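(* Let $\mathtt{B}$ be a left exact comonad on a small complete category $\mathcal{C}$. Then every pseudo-para-cyclic $\mathtt{B}$-comodule $T_\bullet\colon\Lambda_{\mathbb{N}}^{op}\to\mathcal{C}^{\mathtt{B}}$ admits an approximation, denoted $\mathrm{App}_\Lambda(T^{\mathtt{B}}_\bullet)$, within the category of cyclic $\mathtt{B}$-comodules.
   Context: **Approximations.** Let $\mathcal{E}$ be a small category and $\mathcal{D}$ a subcategory. For an object $X$ of $\mathcal{E}$, a morphism $u_X\colon\mathrm{App}_{\mathcal{D}}(X)\to X$ is called the approximation of $X$ within $\mathcal{D}$ if (i) $\mathrm{App}_{\mathcal{D}}(X)$ is an object of $\mathcal{D}$, and (ii) every morphism $v\colon D\to X$ with $D\in Ob(\mathcal{D})$ factors uniquely through $u_X$, i.e. there is a unique morphism $v'\colon D\to\mathrm{App}_{\mathcal{D}}(X)$ with $v=u_X\circ v'$. **Comonads and comodules.** A comonad on $\mathcal{C}$ is an endofunctor $\mathtt{B}$ with natural transformations $\Delta\colon\mathtt{B}\to\mathtt{B}^2$ and $\varepsilon\colon\mathtt{B}\to\mathrm{id}_{\mathcal{C}}$ such that $\mathtt{B}(\Delta_X)\Delta_X=\Delta_{\mathtt{B}(X)}\Delta_X$ and $\mathtt{B}(\varepsilon_X)\Delta_X=\mathrm{id}=\varepsilon_{\mathtt{B}(X)}\Delta_X$. It is left exact if it commutes with arbitrary small limits: $\lim_{\mathcal I}(\mathtt{B}\circ F)\cong\mathtt{B}(\lim_{\mathcal I}F)$ for any functor $F\colon\mathcal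 I\to\mathcal C$ from a small category. A $\mathtt{B}$-comodule is an object $X$ with a morphism $\rho_X\colon X\to\mathtt{B}(X)$ such that $\Delta_X\rho_X=\mathtt{B}(\rho_X)\rho_X$ and $\varepsilon_X\rho_X=\mathrm{id}_X$. A morphism of $\mathtt{B}$-comodules is a morphism $f\colon X\to Y$ of $\mathcal{C}$ with $\mathtt{B}(f)\rho_X=\rho_Yf$. $\mathcal{C}^{\mathtt{B}}$ denotes the full subcategory of $\mathtt{B}$-comodules in $\mathcal{C}$ (so its morphisms are all morphisms of $\mathcal{C}$ between $\mathtt{B}$-comodules), and $\mathbf{CoMod}(\mathtt{B})$ denotes the category of $\mathtt{B}$-comodules and their morphisms. **Index categories.** $\Lambda_{\mathbb{N}}$ has objects $[n]$, $n\ge0$, and is generated by $\partial^n_j\colon[n]\to[n+1]$ ($0\le j\le n+1$), $\sigma^n_i\colon[n+1]\to[n]$ ($0\le i\le n$) and $\tau_n^\ell\colon[n]\to[n]$ ($\ell\in\mathbb{N}$, with $\tau_n^0$ the identity), subject to: - $\partial^{n+1}_i\partial^n_j=\partial^{n+1}_{j+1}\partial^n_i$ and $\sigma^{n-1}_j\sigma^n_i=\sigma^{n-1}_i\sigma^n_{j+1}$ for $i\le j$, and $\tau_n^s\tau_n^t=\tau_n^{s+t}$; - $\sigma^n_i\partial^n_i=\sigma^n_i\partial^n_{i+1}=\tau_n^0$; - $\partial^n_i\sigma^n_j=\sigma^{n+1}_{j+1}\partial^{n+1}_i$ if $i\le j$, and $\partial^n_i\sigma^n_j=\sigma^{n+1}_j\partial^{n+1}_{i+1}$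 if $i>j$; - $\partial^n_j\tau_n^i=\tau_{n+1}^{i+p}\partial^n_q$ where $i+j=(n+1)p+q$ with $0\le q\le n$; - $\tau_n^i\sigma^n_j=\sigma^n_q\tau_{n+1}^{i+p}$ where $-i+j=(n+1)(-p)+q$ with $0\le q\le n$. $\Lambda_{\mathbb{Z}}$ is the extension of $\Lambda_{\mathbb{N}}$ in which $\tau_n^i$ is allowed for all $i\in\mathbb{Z}$, and Connes' cyclic category $\Lambda$ is the quotient of $\Lambda_{\mathbb{Z}}$ by the relations $\tau_n^{n+1}=\mathrm{id}_n$ for $n\ge0$. $\Lambda_+$ is the subcategory of $\Lambda_{\mathbb{N}}$ generated by the $\partial^n_j$ and $\sigma^n_i$ with only $0\le j\le n$ and $0\le i\le n$. **Pseudo-para-cyclic and cyclic comodules.** A cyclic module in a category is a contravariant functor from $\Lambda$ to it; a para-cyclic module is a contravariant functor from $\Lambda_{\mathbb{N}}$ or $\Lambda_{\mathbb{Z}}$. A morphism between (para-)cyclic modules is just a natural transformation of functors. A pseudo-para-cyclic $\mathtt{B}$-comodule is a para-cyclic object $T_\bullet\colon\Lambda_{\mathbb{N}}^{op}\to\mathcal{C}^{\mathtt{B}}$ whose restriction to $\Lambda_+^{op}$ factors through $\mathbf{CoMod}(\mathtt{B})$. A cyclic $\mathtt{B}$-comodule is a cyclic module in $\mathbf{CoMod}(\mathtt{B})$. *)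

theory Defs
  imports Main "HOL-Library.FuncSet"
begin

section \<open>Categories, functors, natural transformations\<close>

record ('o, 'a) category =
  Obj :: "'o set"
  Arr :: "'a set"
  Dom :: "'a \<Rightarrow> 'o"
  Cod :: "'a \<Rightarrow> 'o"
  Id :: "'o \<Rightarrow> 'a"
  Comp :: "'a \<Rightarrow> 'a \<Rightarrow> 'a" (infixl "\<odot>\<index>" 70)

definition hom :: "('o, 'a) category \<Rightarrow> 'o \<Rightarrow> 'o \<Rightarrow> 'a set" where
  "hom C x y = {f \<in> Arr C. Dom C f = x \<and> Cod C f = y}"

locale category =
  fixes C :: "('o, 'a) category" (structure)
  assumes Dom_in: "f \<in> Arr C \<Longrightarrow> Dom C f \<in> Obj C"
    and Cod_in: "f \<in> Arr C \<Longrightarrow> Cod C f \<in> Obj C"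
    and Id_in: "x \<in> Obj C \<Longrightarrow> Id C x \<in> hom C x x"
    and Comp_in: "\<lbrakk>f \<in> hom C x y; g \<in> hom C y z\<rbrakk> \<Longrightarrow> g \<odot> f \<in> hom C x z"
    and Id_left: "f \<in> hom C x y \<Longrightarrow> Id C y \<odot> f = f"
    and Id_right: "f \<in> hom C x y \<Longrightarrow> f \<odot> Id C x = f"
    and Comp_assoc: "\<lbrakk>f \<in> hom C w x; g \<in> hom C x y; h \<in> hom C y z\<rbrakk>
      \<Longrightarrow> (h \<odot> g) \<odot> f = h \<odot> (g \<odot> f)"

definition op_cat :: "('o, 'a) category \<Rightarrow> ('o, 'a) category" where
  "op_cat C = \<lparr>Obj = Obj C, Arr = Arr C, Dom = Cod C, Cod = Dom C, Id = Id C,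
     Comp = (\<lambda>f g. g \<odot>\<^bsub>C\<^esub> f)\<rparr>"

definition subcategory :: "('o, 'a) category \<Rightarrow> ('o, 'a) category \<Rightarrow> bool" where
  "subcategory D E \<longleftrightarrow> category D \<and> category E \<and> Obj D \<subseteq> Obj E \<and> Arr D \<subseteq> Arr E \<and>
     (\<forall>f\<in>Arr D. Dom D f = Dom E f \<and> Cod D f = Cod E f) \<and>
     (\<forall>x\<in>Obj D. Id D x = Id E x) \<and>
     (\<forall>f\<in>Arr D. \<forall>g\<in>Arr D. Cod D f = Dom D g \<longrightarrow> g \<odot>\<^bsub>D\<^esub> f = g \<odot>\<^bsub>E\<^esub> f)"

record ('o, 'a, 'p, 'b) funct =
  OMap :: "'o \<Rightarrow> 'p"
  AMap :: "'a \<Rightarrow> 'b"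

definition is_functor ::
  "('o, 'a) category \<Rightarrow> ('p, 'b) category \<Rightarrow> ('o, 'a, 'p, 'b) funct \<Rightarrow> bool" where
  "is_functor C D F \<longleftrightarrow>
     (\<forall>x\<in>Obj C. OMap F x \<in> Obj D) \<and>
     (\<forall>f\<in>Arr C. AMap F f \<in> hom D (OMap F (Dom C f)) (OMap F (Cod C f))) \<and>
     (\<forall>x\<in>Obj C. AMap F (Id C x) = Id D (OMap F x)) \<and>
     (\<forall>f\<in>Arr C. \<forall>g\<in>Arr C. Cod C f = Dom C g \<longrightarrow>
        AMap F (g \<odot>\<^bsub>C\<^esub> f) = AMap F g \<odot>\<^bsub>D\<^esub> AMap F f)"

definition id_functor :: "('o, 'a) category \<Rightarrow> ('o, 'a, 'o, 'a) funct" where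
  "id_functor C = \<lparr>OMap = (\<lambda>x\<in>Obj C. x), AMap = (\<lambda>f\<in>Arr C. f)\<rparr>"

text \<open>The composite \<open>G \<circ> F\<close> of functors, where \<open>C\<close> is the source category of \<open>F\<close>.\<close>

definition functor_comp ::
  "('o, 'a) category \<Rightarrow> ('p, 'b, 'q, 'c) funct \<Rightarrow> ('o, 'a, 'p, 'b) funct
    \<Rightarrow> ('o, 'a, 'q, 'c) funct" where
  "functor_comp C G F =
     \<lparr>OMap = (\<lambda>x\<in>Obj C. OMap G (OMap F x)), AMap = (\<lambda>f\<in>Arr C. AMap G (AMap F f))\<rparr>"

definition nat_trans ::
  "('o, 'a) category \<Rightarrow> ('p, 'b) category \<Rightarrow> ('o, 'a, 'p, 'b) funct \<Rightarrow> ('o, 'a, 'p, 'b) funct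
    \<Rightarrow> ('o \<Rightarrow> 'b) \<Rightarrow> bool" where
  "nat_trans C D F G \<eta> \<longleftrightarrow>
     (\<forall>x\<in>Obj C. \<eta> x \<in> hom D (OMap F x) (OMap G x)) \<and>
     (\<forall>f\<in>Arr C. AMap G f \<odot>\<^bsub>D\<^esub> \<eta> (Dom C f) = \<eta> (Cod C f) \<odot>\<^bsub>D\<^esub> AMap F f)"

text \<open>Functors and families of components are normalised to be \<open>undefined\<close> outside their
  domains, so that equality in HOL is equality of functors and of natural transformations.
  An arrow is a triple (source, components, target).\<close>

definition functor_cat :: "('o, 'a) category \<Rightarrow> ('p, 'b) category \<Rightarrow>
    (('o, 'a, 'p, 'b) funct,
     ('o, 'a, 'p, 'b) funct \<times> ('o \<Rightarrow> 'b) \<times> ('o, 'a, 'p, 'b) funct) category" where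
  "functor_cat C D =
     (let Fs = {F. is_functor C D F \<and> OMap F \<in> extensional (Obj C) \<and> AMap F \<in> extensional (Arr C)}
      in \<lparr>Obj = Fs,
          Arr = {(F, \<eta>, G). F \<in> Fs \<and> G \<in> Fs \<and> nat_trans C D F G \<eta> \<and> \<eta> \<in> extensional (Obj C)},
          Dom = (\<lambda>(F, \<eta>, G). F),
          Cod = (\<lambda>(F, \<eta>, G). G),
          Id = (\<lambda>F. (F, (\<lambda>x\<in>Obj C. Id D (OMap F x)), F)),
          Comp = (\<lambda>(G, \<beta>, H) (F, \<alpha>, G'). (F, (\<lambda>x\<in>Obj C. \<beta> x \<odot>\<^bsub>D\<^esub> \<alpha> x), H))\<rparr>)"


section \<open>Small limits\<close>

text \<open>A category is small if its objects and arrows are elements of a fixed type \<open>'s\<close>, so that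
  the cardinality of \<open>'s\<close> is the bound defining smallness.\<close>

definition cone ::
  "('i, 'j) category \<Rightarrow> ('o, 'a) category \<Rightarrow> ('i, 'j, 'o, 'a) funct \<Rightarrow> 'o \<Rightarrow> ('i \<Rightarrow> 'a) \<Rightarrow> bool" where
  "cone I C F x \<pi> \<longleftrightarrow> x \<in> Obj C \<and> (\<forall>i\<in>Obj I. \<pi> i \<in> hom C x (OMap F i)) \<and>
     (\<forall>a\<in>Arr I. AMap F a \<odot>\<^bsub>C\<^esub> \<pi> (Dom I a) = \<pi> (Cod I a))"

definition limit_cone ::
  "('i, 'j) category \<Rightarrow> ('o, 'a) category \<Rightarrow> ('i, 'j, 'o, 'a) funct \<Rightarrow> 'o \<Rightarrow> ('i \<Rightarrow> 'a) \<Rightarrow> bool" where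
  "limit_cone I C F x \<pi> \<longleftrightarrow> cone I C F x \<pi> \<and>
     (\<forall>y \<psi>. cone I C F y \<psi> \<longrightarrow> (\<exists>!f. f \<in> hom C y x \<and> (\<forall>i\<in>Obj I. \<pi> i \<odot>\<^bsub>C\<^esub> f = \<psi> i)))"

definition small_complete :: "'s itself \<Rightarrow> ('o, 'a) category \<Rightarrow> bool" where
  "small_complete S C \<longleftrightarrow>
     (\<forall>(I :: ('s, 's) category) F. category I \<and> is_functor I C F \<longrightarrow> (\<exists>x \<pi>. limit_cone I C F x \<pi>))"

text \<open>The isomorphism \<open>lim (B \<circ> F) \<cong> B (lim F)\<close> is the canonical one: \<open>B\<close> takes limit cones
  to limit cones.\<close>

definition left_exact ::
  "'s itself \<Rightarrow> ('o, 'a) category \<Rightarrow> ('o, 'a, 'o, 'a) funct \<Rightarrow> bool" where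
  "left_exact S C B \<longleftrightarrow>
     (\<forall>(I :: ('s, 's) category) F x \<pi>. category I \<and> is_functor I C F \<and> limit_cone I C F x \<pi> \<longrightarrow>
        limit_cone I C (functor_comp I B F) (OMap B x) (\<lambda>i. AMap B (\<pi> i)))"


section \<open>Comonads and comodules\<close>

record ('o, 'a) comonad_data =
  cfun :: "('o, 'a, 'o, 'a) funct"
  comult :: "'o \<Rightarrow> 'a"
  counit :: "'o \<Rightarrow> 'a"

definition comonad :: "('o, 'a) category \<Rightarrow> ('o, 'a) comonad_data \<Rightarrow> bool" where
  "comonad C W \<longleftrightarrow>
     (let B = cfun W; \<Delta> = comult W; \<epsilon> = counit W in
        is_functor C C B \<and>
        nat_trans C C B (functor_comp C B B) \<Delta> \<and>
        nat_trans C C B (id_functor C) \<epsilon> \<and>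
        (\<forall>X\<in>Obj C.
           AMap B (\<Delta> X) \<odot>\<^bsub>C\<^esub> \<Delta> X = \<Delta> (OMap B X) \<odot>\<^bsub>C\<^esub> \<Delta> X \<and>
           AMap B (\<epsilon> X) \<odot>\<^bsub>C\<^esub> \<Delta> X = Id C (OMap B X) \<and>
           \<epsilon> (OMap B X) \<odot>\<^bsub>C\<^esub> \<Delta> X = Id C (OMap B X)))"

definition comodules :: "('o, 'a) category \<Rightarrow> ('o, 'a) comonad_data \<Rightarrow> ('o \<times> 'a) set" where
  "comodules C W = {(X, \<rho>). X \<in> Obj C \<and> \<rho> \<in> hom C X (OMap (cfun W) X) \<and>
     comult W X \<odot>\<^bsub>C\<^esub> \<rho> = AMap (cfun W) \<rho> \<odot>\<^bsub>C\<^esub> \<rho> \<and>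
     counit W X \<odot>\<^bsub>C\<^esub> \<rho> = Id C X}"

text \<open>\<open>C\<^sup>B\<close>: an arrow from \<open>(X, \<rho>)\<close> to \<open>(Y, \<sigma>)\<close> is any arrow from \<open>X\<close> to \<open>Y\<close> in \<open>C\<close>.\<close>

definition CB :: "('o, 'a) category \<Rightarrow> ('o, 'a) comonad_data
    \<Rightarrow> ('o \<times> 'a, ('o \<times> 'a) \<times> 'a \<times> ('o \<times> 'a)) category" where
  "CB C W =
     \<lparr>Obj = comodules C W,
      Arr = {(M, f, N). M \<in> comodules C W \<and> N \<in> comodules C W \<and> f \<in> hom C (fst M) (fst N)},
      Dom = (\<lambda>(M, f, N). M),
      Cod = (\<lambda>(M, f, N). N),
      Id = (\<lambda>M. (M, Id C (fst M), M)),
      Comp = (\<lambda>(N, g, P) (M, f, N'). (M, g \<odot>\<^bsub>C\<^esub> f, P))\<rparr>"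

definition CoMod :: "('o, 'a) category \<Rightarrow> ('o, 'a) comonad_data
    \<Rightarrow> ('o \<times> 'a, ('o \<times> 'a) \<times> 'a \<times> ('o \<times> 'a)) category" where
  "CoMod C W = (CB C W)
     \<lparr>Arr := {((X, \<rho>), f, (Y, \<sigma>)). ((X, \<rho>), f, (Y, \<sigma>)) \<in> Arr (CB C W) \<and>
               AMap (cfun W) f \<odot>\<^bsub>C\<^esub> \<rho> = \<sigma> \<odot>\<^bsub>C\<^esub> f}\<rparr>"


section \<open>The index categories\<close>

text \<open>\<open>Face n j\<close>, \<open>Degen n i\<close> and \<open>Cyc n l\<close> stand for \<open>\<partial>\<^sup>n\<^sub>j\<close>, \<open>\<sigma>\<^sup>n\<^sub>i\<close> and \<open>\<tau>\<^sub>n\<^sup>l\<close>.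
  The object \<open>[n]\<close> is the number \<open>n\<close>.\<close>

datatype gen = Face nat nat | Degen nat nat | Cyc nat int

fun gen_dom :: "gen \<Rightarrow> nat" where
  "gen_dom (Face n j) = n"
| "gen_dom (Degen n i) = n + 1"
| "gen_dom (Cyc n l) = n"

fun gen_cod :: "gen \<Rightarrow> nat" where
  "gen_cod (Face n j) = n + 1"
| "gen_cod (Degen n i) = n"
| "gen_cod (Cyc n l) = n"

definition gens_Z :: "gen set" where
  "gens_Z = {Face n j | n j. j \<le> n + 1} \<union> {Degen n i | n i. i \<le> n} \<union> {Cyc n l | n l. True}"

definition gens_N :: "gen set" where
  "gens_N = {Face n j | n j. j \<le> n + 1} \<union> {Degen n i | n i. i \<le> n} \<union> {Cyc n l | n l. 0 \<le> l}"

definition gens_plus :: "gen set" where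
  "gens_plus = {Face n j | n j. j \<le> n} \<union> {Degen n i | n i. i \<le> n}"

text \<open>\<open>path G m w n\<close>: the word \<open>w = [g\<^sub>1, \<dots>, g\<^sub>k]\<close> over \<open>G\<close>, read as the composite
  \<open>g\<^sub>1 \<circ> \<dots> \<circ> g\<^sub>k\<close>, goes from \<open>[m]\<close> to \<open>[n]\<close>.\<close>

fun path :: "gen set \<Rightarrow> nat \<Rightarrow> gen list \<Rightarrow> nat \<Rightarrow> bool" where
  "path G m [] n \<longleftrightarrow> m = n"
| "path G m (g # w) n \<longleftrightarrow> g \<in> G \<and> gen_cod g = n \<and> path G m w (gen_dom g)"

text \<open>In \<open>ss\<close> the upper index \<open>n\<close> is shifted by one.\<close>

inductive para_rel :: "gen list \<Rightarrow> gen list \<Rightarrow> bool" where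
  dd: "\<lbrakk>i \<le> j; j \<le> n + 1\<rbrakk> \<Longrightarrow> para_rel [Face (n+1) i, Face n j] [Face (n+1) (j+1), Face n i]"
| ss: "\<lbrakk>i \<le> j; j \<le> n\<rbrakk> \<Longrightarrow> para_rel [Degen n j, Degen (n+1) i] [Degen n i, Degen (n+1) (j+1)]"
| tt: "para_rel [Cyc n s, Cyc n t] [Cyc n (s + t)]"
| t0: "para_rel [Cyc n 0] []"
| sd0: "i \<le> n \<Longrightarrow> para_rel [Degen n i, Face n i] [Cyc n 0]"
| sd1: "i \<le> n \<Longrightarrow> para_rel [Degen n i, Face n (i+1)] [Cyc n 0]"
| ds0: "\<lbrakk>i \<le> j; j \<le> n\<rbrakk>
    \<Longrightarrow> para_rel [Face n i, Degen n j] [Degen (n+1) (j+1), Face (n+1) i]"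
| ds1: "\<lbrakk>j < i; i \<le> n + 1; j \<le> n\<rbrakk>
    \<Longrightarrow> para_rel [Face n i, Degen n j] [Degen (n+1) j, Face (n+1) (i+1)]"
| dt: "\<lbrakk>j \<le> n + 1; i + int j = (int n + 1) * p + int q; q \<le> n\<rbrakk>
    \<Longrightarrow> para_rel [Face n j, Cyc n i] [Cyc (n+1) (i + p), Face n q]"
| ts: "\<lbrakk>j \<le> n; - i + int j = (int n + 1) * (- p) + int q; q \<le> n\<rbrakk>
    \<Longrightarrow> para_rel [Cyc n i, Degen n j] [Degen n q, Cyc (n+1) (i + p)]"

inductive cyclic_rel :: "gen list \<Rightarrow> gen list \<Rightarrow> bool" where
  para: "para_rel v w \<Longrightarrow> cyclic_rel v w"
| cyc: "cyclic_rel [Cyc n (int n + 1)] []"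

text \<open>The congruence on paths over \<open>G\<close> generated by \<open>R\<close>.\<close>

inductive path_cong ::
  "gen set \<Rightarrow> (gen list \<Rightarrow> gen list \<Rightarrow> bool) \<Rightarrow> nat \<Rightarrow> gen list \<Rightarrow> gen list \<Rightarrow> nat \<Rightarrow> bool"
  for G R where
  base: "\<lbrakk>R v w; path G m v n; path G m w n\<rbrakk> \<Longrightarrow> path_cong G R m v w n"
| refl: "path G m w n \<Longrightarrow> path_cong G R m w w n"
| sym: "path_cong G R m v w n \<Longrightarrow> path_cong G R m w v n"
| trans: "\<lbrakk>path_cong G R m u v n; path_cong G R m v w n\<rbrakk> \<Longrightarrow> path_cong G R m u w n"
| comp: "\<lbrakk>path_cong G R l v v' m; path_cong G R m w w' n\<rbrakk>
    \<Longrightarrow> path_cong G R l (w @ v) (w' @ v') n"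

definition path_class ::
  "gen set \<Rightarrow> (gen list \<Rightarrow> gen list \<Rightarrow> bool) \<Rightarrow> nat \<Rightarrow> gen list \<Rightarrow> nat \<Rightarrow> gen list set" where
  "path_class G R m w n = {v. path_cong G R m w v n}"

definition presented :: "gen set \<Rightarrow> (gen list \<Rightarrow> gen list \<Rightarrow> bool)
    \<Rightarrow> (nat, nat \<times> gen list set \<times> nat) category" where
  "presented G R =
     \<lparr>Obj = UNIV,
      Arr = {(m, path_class G R m w n, n) | m w n. path G m w n},
      Dom = (\<lambda>(m, V, n). m),
      Cod = (\<lambda>(m, V, n). n),
      Id = (\<lambda>n. (n, path_class G R n [] n, n)),
      Comp = (\<lambda>(m', W, n) (l, V, m). (l, \<Union>w\<in>W. \<Union>v\<in>V. path_class G R l (w @ v) n, n))\<rparr>"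

definition Lambda_N :: "(nat, nat \<times> gen list set \<times> nat) category" where
  "Lambda_N = presented gens_N para_rel"

definition Lambda :: "(nat, nat \<times> gen list set \<times> nat) category" where
  "Lambda = presented gens_Z cyclic_rel"

definition Lambda_plus :: "(nat, nat \<times> gen list set \<times> nat) category" where
  "Lambda_plus = Lambda_N
     \<lparr>Arr := {(m, path_class gens_N para_rel m w n, n) | m w n. path gens_plus m w n}\<rparr>"

text \<open>The canonical functor from \<open>\<Lambda>\<^sub>N\<close> to \<open>\<Lambda>\<close>, also used as a functor between the opposites.\<close>

definition Lambda_proj ::
  "(nat, nat \<times> gen list set \<times> nat, nat, nat \<times> gen list set \<times> nat) funct" where
  "Lambda_proj = \<lparr>OMap = (\<lambda>n. n),
     AMap = (\<lambda>(m, W, n). (m, \<Union>w\<in>W. path_class gens_Z cyclic_rel m w n, n))\<rparr>"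


section \<open>Pseudo-para-cyclic and cyclic comodules\<close>

type_synonym ('o, 'a) para_obj =
  "(nat, nat \<times> gen list set \<times> nat, 'o \<times> 'a, ('o \<times> 'a) \<times> 'a \<times> ('o \<times> 'a)) funct"

type_synonym ('o, 'a) para_mor =
  "('o, 'a) para_obj \<times> (nat \<Rightarrow> ('o \<times> 'a) \<times> 'a \<times> ('o \<times> 'a)) \<times> ('o, 'a) para_obj"

definition pseudo_para_cyclic ::
  "('o, 'a) category \<Rightarrow> ('o, 'a) comonad_data \<Rightarrow> ('o, 'a) para_obj set" where
  "pseudo_para_cyclic C W =
     {T \<in> Obj (functor_cat (op_cat Lambda_N) (CB C W)). is_functor (op_cat Lambda_plus) (CoMod C W) T}"

text \<open>Morphisms of pseudo-para-cyclic comodules are natural transformations of functors into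
  \<open>C\<^sup>B\<close>, with no colinearity condition on the components.\<close>

definition PPC :: "('o, 'a) category \<Rightarrow> ('o, 'a) comonad_data
    \<Rightarrow> (('o, 'a) para_obj, ('o, 'a) para_mor) category" where
  "PPC C W = (functor_cat (op_cat Lambda_N) (CB C W))
     \<lparr>Obj := pseudo_para_cyclic C W,
      Arr := {(S, \<eta>, T) \<in> Arr (functor_cat (op_cat Lambda_N) (CB C W)).
               S \<in> pseudo_para_cyclic C W \<and> T \<in> pseudo_para_cyclic C W}\<rparr>"

text \<open>The wide subcategory of morphisms that restrict along \<open>\<Lambda>\<^sub>+\<close> to natural transformations of
  functors into \<open>CoMod\<close>. As \<open>\<Lambda>\<^sub>+\<close> contains all objects \<open>[n]\<close>, this says that every component is a
  morphism of comodules.\<close>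

definition PPC_colin :: "('o, 'a) category \<Rightarrow> ('o, 'a) comonad_data
    \<Rightarrow> (('o, 'a) para_obj, ('o, 'a) para_mor) category" where
  "PPC_colin C W = (PPC C W)
     \<lparr>Arr := {(S, \<eta>, T) \<in> Arr (PPC C W). nat_trans (op_cat Lambda_plus) (CoMod C W) S T \<eta>}\<rparr>"

text \<open>The functor category \<open>[\<Lambda>\<^sup>o\<^sup>p, CoMod]\<close>, viewed inside \<open>[\<Lambda>\<^sub>N\<^sup>o\<^sup>p, C\<^sup>B]\<close> by precomposition
  with \<open>\<Lambda>\<^sub>N \<rightarrow> \<Lambda>\<close>. This does not change the components of natural transformations.\<close>

definition cyclic_to_para :: "('o, 'a) para_obj \<Rightarrow> ('o, 'a) para_obj" where
  "cyclic_to_para S = functor_comp (op_cat Lambda_N) S Lambda_proj"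

definition CycCoMod :: "('o, 'a) category \<Rightarrow> ('o, 'a) comonad_data
    \<Rightarrow> (('o, 'a) para_obj, ('o, 'a) para_mor) category" where
  "CycCoMod C W = (functor_cat (op_cat Lambda_N) (CB C W))
     \<lparr>Obj := cyclic_to_para ` Obj (functor_cat (op_cat Lambda) (CoMod C W)),
      Arr := (\<lambda>(S, \<eta>, T). (cyclic_to_para S, \<eta>, cyclic_to_para T)) `
               Arr (functor_cat (op_cat Lambda) (CoMod C W))\<rparr>"


section \<open>Approximations\<close>

text \<open>\<open>u : A \<rightarrow> X\<close> is the approximation of \<open>X\<close> within the subcategory \<open>D\<close> of \<open>E\<close>. The
  subcategory need not be full; the factorising morphism \<open>v'\<close>, whose source and target are objects
  of \<open>D\<close>, is a morphism of \<open>D\<close>.\<close>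

definition is_approximation ::
  "('o, 'a) category \<Rightarrow> ('o, 'a) category \<Rightarrow> 'o \<Rightarrow> 'o \<Rightarrow> 'a \<Rightarrow> bool" where
  "is_approximation E D X A u \<longleftrightarrow> subcategory D E \<and> X \<in> Obj E \<and>
     A \<in> Obj D \<and> u \<in> hom E A X \<and>
     (\<forall>Y\<in>Obj D. \<forall>v\<in>hom E Y X. \<exists>!v'. v' \<in> hom D Y A \<and> v = u \<odot>\<^bsub>E\<^esub> v')"

end

theory Submission
  imports Defs "HOL-Library.Countable_Set"
begin

text \<open>
  Write \<open>\<rho>\<close> for coactions, \<open>\<Delta>\<close> and \<open>\<epsilon>\<close> for the comonad structure.  Sending an arrow \<open>v : D \<rightarrow> Z\<close>
  of \<open>C\<close> to \<open>B(v) \<rho>\<^sub>D\<close> identifies arrows from a comodule \<open>D\<close> to \<open>Z\<close> with colinear maps from \<open>D\<close>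
  to the cofree comodule \<open>B(Z)\<close>; the inverse is composition with \<open>\<epsilon>\<close>.  Applied in every degree, this
  identifies transformations from a cyclic comodule \<open>D\<close> to \<open>T\<close>, with arbitrary components in \<open>C\<close>,
  with colinear transformations \<open>D \<rightarrow> B T\<close>.  The gain is that \<open>B T\<close> is a para-cyclic object of
  comodules, although the cyclic operators of \<open>T\<close> need not be colinear.  The approximation is cut out
  of \<open>B T\<close> by equations that the transformations from cyclic comodules satisfy.

  For arbitrary components one equation per degree suffices: the arrows \<open>\<tau>\<^sub>n\<^sup>n\<^sup>+\<^sup>1\<close> are central in
  \<open>\<Lambda>\<^sub>N\<close>, hence act naturally on \<open>B T\<close>, and they act trivially on a cyclic comodule; the approximation
  is the equalizer of this action with the identity.  For colinear components one adds, for every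
  arrow \<open>f : [n] \<rightarrow> [m]\<close> of \<open>\<Lambda>\<^sub>N\<close>, the equation \<open>\<rho>\<^sub>n T(f) \<epsilon> x = B(T(f)) x\<close> in degree \<open>m\<close>.  For the identity
  \<open>f\<close> it says that \<open>\<epsilon> x\<close> is colinear if \<open>x\<close> is; the other \<open>f\<close> make the family of equations stable under
  the action of \<open>\<Lambda>\<^sub>N\<close> on \<open>B T\<close>.  Lemma \<open>cyclic_comodule_cover\<close> treats all countable stable families of
  equations that contain the one for \<open>\<tau>\<^sub>n\<^sup>n\<^sup>+\<^sup>1\<close>.

  Two things have to be supplied.  First, the solutions of countably many equations \<open>a x = b x\<close> in
  \<open>B(X)\<close> form a comodule (\<open>equalizer_comodule_exists\<close>): \<open>a\<close> and \<open>b\<close> may be replaced by colinear maps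
  between cofree comodules, and \<open>B\<close> preserves joint equalizers, so that the coaction of \<open>B(X)\<close>
  restricts.  Countable diagrams are small because the type that bounds the size is infinite.  Second,
  cyclic comodules are exactly the functors from \<open>\<Lambda>\<^sub>N\<^sup>o\<^sup>p\<close> to comodules that send all \<open>\<tau>\<^sub>n\<^sup>n\<^sup>+\<^sup>1\<close> to identities,
  and their morphisms are all natural transformations between these (\<open>Obj_CycCoMod\<close>, \<open>Arr_CycCoMod\<close>).
  This holds because \<open>\<Lambda>\<^sub>N \<rightarrow> \<Lambda>\<close> is the identity on objects, is full, and identifies two words only if
  they agree after the exponents in \<open>\<tau>\<^sub>n\<^sup>l\<close> are reduced modulo \<open>n + 1\<close> and \<open>\<tau>\<^sub>n\<^sup>n\<^sup>+\<^sup>1\<close> is made trivial.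
\<close>

section \<open>Categories and functors\<close>

context category
begin

text \<open>The axioms of a category mention hom-sets, whose objects would be extra variables in rewrite
  rules.  Stated through \<open>Dom\<close> and \<open>Cod\<close> they can be used by the simplifier.\<close>

lemma hom_iff: "f \<in> hom C x y \<longleftrightarrow> f \<in> Arr C \<and> Dom C f = x \<and> Cod C f = y"
  by (simp add: hom_def)

lemma Id_arr [simp]:
  assumes "x \<in> Obj C"
  shows "Id C x \<in> Arr C" "Dom C (Id C x) = x" "Cod C (Id C x) = x"
  using Id_in[OF assms] by (auto simp: hom_def)

lemma comp_arr [simp]:
  assumes "f \<in> Arr C" "g \<in> Arr C" "Cod C f = Dom C g"
  shows "g \<odot> f \<in> Arr C" "Dom C (g \<odot> f) = Dom C f" "Cod C (g \<odot> f) = Cod C g"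
  using Comp_in[of f "Dom C f" "Cod C f" g "Cod C g"] assms by (auto simp: hom_def)

lemma assoc:
  assumes "f \<in> Arr C" "g \<in> Arr C" "h \<in> Arr C" "Cod C f = Dom C g" "Cod C g = Dom C h"
  shows "(h \<odot> g) \<odot> f = h \<odot> (g \<odot> f)"
  using Comp_assoc[of f "Dom C f" "Cod C f" g "Cod C g" h "Cod C h"] assms by (auto simp: hom_def)

lemma Id_left_arr [simp]: "f \<in> Arr C \<Longrightarrow> Cod C f = x \<Longrightarrow> Id C x \<odot> f = f"
  using Id_left[of f "Dom C f" x] by (auto simp: hom_def)

lemma Id_right_arr [simp]: "f \<in> Arr C \<Longrightarrow> Dom C f = x \<Longrightarrow> f \<odot> Id C x = f"
  using Id_right[of f x "Cod C f"] by (auto simp: hom_def)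

lemma Dom_Cod_in [simp]: "f \<in> Arr C \<Longrightarrow> Dom C f \<in> Obj C" "f \<in> Arr C \<Longrightarrow> Cod C f \<in> Obj C"
  by (auto intro: Dom_in Cod_in)

end

lemma categoryI:
  assumes "\<And>f. f \<in> Arr C \<Longrightarrow> Dom C f \<in> Obj C \<and> Cod C f \<in> Obj C"
    and "\<And>x. x \<in> Obj C \<Longrightarrow> Id C x \<in> Arr C \<and> Dom C (Id C x) = x \<and> Cod C (Id C x) = x"
    and "\<And>f g. f \<in> Arr C \<Longrightarrow> g \<in> Arr C \<Longrightarrow> Cod C f = Dom C g \<Longrightarrow>
      g \<odot>\<^bsub>C\<^esub> f \<in> Arr C \<and> Dom C (g \<odot>\<^bsub>C\<^esub> f) = Dom C f \<and> Cod C (g \<odot>\<^bsub>C\<^esub> f) = Cod C g"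
    and "\<And>f. f \<in> Arr C \<Longrightarrow> Id C (Cod C f) \<odot>\<^bsub>C\<^esub> f = f \<and> f \<odot>\<^bsub>C\<^esub> Id C (Dom C f) = f"
    and "\<And>f g h. f \<in> Arr C \<Longrightarrow> g \<in> Arr C \<Longrightarrow> h \<in> Arr C \<Longrightarrow> Cod C f = Dom C g \<Longrightarrow>
      Cod C g = Dom C h \<Longrightarrow> (h \<odot>\<^bsub>C\<^esub> g) \<odot>\<^bsub>C\<^esub> f = h \<odot>\<^bsub>C\<^esub> (g \<odot>\<^bsub>C\<^esub> f)"
  shows "category C"
  using assms by unfold_locales (auto simp: hom_def)

lemma op_cat_simps [simp]:
  "Obj (op_cat C) = Obj C" "Arr (op_cat C) = Arr C" "Dom (op_cat C) = Cod C"
  "Cod (op_cat C) = Dom C" "Id (op_cat C) = Id C" "g \<odot>\<^bsub>op_cat C\<^esub> f = f \<odot>\<^bsub>C\<^esub> g"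
  by (auto simp: op_cat_def)

lemma category_op:
  assumes "category C"
  shows "category (op_cat C)"
proof -
  interpret category C by fact
  show ?thesis by (rule categoryI) (auto simp: assoc)
qed

lemma functor_simps:
  assumes "is_functor C D F"
  shows "x \<in> Obj C \<Longrightarrow> OMap F x \<in> Obj D"
    and "f \<in> Arr C \<Longrightarrow> AMap F f \<in> Arr D"
    and "f \<in> Arr C \<Longrightarrow> Dom D (AMap F f) = OMap F (Dom C f)"
    and "f \<in> Arr C \<Longrightarrow> Cod D (AMap F f) = OMap F (Cod C f)"
    and "x \<in> Obj C \<Longrightarrow> AMap F (Id C x) = Id D (OMap F x)"
    and "f \<in> Arr C \<Longrightarrow> g \<in> Arr C \<Longrightarrow> Cod C f = Dom C g \<Longrightarrow>
      AMap F (g \<odot>\<^bsub>C\<^esub> f) = AMap F g \<odot>\<^bsub>D\<^esub> AMap F f"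
  using assms by (auto simp: is_functor_def hom_def)

lemma functor_comp_simps [simp]:
  "x \<in> Obj C \<Longrightarrow> OMap (functor_comp C G F) x = OMap G (OMap F x)"
  "f \<in> Arr C \<Longrightarrow> AMap (functor_comp C G F) f = AMap G (AMap F f)"
  by (auto simp: functor_comp_def)

lemma functor_compose:
  assumes "category I" "is_functor I J F" "is_functor J D G"
  shows "is_functor I D (functor_comp I G F)"
proof -
  interpret category I by fact
  show ?thesis
    using functor_simps[OF assms(2)] functor_simps[OF assms(3)] by (auto simp: is_functor_def hom_def)
qed

text \<open>All categories of comodules and of para-cyclic objects below arise from a functor category
  or from \<open>CB\<close> by cutting down objects and arrows, without changing the structure maps.\<close>

lemma category_restrict:
  assumes "category E" "Ob \<subseteq> Obj E" "Ar \<subseteq> Arr E"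
    and "\<And>f. f \<in> Ar \<Longrightarrow> Dom E f \<in> Ob \<and> Cod E f \<in> Ob" "\<And>x. x \<in> Ob \<Longrightarrow> Id E x \<in> Ar"
    and "\<And>f g. f \<in> Ar \<Longrightarrow> g \<in> Ar \<Longrightarrow> Cod E f = Dom E g \<Longrightarrow> g \<odot>\<^bsub>E\<^esub> f \<in> Ar"
  shows "category (E\<lparr>Obj := Ob, Arr := Ar\<rparr>)"
proof -
  interpret category E by fact
  show ?thesis using assms(2-) by (intro categoryI) (auto simp: assoc subset_iff)
qed

lemma subcategory_restrict:
  assumes "category (E\<lparr>Obj := Ob, Arr := Ar\<rparr>)" "category (E\<lparr>Obj := Ob', Arr := Ar'\<rparr>)"
    and "Ob \<subseteq> Ob'" "Ar \<subseteq> Ar'"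
  shows "subcategory (E\<lparr>Obj := Ob, Arr := Ar\<rparr>) (E\<lparr>Obj := Ob', Arr := Ar'\<rparr>)"
  using assms by (simp add: subcategory_def)

lemma Arr_functor_cat:
  "(F, \<eta>, G) \<in> Arr (functor_cat I D) \<longleftrightarrow> F \<in> Obj (functor_cat I D) \<and> G \<in> Obj (functor_cat I D) \<and>
    nat_trans I D F G \<eta> \<and> \<eta> \<in> extensional (Obj I)"
  by (auto simp: functor_cat_def Let_def)

lemma Obj_functor_cat:
  "F \<in> Obj (functor_cat I D) \<longleftrightarrow>
    is_functor I D F \<and> OMap F \<in> extensional (Obj I) \<and> AMap F \<in> extensional (Arr I)"
  by (auto simp: functor_cat_def Let_def)

lemma functor_cat_simps [simp]:
  "Dom (functor_cat I D) (F, \<eta>, G) = F" "Cod (functor_cat I D) (F, \<eta>, G) = G"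
  "Id (functor_cat I D) F = (F, (\<lambda>x\<in>Obj I. Id D (OMap F x)), F)"
  "(G, \<beta>, H) \<odot>\<^bsub>functor_cat I D\<^esub> (F, \<alpha>, G') = (F, (\<lambda>x\<in>Obj I. \<beta> x \<odot>\<^bsub>D\<^esub> \<alpha> x), H)"
  by (auto simp: functor_cat_def Let_def)

lemma nat_trans_simps:
  assumes "nat_trans I D F G \<eta>"
  shows "x \<in> Obj I \<Longrightarrow> \<eta> x \<in> Arr D" "x \<in> Obj I \<Longrightarrow> Dom D (\<eta> x) = OMap F x"
    "x \<in> Obj I \<Longrightarrow> Cod D (\<eta> x) = OMap G x"
    "f \<in> Arr I \<Longrightarrow> AMap G f \<odot>\<^bsub>D\<^esub> \<eta> (Dom I f) = \<eta> (Cod I f) \<odot>\<^bsub>D\<^esub> AMap F f"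
  using assms by (auto simp: nat_trans_def hom_def)

lemma nat_trans_Id:
  assumes "category I" "category D" "is_functor I D F"
  shows "nat_trans I D F F (\<lambda>x\<in>Obj I. Id D (OMap F x))"
proof -
  interpret I: category I by fact
  interpret D: category D by fact
  show ?thesis using functor_simps[OF assms(3)] by (auto simp: nat_trans_def D.hom_iff)
qed

lemma nat_trans_comp:
  assumes "category I" "category D" "is_functor I D F" "is_functor I D G" "is_functor I D H"
    and "nat_trans I D F G \<alpha>" "nat_trans I D G H \<beta>"
  shows "nat_trans I D F H (\<lambda>x\<in>Obj I. \<beta> x \<odot>\<^bsub>D\<^esub> \<alpha> x)"
proof -
  interpret I: category I by fact
  interpret D: category D by fact
  note a = nat_trans_simps[OF assms(6)] and b = nat_trans_simps[OF assms(7)]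
  note [simp] = functor_simps(1-4)[OF assms(3)] functor_simps(1-4)[OF assms(4)]
    functor_simps(1-4)[OF assms(5)] a(1-3) b(1-3)
  have "AMap H f \<odot>\<^bsub>D\<^esub> (\<beta> (Dom I f) \<odot>\<^bsub>D\<^esub> \<alpha> (Dom I f)) = (\<beta> (Cod I f) \<odot>\<^bsub>D\<^esub> \<alpha> (Cod I f)) \<odot>\<^bsub>D\<^esub> AMap F f"
    if f: "f \<in> Arr I" for f
  proof -
    have "AMap H f \<odot>\<^bsub>D\<^esub> (\<beta> (Dom I f) \<odot>\<^bsub>D\<^esub> \<alpha> (Dom I f)) = (\<beta> (Cod I f) \<odot>\<^bsub>D\<^esub> AMap G f) \<odot>\<^bsub>D\<^esub> \<alpha> (Dom I f)"
      using f b(4)[OF f, symmetric] by (simp add: D.assoc)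
    also have "\<dots> = \<beta> (Cod I f) \<odot>\<^bsub>D\<^esub> (\<alpha> (Cod I f) \<odot>\<^bsub>D\<^esub> AMap F f)"
      using f a(4)[OF f] by (simp add: D.assoc)
    finally show ?thesis using f by (simp add: D.assoc)
  qed
  then show ?thesis by (auto simp: nat_trans_def D.hom_iff)
qed

lemma category_functor_cat:
  assumes I: "category I" and D: "category D"
  shows "category (functor_cat I D)"
proof -
  interpret I: category I by fact
  interpret D: category D by fact
  show ?thesis
  proof (rule categoryI, goal_cases)
    case (1 f)
    then show ?case by (cases f) (auto simp: Arr_functor_cat)
  next
    case (2 F)
    then show ?case using nat_trans_Id[OF I D] by (simp add: Arr_functor_cat) (simp add: Obj_functor_cat)
  next
    case (3 f g)
    obtain F \<alpha> G where f: "f = (F, \<alpha>, G)" by (cases f)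
    obtain G' \<beta> H where g: "g = (G', \<beta>, H)" by (cases g)
    have "G' = G" using 3 f g by simp
    then show ?case using 3 nat_trans_comp[OF I D, of F G H \<alpha> \<beta>]
      by (simp add: f g Arr_functor_cat) (simp add: Obj_functor_cat)
  next
    case (4 f)
    obtain F \<alpha> G where f: "f = (F, \<alpha>, G)" by (cases f)
    then have "nat_trans I D F G \<alpha>" "\<alpha> \<in> extensional (Obj I)" using 4 by (auto simp: Arr_functor_cat)
    then show ?case
      using nat_trans_simps[of I D F G \<alpha>] by (auto simp: f intro!: extensionalityI[of _ "Obj I"])
  next
    case (5 f g h)
    obtain F \<alpha> G where f: "f = (F, \<alpha>, G)" by (cases f)
    obtain G' \<beta> H where g: "g = (G', \<beta>, H)" by (cases g)
    obtain H' \<gamma> K where h: "h = (H', \<gamma>, K)" by (cases h)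
    have *: "nat_trans I D F G \<alpha>" "nat_trans I D G H \<beta>" "nat_trans I D H K \<gamma>"
      using 5 f g h by (auto simp: Arr_functor_cat)
    show ?case
      using nat_trans_simps[OF *(1)] nat_trans_simps[OF *(2)] nat_trans_simps[OF *(3)]
      by (auto simp: f g h D.assoc intro!: restrict_ext)
  qed
qed

section \<open>Presented categories\<close>

definition word_arrow ::
  "gen set \<Rightarrow> (gen list \<Rightarrow> gen list \<Rightarrow> bool) \<Rightarrow> nat \<Rightarrow> gen list \<Rightarrow> nat \<Rightarrow> nat \<times> gen list set \<times> nat"
  where "word_arrow G R m w n = (m, path_class G R m w n, n)"

lemma path_append: "path G l (w @ v) n \<longleftrightarrow> (\<exists>m. path G l v m \<and> path G m w n)"
  by (induction w arbitrary: n) auto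

lemma path_cong_path: "path_cong G R m v w n \<Longrightarrow> path G m v n \<and> path G m w n"
  by (induction rule: path_cong.induct) (auto simp: path_append)

lemma path_class_eq: "path_cong G R m v w n \<Longrightarrow> path_class G R m v n = path_class G R m w n"
  by (auto simp: path_class_def intro: path_cong.sym path_cong.trans)

lemma word_arrow_eq: "path_cong G R m v w n \<Longrightarrow> word_arrow G R m v n = word_arrow G R m w n"
  by (simp add: word_arrow_def path_class_eq)

lemma word_arrow_eqD: "path G m v n \<Longrightarrow> word_arrow G R m v n = word_arrow G R m' w n' \<Longrightarrow> path_cong G R m w v n"
  by (auto simp: word_arrow_def path_class_def intro: path_cong.refl)

lemma presented_simps [simp]:
  "Obj (presented G R) = UNIV" "Dom (presented G R) (word_arrow G' R' m w n) = m"
  "Cod (presented G R) (word_arrow G' R' m w n) = n"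
  "Id (presented G R) n = word_arrow G R n [] n"
  by (auto simp: presented_def word_arrow_def)

lemma Arr_presented: "f \<in> Arr (presented G R) \<longleftrightarrow> (\<exists>m w n. path G m w n \<and> f = word_arrow G R m w n)"
  by (auto simp: presented_def word_arrow_def)

text \<open>The composite is defined as a union over all representatives; as the classes of all these
  concatenations agree, one pair of representatives determines it.\<close>

lemma comp_word_arrow:
  assumes "path G l v m" "path G m w n"
  shows "word_arrow G R m w n \<odot>\<^bsub>presented G R\<^esub> word_arrow G R l v m = word_arrow G R l (w @ v) n"
proof -
  have "path_class G R l (w' @ v') n = path_class G R l (w @ v) n"
    if "w' \<in> path_class G R m w n" "v' \<in> path_class G R l v m" for w' v'
    using that path_cong.comp[of G R l v v' m w w' n] path_class_eq[of G R l]
    by (auto simp: path_class_def)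
  moreover have "w \<in> path_class G R m w n" "v \<in> path_class G R l v m"
    using assms by (auto simp: path_class_def intro: path_cong.refl)
  ultimately have "(\<Union>w'\<in>path_class G R m w n. \<Union>v'\<in>path_class G R l v m.
      path_class G R l (w' @ v') n) = path_class G R l (w @ v) n"
    by blast
  then show ?thesis by (simp add: presented_def word_arrow_def)
qed

lemma category_presented: "category (presented G R)"
proof (rule categoryI, goal_cases)
  case (3 f g)
  then obtain m w n v k where *: "f = word_arrow G R m w n" "path G m w n" "g = word_arrow G R n v k"
    "path G n v k"
    by (auto simp: Arr_presented)
  then have "path G m (v @ w) k" by (auto simp: path_append)
  then show ?case using * by (auto simp: Arr_presented comp_word_arrow)
next
  case (4 f)
  then obtain m w n where f: "f = word_arrow G R m w n" and p: "path G m w n"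
    by (auto simp: Arr_presented)
  have "path G n [] n" "path G m [] m" by auto
  then show ?case using comp_word_arrow[OF p, of "[]" n R] comp_word_arrow[of G m "[]" m w n R] p
    by (simp add: f)
next
  case (5 f g h)
  then obtain m w n v k u l where *: "f = word_arrow G R m w n" "path G m w n" "g = word_arrow G R n v k"
    "path G n v k" "h = word_arrow G R k u l" "path G k u l"
    by (auto simp: Arr_presented)
  then have "path G m (v @ w) k" "path G n (u @ v) l" by (auto simp: path_append)
  then show ?case using * by (simp add: comp_word_arrow)
next
  case (2 n)
  have "path G n [] n" by simp
  then have "word_arrow G R n [] n \<in> Arr (presented G R)" unfolding Arr_presented by blast
  then show ?case by simp
qed auto

section \<open>The index categories\<close>

abbreviation arrN :: "nat \<Rightarrow> gen list \<Rightarrow> nat \<Rightarrow> nat \<times> gen list set \<times> nat" where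
  "arrN \<equiv> word_arrow gens_N para_rel"

abbreviation arrL :: "nat \<Rightarrow> gen list \<Rightarrow> nat \<Rightarrow> nat \<times> gen list set \<times> nat" where
  "arrL \<equiv> word_arrow gens_Z cyclic_rel"

lemma gens_simps [simp]:
  "Face n j \<in> gens_Z \<longleftrightarrow> j \<le> n + 1" "Degen n i \<in> gens_Z \<longleftrightarrow> i \<le> n" "Cyc n l \<in> gens_Z"
  "Face n j \<in> gens_N \<longleftrightarrow> j \<le> n + 1" "Degen n i \<in> gens_N \<longleftrightarrow> i \<le> n" "Cyc n l \<in> gens_N \<longleftrightarrow> 0 \<le> l"
  by (auto simp: gens_Z_def gens_N_def)

lemma gens_plus_subset: "gens_plus \<subseteq> gens_N" and gens_N_subset: "gens_N \<subseteq> gens_Z"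
  by (auto simp: gens_plus_def gens_N_def gens_Z_def)

lemma path_mono: "path G m w n \<Longrightarrow> G \<subseteq> G' \<Longrightarrow> path G' m w n"
  by (induction w arbitrary: n) auto

lemma category_Lambda: "category Lambda" "category Lambda_N"
  by (auto simp: Lambda_def Lambda_N_def category_presented)

lemma Lambda_simps [simp]:
  "Obj Lambda = UNIV" "Dom Lambda (word_arrow G R m w n) = m" "Cod Lambda (word_arrow G R m w n) = n"
  "Id Lambda n = arrL n [] n"
  by (auto simp: Lambda_def)

lemma Lambda_N_simps [simp]:
  "Obj Lambda_N = UNIV" "Dom Lambda_N (word_arrow G R m w n) = m" "Cod Lambda_N (word_arrow G R m w n) = n"
  "Id Lambda_N n = arrN n [] n"
  by (auto simp: Lambda_N_def)

lemma Lambda_plus_simps [simp]: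
  "Obj Lambda_plus = UNIV" "Dom Lambda_plus = Dom Lambda_N" "Cod Lambda_plus = Cod Lambda_N"
  "Id Lambda_plus = Id Lambda_N" "g \<odot>\<^bsub>Lambda_plus\<^esub> f = g \<odot>\<^bsub>Lambda_N\<^esub> f"
  by (auto simp: Lambda_plus_def Lambda_N_def)

lemma Arr_Lambda: "f \<in> Arr Lambda \<longleftrightarrow> (\<exists>m w n. path gens_Z m w n \<and> f = arrL m w n)"
  and Arr_Lambda_N: "f \<in> Arr Lambda_N \<longleftrightarrow> (\<exists>m w n. path gens_N m w n \<and> f = arrN m w n)"
  by (auto simp: Lambda_def Lambda_N_def Arr_presented)

lemma word_arrow_arr [simp]:
  "path gens_Z m w n \<Longrightarrow> arrL m w n \<in> Arr Lambda" "path gens_N m w n \<Longrightarrow> arrN m w n \<in> Arr Lambda_N"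
  by (auto simp: Arr_Lambda Arr_Lambda_N)

lemma Arr_Lambda_plus: "Arr Lambda_plus \<subseteq> Arr Lambda_N"
  using path_mono[OF _ gens_plus_subset] by (fastforce simp: Lambda_plus_def Arr_Lambda_N word_arrow_def)

lemma comp_word_arrowL:
  "path gens_Z l v m \<Longrightarrow> path gens_Z m w n \<Longrightarrow> arrL m w n \<odot>\<^bsub>Lambda\<^esub> arrL l v m = arrL l (w @ v) n"
  and comp_word_arrowN:
  "path gens_N l v m \<Longrightarrow> path gens_N m w n \<Longrightarrow> arrN m w n \<odot>\<^bsub>Lambda_N\<^esub> arrN l v m = arrN l (w @ v) n"
  by (auto simp: Lambda_def Lambda_N_def comp_word_arrow)

section \<open>The projection from the para-cyclic to the cyclic category\<close>

lemma path_cong_N_imp_L: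
  "path_cong gens_N para_rel m v w n \<Longrightarrow> path_cong gens_Z cyclic_rel m v w n"
proof (induction rule: path_cong.induct)
  case (base v w m n)
  then show ?case
    by (auto intro!: path_cong.base cyclic_rel.para intro: path_mono[OF _ gens_N_subset])
next
  case (refl m w n)
  then show ?case by (auto intro!: path_cong.refl intro: path_mono[OF _ gens_N_subset])
qed (auto intro: path_cong.intros)

lemma Lambda_proj_word_arrow:
  assumes "path gens_N m w n"
  shows "AMap Lambda_proj (arrN m w n) = arrL m w n"
proof -
  have "path_class gens_Z cyclic_rel m v n = path_class gens_Z cyclic_rel m w n"
    if "v \<in> path_class gens_N para_rel m w n" for v
    using that path_class_eq[OF path_cong_N_imp_L] by (auto simp: path_class_def[of gens_N])
  moreover have "w \<in> path_class gens_N para_rel m w n"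
    using assms by (auto simp: path_class_def intro: path_cong.refl)
  ultimately have "(\<Union>v\<in>path_class gens_N para_rel m w n. path_class gens_Z cyclic_rel m v n)
      = path_class gens_Z cyclic_rel m w n"
    by blast
  then show ?thesis by (simp add: Lambda_proj_def word_arrow_def)
qed

lemma OMap_Lambda_proj [simp]: "OMap Lambda_proj n = n"
  by (simp add: Lambda_proj_def)

lemma functor_Lambda_proj: "is_functor Lambda_N Lambda Lambda_proj"
proof -
  have "AMap Lambda_proj (g \<odot>\<^bsub>Lambda_N\<^esub> f) = AMap Lambda_proj g \<odot>\<^bsub>Lambda\<^esub> AMap Lambda_proj f"
    if fg: "f \<in> Arr Lambda_N" "g \<in> Arr Lambda_N" "Cod Lambda_N f = Dom Lambda_N g" for f g
  proof -
    obtain m w n v k where *: "f = arrN m w n" "path gens_N m w n" "g = arrN n v k"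
      "path gens_N n v k"
      using fg by (auto simp: Arr_Lambda_N)
    then have "path gens_N m (v @ w) k" by (auto simp: path_append)
    then show ?thesis
      using * path_mono[OF _ gens_N_subset]
      by (simp add: comp_word_arrowN Lambda_proj_word_arrow comp_word_arrowL)
  qed
  then show ?thesis
    by (auto simp: is_functor_def hom_def Arr_Lambda_N Lambda_proj_word_arrow path_mono[OF _ gens_N_subset])
qed

text \<open>Reducing exponents modulo \<open>n + 1\<close> turns a word over the generators of \<open>\<Lambda>\<^sub>Z\<close> into a word over
  those of \<open>\<Lambda>\<^sub>N\<close> with the same image in \<open>\<Lambda>\<close>.  This makes the projection full, and it
  lets a functor on \<open>\<Lambda>\<^sub>N\<close> be evaluated on words with negative exponents.\<close>

fun norm_gen :: "gen \<Rightarrow> gen" where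
  "norm_gen (Cyc n l) = Cyc n (l mod (int n + 1))"
| "norm_gen g = g"

lemma norm_gen_dom_cod [simp]: "gen_dom (norm_gen g) = gen_dom g" "gen_cod (norm_gen g) = gen_cod g"
  by (cases g; simp)+

lemma path_norm: "path gens_Z m w n \<Longrightarrow> path gens_N m (map norm_gen w) n"
proof (induction w arbitrary: n)
  case (Cons g w)
  then show ?case by (cases g) auto
qed simp

lemma cyc_multiple: "path_cong gens_Z cyclic_rel n [Cyc n ((int n + 1) * k)] [] n"
proof -
  let ?E = "\<lambda>v w. path_cong gens_Z cyclic_rel n v w n"
  have base: "?E v w" if "cyclic_rel v w" "path gens_Z n v n" "path gens_Z n w n" for v w
    using that by (rule path_cong.base)
  have add: "?E ([Cyc n a] @ [Cyc n b]) [Cyc n (a + b)]" for a b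
    by (intro base cyclic_rel.para) (auto intro: para_rel.tt)
  have zero: "?E [Cyc n 0] []" by (intro base cyclic_rel.para) (auto intro: para_rel.t0)
  have pos: "?E [Cyc n ((int n + 1) * int j)] []" for j
  proof (induction j)
    case 0
    then show ?case using zero by simp
  next
    case (Suc j)
    have "?E ([Cyc n (int n + 1)] @ [Cyc n ((int n + 1) * int j)]) ([] @ [])"
      using Suc by (intro path_cong.comp) (auto intro: base cyclic_rel.cyc)
    then have "?E [Cyc n ((int n + 1) + (int n + 1) * int j)] []"
      using path_cong.trans[OF path_cong.sym[OF add]] by simp
    then show ?case by (simp add: algebra_simps)
  qed
  show ?thesis
  proof (cases "0 \<le> k")
    case True
    then show ?thesis using pos[of "nat k"] by simp
  next
    case False
    let ?a = "(int n + 1) * k"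
    have "?E [Cyc n (- ?a)] []" using pos[of "nat (- k)"] False by simp
    then have "?E ([Cyc n ?a] @ [Cyc n (- ?a)]) ([Cyc n ?a] @ [])"
      by (intro path_cong.comp) (auto intro: path_cong.refl)
    then have "?E [Cyc n ?a] ([Cyc n ?a] @ [Cyc n (- ?a)])" using path_cong.sym by simp
    moreover have "?E ([Cyc n ?a] @ [Cyc n (- ?a)]) [Cyc n 0]" using add[of ?a "- ?a"] by simp
    ultimately show ?thesis using zero by (blast intro: path_cong.trans)
  qed
qed

lemma norm_gen_cong:
  assumes "g \<in> gens_Z"
  shows "path_cong gens_Z cyclic_rel (gen_dom g) [norm_gen g] [g] (gen_cod g)"
proof (cases g)
  case (Cyc n l)
  let ?r = "l mod (int n + 1)" and ?k = "(int n + 1) * (l div (int n + 1))"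
  have "path_cong gens_Z cyclic_rel n ([Cyc n ?r] @ [Cyc n ?k]) [Cyc n (?r + ?k)] n"
    by (intro path_cong.base cyclic_rel.para)
      (simp_all only: append_Cons append_Nil para_rel.tt, simp_all)
  moreover have "path_cong gens_Z cyclic_rel n ([Cyc n ?r] @ [Cyc n ?k]) ([Cyc n ?r] @ []) n"
    by (rule path_cong.comp[where m = n, OF cyc_multiple]) (auto intro: path_cong.refl)
  ultimately have "path_cong gens_Z cyclic_rel n ([Cyc n ?r] @ []) [Cyc n (?r + ?k)] n"
    by (blast intro: path_cong.trans path_cong.sym)
  then show ?thesis using Cyc by simp
qed (use assms in \<open>auto intro: path_cong.refl\<close>)

lemma norm_cong: "path gens_Z m w n \<Longrightarrow> path_cong gens_Z cyclic_rel m (map norm_gen w) w n"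
proof (induction w arbitrary: n)
  case (Cons g w)
  then have "path_cong gens_Z cyclic_rel m ([norm_gen g] @ map norm_gen w) ([g] @ w) n"
    by (intro path_cong.comp[where m = "gen_dom g"]) (use norm_gen_cong[of g] in auto)
  then show ?case by simp
qed (auto intro: path_cong.refl)

lemma Lambda_proj_full:
  assumes "f \<in> Arr Lambda"
  obtains g where "g \<in> Arr Lambda_N" "AMap Lambda_proj g = f"
    "Dom Lambda_N g = Dom Lambda f" "Cod Lambda_N g = Cod Lambda f"
proof -
  obtain m w n where f: "f = arrL m w n" "path gens_Z m w n" using assms by (auto simp: Arr_Lambda)
  then have p: "path gens_N m (map norm_gen w) n" by (simp add: path_norm)
  show thesis
    using that[of "arrN m (map norm_gen w) n"] p f word_arrow_eq[OF norm_cong, of m w n]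
    by (simp add: Lambda_proj_word_arrow)
qed

section \<open>The central cyclic words\<close>

abbreviation tau_top :: "nat \<Rightarrow> nat \<times> gen list set \<times> nat" where
  "tau_top n \<equiv> arrN n [Cyc n (int n + 1)] n"

text \<open>Moving \<open>\<tau>\<^sub>n\<^sup>n\<^sup>+\<^sup>1\<close> past a face or degeneracy raises or lowers the exponent by one, together with \<open>n\<close>.  The
  exception is the last face: here \<open>\<partial>\<^sup>n\<^sub>n\<^sub>+\<^sub>1 = \<tau>\<^sub>n\<^sub>+\<^sub>1 \<partial>\<^sup>n\<^sub>0\<close>, and both sides become \<open>\<tau>\<^sub>n\<^sub>+\<^sub>1\<^sup>n\<^sup>+\<^sup>3 \<partial>\<^sup>n\<^sub>0\<close>.\<close>

lemma tau_top_central_gen: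
  assumes "g \<in> gens_N"
  shows "path_cong gens_N para_rel (gen_dom g) ([Cyc (gen_cod g) (int (gen_cod g) + 1)] @ [g])
    ([g] @ [Cyc (gen_dom g) (int (gen_dom g) + 1)]) (gen_cod g)"
proof (cases g)
  case (Face n j)
  with assms have j: "j \<le> n + 1" by simp
  show ?thesis
  proof (cases "j \<le> n")
    case True
    then have "para_rel [Face n j, Cyc n (int n + 1)] [Cyc (n+1) (int n + 1 + 1), Face n j]"
      by (intro para_rel.dt) auto
    then have "path_cong gens_N para_rel n [Face n j, Cyc n (int n + 1)]
        [Cyc (n+1) (int n + 1 + 1), Face n j] (n + 1)"
      using j by (intro path_cong.base) auto
    then show ?thesis using Face by (auto intro: path_cong.sym simp: algebra_simps)
  next
    case False
    let ?E = "\<lambda>v w. path_cong gens_N para_rel n v w (n + 1)"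
    from False j have j: "j = n + 1" by simp
    have "para_rel [Face n j, Cyc n (int n + 1)] [Cyc (n+1) (int n + 1 + 2), Face n 0]"
      using j by (intro para_rel.dt) auto
    then have 1: "?E [Face n j, Cyc n (int n + 1)] [Cyc (n+1) (int n + 1 + 2), Face n 0]"
      using j by (auto intro!: path_cong.base)
    \<comment> \<open>the relation for \<open>\<tau>\<^sup>0\<close> and the last face reads \<open>\<partial>\<^sub>n\<^sub>+\<^sub>1 = \<tau> \<partial>\<^sub>0\<close>\<close>
    have "para_rel [Face n j, Cyc n 0] [Cyc (n+1) (0 + 1), Face n 0]"
      using j by (intro para_rel.dt) auto
    then have 2: "?E [Face n j, Cyc n 0] [Cyc (n+1) 1, Face n 0]"
      using j by (auto intro!: path_cong.base)
    have "path_cong gens_N para_rel n ([Face n j] @ [Cyc n 0]) ([Face n j] @ []) (n+1)"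
      using j by (intro path_cong.comp[where m = n])
        (auto intro: path_cong.refl path_cong.base para_rel.t0)
    then have "?E [Face n j] [Face n j, Cyc n 0]" using path_cong.sym by simp
    then have 3: "?E [Face n j] [Cyc (n+1) 1, Face n 0]" using 2 by (rule path_cong.trans)
    have 4: "?E ([Cyc (n+1) (int (n+1) + 1)] @ [Face n j])
        ([Cyc (n+1) (int (n+1) + 1)] @ [Cyc (n+1) 1, Face n 0])"
      using 3 by (intro path_cong.comp[where m = "n+1"]) (auto intro: path_cong.refl)
    have "para_rel [Cyc (n+1) (int (n+1) + 1), Cyc (n+1) 1] [Cyc (n+1) (int (n+1) + 1 + 1)]"
      by (rule para_rel.tt)
    then have 5: "?E ([Cyc (n+1) (int (n+1) + 1), Cyc (n+1) 1] @ [Face n 0])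
        ([Cyc (n+1) (int (n+1) + 1 + 1)] @ [Face n 0])"
      using j by (intro path_cong.comp[where m = "n+1"]) (auto intro: path_cong.refl path_cong.base)
    have "int (n+1) + 1 + 1 = int n + 1 + 2" by simp
    with 5 have "?E ([Cyc (n+1) (int (n+1) + 1)] @ [Cyc (n+1) 1, Face n 0])
        [Face n j, Cyc n (int n + 1)]"
      using path_cong.trans[OF _ path_cong.sym[OF 1]] by simp
    with path_cong.trans[OF 4] Face show ?thesis by simp
  qed
next
  case (Degen n j)
  then have "para_rel [Cyc n (int n + 1), Degen n j] [Degen n j, Cyc (n+1) (int n + 1 + 1)]"
    using assms by (intro para_rel.ts) auto
  then show ?thesis using Degen assms by (auto intro!: path_cong.base simp: algebra_simps)
next
  case (Cyc n l)
  have tt: "path_cong gens_N para_rel n [Cyc n a, Cyc n b] [Cyc n (a + b)] n"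
    if "0 \<le> a" "0 \<le> b" for a b
    using that by (intro path_cong.base para_rel.tt) auto
  have "path_cong gens_N para_rel n [Cyc n (int n + 1), Cyc n l] [Cyc n (l + (int n + 1))] n"
    using tt[of "int n + 1" l] Cyc assms by (simp add: add.commute)
  moreover have "path_cong gens_N para_rel n [Cyc n (l + (int n + 1))] [Cyc n l, Cyc n (int n + 1)] n"
    using tt[of l "int n + 1"] Cyc assms path_cong.sym by simp
  ultimately show ?thesis using Cyc by (simp add: path_cong.trans)
qed

lemma tau_top_central_word:
  "path gens_N m w n \<Longrightarrow> path_cong gens_N para_rel m ([Cyc n (int n + 1)] @ w)
    (w @ [Cyc m (int m + 1)]) n"
proof (induction w arbitrary: n)
  case (Cons g w)
  let ?E = "path_cong gens_N para_rel" and ?d = "gen_dom g"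
  have g: "g \<in> gens_N" "gen_cod g = n" "path gens_N m w ?d" using Cons.prems by auto
  have "?E m (([Cyc n (int n + 1)] @ [g]) @ w) (([g] @ [Cyc ?d (int ?d + 1)]) @ w) n"
    by (rule path_cong.comp[where m = ?d])
      (use g tau_top_central_gen[of g] in \<open>auto intro: path_cong.refl simp del: append.simps\<close>)
  moreover have "?E m ([g] @ ([Cyc ?d (int ?d + 1)] @ w)) ([g] @ (w @ [Cyc m (int m + 1)])) n"
    by (rule path_cong.comp[where m = ?d])
      (use g Cons.IH[of ?d] in \<open>auto intro: path_cong.refl\<close>)
  ultimately show ?case using path_cong.trans by fastforce
qed (auto intro: path_cong.refl)

lemma tau_top_central:
  assumes "f \<in> Arr Lambda_N"
  shows "tau_top (Cod Lambda_N f) \<odot>\<^bsub>Lambda_N\<^esub> f = f \<odot>\<^bsub>Lambda_N\<^esub> tau_top (Dom Lambda_N f)"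
proof -
  obtain m w n where f: "f = arrN m w n" "path gens_N m w n" using assms by (auto simp: Arr_Lambda_N)
  then show ?thesis
    using word_arrow_eq[OF tau_top_central_word, of m w n]
    by (simp add: comp_word_arrowN)
qed

lemma nonneg_if_mult_gt: "0 < a \<Longrightarrow> - a < a * z \<Longrightarrow> 0 \<le> z" for a z :: int
  using mult_left_mono[of z "-1" a] by (cases "0 \<le> z") auto

section \<open>Functors that factor through the cyclic category\<close>

text \<open>A functor on \<open>\<Lambda>\<^sub>N\<^sup>o\<^sup>p\<close> that trivialises the central arrows \<open>\<tau>\<^sub>n\<^sup>n\<^sup>+\<^sup>1\<close>.  It sees exponents only
  modulo \<open>n + 1\<close>, so it can be evaluated on words with negative exponents after reduction, and it
  remains to see that the relations of \<open>\<Lambda>\<close> are respected.\<close>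

locale cyclic_action = D: category D
  for D :: "('p, 'b) category" +
  fixes F :: "(nat, nat \<times> gen list set \<times> nat, 'p, 'b) funct"
  assumes F: "is_functor (op_cat Lambda_N) D F"
    and F_tau: "AMap F (tau_top n) = Id D (OMap F n)"
begin

abbreviation act :: "nat \<Rightarrow> gen list \<Rightarrow> nat \<Rightarrow> 'b" where
  "act m w n \<equiv> AMap F (arrN m w n)"

lemma act_arr [simp]:
  assumes "path gens_N m w n"
  shows "act m w n \<in> Arr D" "Dom D (act m w n) = OMap F n" "Cod D (act m w n) = OMap F m"
  using functor_simps(2-4)[OF F, of "arrN m w n"] assms by auto

lemma OMap_in [simp]: "OMap F n \<in> Obj D"
  using functor_simps(1)[OF F] by simp

lemma act_Nil: "act n [] n = Id D (OMap F n)"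
  using functor_simps(5)[OF F, of n] by simp

lemma act_append:
  "path gens_N l v m \<Longrightarrow> path gens_N m w n \<Longrightarrow> act l (w @ v) n = act l v m \<odot>\<^bsub>D\<^esub> act m w n"
  using functor_simps(6)[OF F, of "arrN m w n" "arrN l v m"] by (simp add: comp_word_arrowN)

lemma act_rel:
  "para_rel v w \<Longrightarrow> path gens_N m v n \<Longrightarrow> path gens_N m w n \<Longrightarrow> act m v n = act m w n"
  by (intro arg_cong[of _ _ "AMap F"] word_arrow_eq path_cong.base)

lemma act_tt:
  "0 \<le> a \<Longrightarrow> 0 \<le> b \<Longrightarrow> act n [Cyc n (a + b)] n = act n [Cyc n b] n \<odot>\<^bsub>D\<^esub> act n [Cyc n a] n"
  using act_rel[OF para_rel.tt, of n n a b n] act_append[of n "[Cyc n b]" n "[Cyc n a]" n] by simp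

lemma act_multiple: "act n [Cyc n ((int n + 1) * int k)] n = Id D (OMap F n)"
proof (induction k)
  case 0
  show ?case using act_rel[OF para_rel.t0, of n n n] by (simp add: act_Nil)
next
  case (Suc k)
  have "act n [Cyc n ((int n + 1) * int k + (int n + 1))] n = Id D (OMap F n)"
    using act_tt[of "(int n + 1) * int k" "int n + 1" n] Suc by (simp add: F_tau)
  then show ?case by (simp add: algebra_simps)
qed

lemma act_mod:
  assumes "0 \<le> a"
  shows "act n [Cyc n (a mod (int n + 1))] n = act n [Cyc n a] n"
proof -
  define k where "k = nat (a div (int n + 1))"
  have "a mod (int n + 1) + (int n + 1) * int k = a"
    using assms by (simp add: k_def pos_imp_zdiv_nonneg_iff)
  then show ?thesis
    using act_tt[of "a mod (int n + 1)" "(int n + 1) * int k" n] by (simp add: act_multiple)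
qed

lemma act_norm: "path gens_N m w n \<Longrightarrow> act m (map norm_gen w) n = act m w n"
proof (induction w arbitrary: n)
  case (Cons g w)
  have g: "g \<in> gens_N" "gen_cod g = n" "path gens_N m w (gen_dom g)" using Cons.prems by auto
  then have p: "path gens_N m (map norm_gen w) (gen_dom g)"
    using path_norm path_mono[OF _ gens_N_subset] by blast
  have "act (gen_dom g) [norm_gen g] n = act (gen_dom g) [g] n"
    using g by (cases g) (auto simp: act_mod)
  moreover have "path gens_N (gen_dom g) [norm_gen g] n" using g by (cases g) auto
  ultimately show ?case
    using g p Cons.IH[of "gen_dom g"] act_append[of m "map norm_gen w" "gen_dom g" "[norm_gen g]" n]
      act_append[of m w "gen_dom g" "[g]" n]
    by simp
qed simp

lemma act_mod_cong:
  "0 \<le> a \<Longrightarrow> a mod (int n + 1) = b mod (int n + 1) \<Longrightarrow>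
    act n [Cyc n (b mod (int n + 1))] n = act n [Cyc n a] n"
  using act_mod[of a n] by simp

text \<open>The simplicial relations are not changed by the reduction.  In the relations that move
  \<open>\<tau>\<^sup>i\<close> past a face or degeneracy, write \<open>i = (n + 1) c + r\<close> with \<open>0 \<le> r \<le> n\<close>.  The same relation with
  \<open>r\<close> and \<open>p - c\<close> in place of \<open>i\<close> and \<open>p\<close> is available in \<open>\<Lambda>\<^sub>N\<close>, as the bounds on \<open>q\<close> and \<open>j\<close> force \<open>p - c \<ge> 0\<close>; its
  exponent on the other side, \<open>r + (p - c)\<close>, differs from \<open>i + p\<close> by \<open>(n + 2) c\<close>, which is a multiple of the period there.\<close>

lemma act_base:
  assumes "cyclic_rel v w" "path gens_Z m v n" "path gens_Z m w n"
  shows "act m (map norm_gen v) n = act m (map norm_gen w) n"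
  using assms(1)
proof cases
  case para
  have triv: "map norm_gen v = v \<Longrightarrow> map norm_gen w = w \<Longrightarrow> ?thesis"
    using act_rel[OF para] path_norm[OF assms(2)] path_norm[OF assms(3)] by simp
  from para show ?thesis
  proof cases
    case (tt k s t)
    with assms have mn: "m = k" "n = k" by auto
    let ?s = "s mod (int k + 1)" and ?t = "t mod (int k + 1)"
    have "act k [Cyc k ?s, Cyc k ?t] k = act k [Cyc k (?s + ?t)] k"
      by (rule act_rel[OF para_rel.tt]) auto
    also have "\<dots> = act k [Cyc k ((s + t) mod (int k + 1))] k"
      by (rule act_mod_cong[symmetric]) (auto simp: mod_add_eq)
    finally show ?thesis by (simp add: tt mn)
  next
    case (dt j k i p q)
    with assms have mn: "m = k" "n = k + 1" by auto
    define c r where "c = i div (int k + 1)" and "r = i mod (int k + 1)"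
    then have i: "i = (int k + 1) * c + r" and r: "0 \<le> r" by simp_all
    have eq: "r + int j = (int k + 1) * (p - c) + int q"
      using dt(4) i by (simp add: algebra_simps)
    define z where "z = (int k + 1) * (p - c)"
    have "z > - (int k + 1)" using eq r dt(5) unfolding z_def[symmetric] by linarith
    then have pc: "p - c \<ge> 0" unfolding z_def by (intro nonneg_if_mult_gt[of "int k + 1"]) auto
    have "act k [Face k j, Cyc k r] (k+1) = act k ([Cyc (k+1) (r + (p - c))] @ [Face k q]) (k+1)"
      using para_rel.dt[OF dt(3) eq dt(5)] dt(3,5) r pc by (intro act_rel) auto
    also have "\<dots> = act k [Face k q] (k+1) \<odot>\<^bsub>D\<^esub> act (k+1) [Cyc (k+1) (r + (p - c))] (k+1)"
      using dt r pc by (intro act_append) auto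
    also have "act (k+1) [Cyc (k+1) (r + (p - c))] (k+1)
        = act (k+1) [Cyc (k+1) ((i + p) mod (int (k+1) + 1))] (k+1)"
    proof (rule act_mod_cong[symmetric])
      \<comment> \<open>the period in degree \<open>k + 1\<close> is \<open>k + 2\<close>, and \<open>(k + 1) c + c = (k + 2) c\<close>\<close>
      have "i + p = (r + (p - c)) + (int (k+1) + 1) * c"
        by (simp add: i algebra_simps)
      then show "(r + (p - c)) mod (int (k+1) + 1) = (i + p) mod (int (k+1) + 1)"
        by (simp only: mod_mult_self2)
    qed (use r pc in simp)
    also have "act k [Face k q] (k+1) \<odot>\<^bsub>D\<^esub> \<dots> =
        act k ([Cyc (k+1) ((i + p) mod (int (k+1) + 1))] @ [Face k q]) (k+1)"
      using dt by (intro act_append[symmetric]) auto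
    finally show ?thesis by (simp add: dt mn r_def algebra_simps)
  next
    case (ts j k i p q)
    with assms have mn: "m = k + 1" "n = k" by auto
    define c r where "c = i div (int k + 1)" and "r = i mod (int k + 1)"
    then have i: "i = (int k + 1) * c + r" and r: "0 \<le> r" by simp_all
    have eq: "- r + int j = (int k + 1) * (- (p - c)) + int q"
      using ts(4) i by (simp add: algebra_simps)
    define z where "z = (int k + 1) * (p - c)"
    have "z > - (int k + 1)" using eq r ts(3,5) unfolding z_def[symmetric] mult_minus_right by linarith
    then have pc: "p - c \<ge> 0" unfolding z_def by (intro nonneg_if_mult_gt[of "int k + 1"]) auto
    have "act (k+1) [Cyc k r, Degen k j] k = act (k+1) ([Degen k q] @ [Cyc (k+1) (r + (p - c))]) k"
      using para_rel.ts[OF ts(3) eq ts(5)] ts(3,5) r pc by (intro act_rel) auto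
    also have "\<dots> = act (k+1) [Cyc (k+1) (r + (p - c))] (k+1) \<odot>\<^bsub>D\<^esub> act (k+1) [Degen k q] k"
      using ts r pc by (intro act_append) auto
    also have "act (k+1) [Cyc (k+1) (r + (p - c))] (k+1)
        = act (k+1) [Cyc (k+1) ((i + p) mod (int (k+1) + 1))] (k+1)"
    proof (rule act_mod_cong[symmetric])
      \<comment> \<open>the period in degree \<open>k + 1\<close> is \<open>k + 2\<close>, and \<open>(k + 1) c + c = (k + 2) c\<close>\<close>
      have "i + p = (r + (p - c)) + (int (k+1) + 1) * c"
        by (simp add: i algebra_simps)
      then show "(r + (p - c)) mod (int (k+1) + 1) = (i + p) mod (int (k+1) + 1)"
        by (simp only: mod_mult_self2)
    qed (use r pc in simp)
    also have "\<dots> \<odot>\<^bsub>D\<^esub> act (k+1) [Degen k q] k =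
        act (k+1) ([Degen k q] @ [Cyc (k+1) ((i + p) mod (int (k+1) + 1))]) k"
      using ts by (intro act_append[symmetric]) auto
    finally show ?thesis by (simp add: ts mn r_def algebra_simps)
  qed (rule triv; simp)+
next
  case (cyc k)
  then show ?thesis using assms act_multiple[of k 0] by (auto simp: act_Nil)
qed

lemma act_cong:
  "path_cong gens_Z cyclic_rel m v w n \<Longrightarrow> act m (map norm_gen v) n = act m (map norm_gen w) n"
proof (induction rule: path_cong.induct)
  case (base v w m n)
  then show ?case by (rule act_base)
next
  case (comp l v v' m w w' n)
  then have "path gens_N l (map norm_gen v) m" "path gens_N l (map norm_gen v') m"
    "path gens_N m (map norm_gen w) n" "path gens_N m (map norm_gen w') n"
    using path_cong_path path_norm by blast+
  then show ?case using comp.IH by (simp add: act_append)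
qed auto

lemma AMap_fibre:
  assumes "f \<in> Arr Lambda_N" "g \<in> Arr Lambda_N" "AMap Lambda_proj f = AMap Lambda_proj g"
  shows "AMap F f = AMap F g"
proof -
  obtain m w n m' v n' where *: "f = arrN m w n" "path gens_N m w n" "g = arrN m' v n'"
    "path gens_N m' v n'"
    using assms(1,2) by (auto simp: Arr_Lambda_N)
  then have eq: "arrL m w n = arrL m' v n'" using assms(3) by (simp add: Lambda_proj_word_arrow)
  then have [simp]: "m' = m" "n' = n" by (auto simp: word_arrow_def)
  have "path_cong gens_Z cyclic_rel m v w n"
    using eq * by (intro word_arrow_eqD) (auto intro: path_mono[OF _ gens_N_subset])
  then show ?thesis using act_cong[of m v w n] * by (simp add: act_norm)
qed

text \<open>The projection is full and the functor is constant on its fibres, so any choice of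
  preimages of arrows defines the factorisation.\<close>

lemma factors_through_Lambda:
  "\<exists>S. is_functor (op_cat Lambda) D S \<and> OMap S = OMap F \<and> AMap S \<in> extensional (Arr Lambda) \<and>
    (\<forall>f\<in>Arr Lambda_N. AMap S (AMap Lambda_proj f) = AMap F f)"
proof -
  interpret L: category Lambda by (rule category_Lambda)
  interpret N: category Lambda_N by (rule category_Lambda)
  note P = functor_simps[OF functor_Lambda_proj]
  define S where "S = \<lparr>OMap = OMap F, AMap = (\<lambda>f\<in>Arr Lambda. AMap F (SOME g.
      g \<in> Arr Lambda_N \<and> AMap Lambda_proj g = f))\<rparr>"
  have S: "AMap S (AMap Lambda_proj g) = AMap F g" if g: "g \<in> Arr Lambda_N" for g
  proof -
    define h where "h = (SOME h. h \<in> Arr Lambda_N \<and> AMap Lambda_proj h = AMap Lambda_proj g)"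
    have "h \<in> Arr Lambda_N \<and> AMap Lambda_proj h = AMap Lambda_proj g"
      unfolding h_def by (rule someI[of _ g]) (use g in auto)
    moreover have "AMap S (AMap Lambda_proj g) = AMap F h"
      using P(2)[OF g] by (simp add: S_def h_def)
    ultimately show ?thesis using AMap_fibre[OF _ g, of h] by simp
  qed
  have OS: "OMap S = OMap F" by (simp add: S_def)
  have hom: "AMap S f \<in> hom D (OMap F (Cod Lambda f)) (OMap F (Dom Lambda f))"
    if f: "f \<in> Arr Lambda" for f
  proof -
    obtain g where g: "g \<in> Arr Lambda_N" "AMap Lambda_proj g = f"
      "Dom Lambda_N g = Dom Lambda f" "Cod Lambda_N g = Cod Lambda f"
      by (rule Lambda_proj_full[OF f])
    show ?thesis
      using S[OF g(1)] g functor_simps(2-4)[OF F, of g] by (simp add: hom_def)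
  qed
  have comp: "AMap S (f \<odot>\<^bsub>Lambda\<^esub> f') = AMap S f' \<odot>\<^bsub>D\<^esub> AMap S f"
    if f: "f \<in> Arr Lambda" and f': "f' \<in> Arr Lambda" and c: "Dom Lambda f = Cod Lambda f'" for f f'
  proof -
    obtain g where g: "g \<in> Arr Lambda_N" "AMap Lambda_proj g = f"
      "Dom Lambda_N g = Dom Lambda f" "Cod Lambda_N g = Cod Lambda f"
      by (rule Lambda_proj_full[OF f])
    obtain g' where g': "g' \<in> Arr Lambda_N" "AMap Lambda_proj g' = f'"
      "Dom Lambda_N g' = Dom Lambda f'" "Cod Lambda_N g' = Cod Lambda f'"
      by (rule Lambda_proj_full[OF f'])
    have gg: "g \<odot>\<^bsub>Lambda_N\<^esub> g' \<in> Arr Lambda_N" using g g' c by simp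
    have "AMap Lambda_proj (g \<odot>\<^bsub>Lambda_N\<^esub> g') = f \<odot>\<^bsub>Lambda\<^esub> f'"
      using P(6)[OF g'(1) g(1)] g g' c by simp
    then have "AMap S (f \<odot>\<^bsub>Lambda\<^esub> f') = AMap F (g \<odot>\<^bsub>Lambda_N\<^esub> g')"
      using S[OF gg] by simp
    also have "\<dots> = AMap F g' \<odot>\<^bsub>D\<^esub> AMap F g"
      using g g' c functor_simps(6)[OF F, of g g'] by simp
    finally show ?thesis using S[OF g(1)] S[OF g'(1)] g(2) g'(2) by simp
  qed
  have id: "AMap S (arrL n [] n) = Id D (OMap F n)" for n
    using S[of "arrN n [] n"] by (simp add: Lambda_proj_word_arrow act_Nil)
  have "is_functor (op_cat Lambda) D S"
    by (simp add: is_functor_def OS hom comp id)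
  moreover have "AMap S \<in> extensional (Arr Lambda)" by (simp add: S_def)
  ultimately show ?thesis using S OS by blast
qed

end

section \<open>Limits over countable shapes\<close>

lemma cone_cong:
  assumes "category I" "\<And>i. i \<in> Obj I \<Longrightarrow> OMap F i = OMap G i" "\<And>a. a \<in> Arr I \<Longrightarrow> AMap F a = AMap G a"
    "\<And>i. i \<in> Obj I \<Longrightarrow> \<pi> i = \<psi> i"
  shows "cone I C F x \<pi> \<longleftrightarrow> cone I C G x \<psi>"
proof -
  interpret category I by fact
  show ?thesis using assms(2-) by (simp add: cone_def)
qed

lemma limit_cone_cong:
  assumes "category I" "\<And>i. i \<in> Obj I \<Longrightarrow> OMap F i = OMap G i" "\<And>a. a \<in> Arr I \<Longrightarrow> AMap F a = AMap G a"
    "\<And>i. i \<in> Obj I \<Longrightarrow> \<pi> i = \<psi> i"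
  shows "limit_cone I C F x \<pi> \<longleftrightarrow> limit_cone I C G x \<psi>"
proof -
  have "cone I C F y \<chi> \<longleftrightarrow> cone I C G y \<chi>" for y \<chi>
    using assms by (intro cone_cong) auto
  moreover have "cone I C F x \<pi> \<longleftrightarrow> cone I C G x \<psi>" using assms by (rule cone_cong)
  ultimately show ?thesis using assms(4) by (simp add: limit_cone_def)
qed

text \<open>Smallness is measured by a fixed type, so a shape over other types has to be transported
  into that type along injections of its objects and arrows.\<close>

definition relabel :: "('i \<Rightarrow> 's) \<Rightarrow> ('j \<Rightarrow> 's) \<Rightarrow> ('i, 'j) category \<Rightarrow> ('s, 's) category" where
  "relabel p q I = \<lparr>Obj = p ` Obj I, Arr = q ` Arr I,
     Dom = (\<lambda>s. p (Dom I (inv_into (Arr I) q s))), Cod = (\<lambda>s. p (Cod I (inv_into (Arr I) q s))),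
     Id = (\<lambda>s. q (Id I (inv_into (Obj I) p s))),
     Comp = (\<lambda>s t. q (inv_into (Arr I) q s \<odot>\<^bsub>I\<^esub> inv_into (Arr I) q t))\<rparr>"

definition relabel_functor ::
  "('i \<Rightarrow> 's) \<Rightarrow> ('j \<Rightarrow> 's) \<Rightarrow> ('i, 'j) category \<Rightarrow> ('i, 'j, 'o, 'a) funct \<Rightarrow> ('s, 's, 'o, 'a) funct"
  where "relabel_functor p q I F =
    \<lparr>OMap = (\<lambda>s. OMap F (inv_into (Obj I) p s)), AMap = (\<lambda>s. AMap F (inv_into (Arr I) q s))\<rparr>"

locale relabelling = I: category I
  for I :: "('i, 'j) category" +
  fixes p :: "'i \<Rightarrow> 's" and q :: "'j \<Rightarrow> 's"
  assumes p: "inj_on p (Obj I)" and q: "inj_on q (Arr I)"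
begin

lemma inv_p [simp]: "i \<in> Obj I \<Longrightarrow> inv_into (Obj I) p (p i) = i"
  and inv_q [simp]: "a \<in> Arr I \<Longrightarrow> inv_into (Arr I) q (q a) = a"
  using p q by auto

lemma p_eq [simp]: "i \<in> Obj I \<Longrightarrow> j \<in> Obj I \<Longrightarrow> p i = p j \<longleftrightarrow> i = j"
  using p by (auto simp: inj_on_def)

lemma relabel_simps [simp]:
  "Obj (relabel p q I) = p ` Obj I" "Arr (relabel p q I) = q ` Arr I"
  "a \<in> Arr I \<Longrightarrow> Dom (relabel p q I) (q a) = p (Dom I a)"
  "a \<in> Arr I \<Longrightarrow> Cod (relabel p q I) (q a) = p (Cod I a)"
  "i \<in> Obj I \<Longrightarrow> Id (relabel p q I) (p i) = q (Id I i)"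
  "a \<in> Arr I \<Longrightarrow> b \<in> Arr I \<Longrightarrow> q a \<odot>\<^bsub>relabel p q I\<^esub> q b = q (a \<odot>\<^bsub>I\<^esub> b)"
  by (simp_all add: relabel_def)

lemma relabel_functor_simps [simp]:
  "i \<in> Obj I \<Longrightarrow> OMap (relabel_functor p q I F) (p i) = OMap F i"
  "a \<in> Arr I \<Longrightarrow> AMap (relabel_functor p q I F) (q a) = AMap F a"
  by (simp_all add: relabel_functor_def)

lemma category_relabel: "category (relabel p q I)"
  by (rule categoryI) (auto simp: I.assoc)

lemma functor_relabel: "is_functor I C F \<Longrightarrow> is_functor (relabel p q I) C (relabel_functor p q I F)"
  by (auto simp: is_functor_def)

lemma cone_relabel:
  "cone (relabel p q I) C (relabel_functor p q I F) x \<pi> \<longleftrightarrow> cone I C F x (\<lambda>i. \<pi> (p i))"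
  by (auto simp: cone_def)

lemma limit_cone_relabel:
  "limit_cone (relabel p q I) C (relabel_functor p q I F) x \<pi> \<longleftrightarrow> limit_cone I C F x (\<lambda>i. \<pi> (p i))"
proof -
  have "(\<forall>y \<psi>. cone I C F y (\<lambda>i. \<psi> (p i)) \<longrightarrow>
          (\<exists>!f. f \<in> hom C y x \<and> (\<forall>i\<in>Obj I. \<pi> (p i) \<odot>\<^bsub>C\<^esub> f = \<psi> (p i)))) \<longleftrightarrow>
        (\<forall>y \<psi>. cone I C F y \<psi> \<longrightarrow>
          (\<exists>!f. f \<in> hom C y x \<and> (\<forall>i\<in>Obj I. \<pi> (p i) \<odot>\<^bsub>C\<^esub> f = \<psi> i)))"
    (is "?L \<longleftrightarrow> ?R")
  proof
    assume L: ?L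
    show ?R
    proof (intro allI impI)
      fix y \<psi> assume c: "cone I C F y \<psi>"
      let ?\<psi> = "\<lambda>s. \<psi> (inv_into (Obj I) p s)"
      have "cone I C F y (\<lambda>i. ?\<psi> (p i))"
        using c cone_cong[OF I.category_axioms, of F F "\<lambda>i. ?\<psi> (p i)" \<psi>] by simp
      then have "\<exists>!f. f \<in> hom C y x \<and> (\<forall>i\<in>Obj I. \<pi> (p i) \<odot>\<^bsub>C\<^esub> f = ?\<psi> (p i))"
        by (rule L[rule_format])
      then show "\<exists>!f. f \<in> hom C y x \<and> (\<forall>i\<in>Obj I. \<pi> (p i) \<odot>\<^bsub>C\<^esub> f = \<psi> i)" by simp
    qed
  qed blast
  then show ?thesis by (simp add: limit_cone_def cone_relabel)
qed

lemma small_limit: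
  assumes "small_complete TYPE('s) C" "is_functor I C F"
  shows "\<exists>x \<pi>. limit_cone I C F x \<pi>"
proof -
  obtain x \<pi> where "limit_cone (relabel p q I) C (relabel_functor p q I F) x \<pi>"
    using assms category_relabel functor_relabel unfolding small_complete_def by blast
  then show ?thesis unfolding limit_cone_relabel by blast
qed

lemma left_exact_limit:
  assumes "left_exact TYPE('s) C B" "is_functor I C F" "limit_cone I C F x \<pi>"
  shows "limit_cone I C (functor_comp I B F) (OMap B x) (\<lambda>i. AMap B (\<pi> i))"
proof -
  let ?I = "relabel p q I" and ?F = "relabel_functor p q I F"
  let ?\<pi> = "\<lambda>s. \<pi> (inv_into (Obj I) p s)"
  have "limit_cone ?I C ?F x ?\<pi>"
    unfolding limit_cone_relabel
    using limit_cone_cong[OF I.category_axioms, of F F "\<lambda>i. ?\<pi> (p i)" \<pi>] assms(3) by simp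
  then have "limit_cone ?I C (functor_comp ?I B ?F) (OMap B x) (\<lambda>i. AMap B (?\<pi> i))"
    using assms(1) category_relabel functor_relabel[OF assms(2)] unfolding left_exact_def by blast
  moreover have "limit_cone ?I C (functor_comp ?I B ?F) (OMap B x) (\<lambda>i. AMap B (?\<pi> i)) \<longleftrightarrow>
      limit_cone ?I C (relabel_functor p q I (functor_comp I B F)) (OMap B x) (\<lambda>i. AMap B (?\<pi> i))"
    by (rule limit_cone_cong[OF category_relabel]) auto
  ultimately have "limit_cone I C (functor_comp I B F) (OMap B x) (\<lambda>i. AMap B (?\<pi> (p i)))"
    unfolding limit_cone_relabel by simp
  then show ?thesis
    using limit_cone_cong[OF I.category_axioms, of "functor_comp I B F" "functor_comp I B F"
        "\<lambda>i. AMap B (?\<pi> (p i))" "\<lambda>i. AMap B (\<pi> i)"] by simp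
qed

end

lemma countable_relabelling:
  assumes "infinite (UNIV :: 's set)" "category I" "countable (Obj I)" "countable (Arr I)"
  obtains p q where "relabelling I (p :: 'i \<Rightarrow> 's) (q :: 'j \<Rightarrow> 's)"
proof -
  obtain h :: "nat \<Rightarrow> 's" where h: "inj h"
    using infinite_countable_subset[OF assms(1)] by auto
  obtain f :: "'i \<Rightarrow> nat" and g :: "'j \<Rightarrow> nat" where "inj_on f (Obj I)" "inj_on g (Arr I)"
    using assms(3,4) by (auto simp: countable_def)
  then have "inj_on (h \<circ> f) (Obj I)" "inj_on (h \<circ> g) (Arr I)"
    using h by (auto intro!: comp_inj_on intro: inj_on_subset)
  then show thesis
    using assms(2) by (intro that[of "h \<circ> f" "h \<circ> g"] relabelling.intro relabelling_axioms.intro) auto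
qed

section \<open>Joint equalizers\<close>

text \<open>The universal arrow into \<open>X\<close> that equalizes all pairs \<open>l k, r k\<close> with \<open>k \<in> K\<close> at once; the
  targets of the pairs may vary with \<open>k\<close>.\<close>

definition joint_equalizer ::
  "('o, 'a) category \<Rightarrow> 'o \<Rightarrow> 'k set \<Rightarrow> ('k \<Rightarrow> 'a) \<Rightarrow> ('k \<Rightarrow> 'a) \<Rightarrow> 'o \<Rightarrow> 'a \<Rightarrow> bool" where
  "joint_equalizer C X K l r A e \<longleftrightarrow> A \<in> Obj C \<and> e \<in> hom C A X \<and>
     (\<forall>k\<in>K. l k \<odot>\<^bsub>C\<^esub> e = r k \<odot>\<^bsub>C\<^esub> e) \<and>
     (\<forall>Y y. y \<in> hom C Y X \<and> (\<forall>k\<in>K. l k \<odot>\<^bsub>C\<^esub> y = r k \<odot>\<^bsub>C\<^esub> y) \<longrightarrow>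
        (\<exists>!z. z \<in> hom C Y A \<and> e \<odot>\<^bsub>C\<^esub> z = y))"

definition parallel_pairs ::
  "('o, 'a) category \<Rightarrow> 'o \<Rightarrow> 'k set \<Rightarrow> ('k \<Rightarrow> 'a) \<Rightarrow> ('k \<Rightarrow> 'a) \<Rightarrow> bool" where
  "parallel_pairs C X K l r \<longleftrightarrow> X \<in> Obj C \<and> (\<forall>k\<in>K. l k \<in> Arr C \<and> r k \<in> Arr C \<and> Dom C (l k) = X \<and>
     Dom C (r k) = X \<and> Cod C (r k) = Cod C (l k))"

text \<open>The shape of the diagram of which a joint equalizer is the limit: one object \<open>None\<close>, and two
  parallel arrows from it to \<open>Some k\<close> for each \<open>k\<close>.\<close>

datatype 'k fork_arr = Unit "'k option" | Left 'k | Right 'k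

definition fork :: "'k set \<Rightarrow> ('k option, 'k fork_arr) category" where
  "fork K = \<lparr>Obj = insert None (Some ` K),
     Arr = Unit ` insert None (Some ` K) \<union> Left ` K \<union> Right ` K,
     Dom = (\<lambda>a. case a of Unit i \<Rightarrow> i | _ \<Rightarrow> None),
     Cod = (\<lambda>a. case a of Unit i \<Rightarrow> i | Left k \<Rightarrow> Some k | Right k \<Rightarrow> Some k),
     Id = Unit,
     Comp = (\<lambda>b a. case a of Unit i \<Rightarrow> b | _ \<Rightarrow> a)\<rparr>"

definition fork_functor ::
  "('o, 'a) category \<Rightarrow> 'o \<Rightarrow> ('k \<Rightarrow> 'a) \<Rightarrow> ('k \<Rightarrow> 'a) \<Rightarrow> ('k option, 'k fork_arr, 'o, 'a) funct" where
  "fork_functor C X l r =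
     \<lparr>OMap = (\<lambda>i. case i of None \<Rightarrow> X | Some k \<Rightarrow> Cod C (l k)),
      AMap = (\<lambda>a. case a of Unit i \<Rightarrow> Id C (case i of None \<Rightarrow> X | Some k \<Rightarrow> Cod C (l k))
        | Left k \<Rightarrow> l k | Right k \<Rightarrow> r k)\<rparr>"

lemma category_fork: "category (fork K)"
  by (rule categoryI) (auto simp: fork_def split: fork_arr.splits)

context category
begin

lemma functor_fork:
  "parallel_pairs C X K l r \<Longrightarrow> is_functor (fork K) C (fork_functor C X l r)"
  by (auto simp: is_functor_def fork_def fork_functor_def parallel_pairs_def hom_iff)

lemma cone_fork_iff:
  assumes "parallel_pairs C X K l r"
  shows "cone (fork K) C (fork_functor C X l r) y \<psi> \<longleftrightarrow> y \<in> Obj C \<and> \<psi> None \<in> hom C y X \<and>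
    (\<forall>k\<in>K. \<psi> (Some k) = l k \<odot> \<psi> None \<and> l k \<odot> \<psi> None = r k \<odot> \<psi> None)"
  using assms by (auto simp: cone_def fork_def fork_functor_def parallel_pairs_def hom_iff ball_Un)

text \<open>A cone over such a diagram is determined by its leg at \<open>None\<close>.\<close>

lemma limit_fork_iff:
  assumes P: "parallel_pairs C X K l r" and e: "e \<in> hom C A X" "A \<in> Obj C"
  shows "limit_cone (fork K) C (fork_functor C X l r) A (\<lambda>i. case i of None \<Rightarrow> e | Some k \<Rightarrow> l k \<odot> e)
    \<longleftrightarrow> joint_equalizer C X K l r A e" (is "limit_cone _ _ ?F A ?\<pi> \<longleftrightarrow> _")
proof -
  have leg: "(\<forall>i\<in>Obj (fork K). ?\<pi> i \<odot> f = \<psi> i) \<longleftrightarrow> e \<odot> f = \<psi> None"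
    if "cone (fork K) C ?F y \<psi>" "f \<in> hom C y A" for y \<psi> f
    using that P e unfolding cone_fork_iff[OF P]
    by (auto simp: fork_def assoc hom_iff parallel_pairs_def)
  have unique: "(\<exists>!f. f \<in> hom C y A \<and> (\<forall>i\<in>Obj (fork K). ?\<pi> i \<odot> f = \<psi> i)) \<longleftrightarrow>
      (\<exists>!f. f \<in> hom C y A \<and> e \<odot> f = \<psi> None)" if "cone (fork K) C ?F y \<psi>" for y \<psi>
    by (rule arg_cong[of _ _ Ex1], rule ext) (use leg[OF that] in blast)
  show ?thesis
  proof
    assume L: "limit_cone (fork K) C ?F A ?\<pi>"
    have "\<exists>!z. z \<in> hom C Y A \<and> e \<odot> z = y"
      if y: "y \<in> hom C Y X" "\<forall>k\<in>K. l k \<odot> y = r k \<odot> y" for Y y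
    proof -
      let ?\<psi> = "\<lambda>i. case i of None \<Rightarrow> y | Some k \<Rightarrow> l k \<odot> y"
      have c: "cone (fork K) C ?F Y ?\<psi>" using y by (auto simp: cone_fork_iff[OF P] hom_iff)
      then have "\<exists>!f. f \<in> hom C Y A \<and> (\<forall>i\<in>Obj (fork K). ?\<pi> i \<odot> f = ?\<psi> i)"
        using L unfolding limit_cone_def by blast
      then show ?thesis unfolding unique[OF c] by simp
    qed
    then show "joint_equalizer C X K l r A e"
      using L e unfolding limit_cone_def cone_fork_iff[OF P] joint_equalizer_def by auto
  next
    assume J: "joint_equalizer C X K l r A e"
    have "\<exists>!f. f \<in> hom C y A \<and> e \<odot> f = \<psi> None" if "cone (fork K) C ?F y \<psi>" for y \<psi>
      using that J unfolding cone_fork_iff[OF P] joint_equalizer_def by blast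
    moreover have "cone (fork K) C ?F A ?\<pi>"
      using J e unfolding cone_fork_iff[OF P] joint_equalizer_def by auto
    ultimately show "limit_cone (fork K) C ?F A ?\<pi>"
      unfolding limit_cone_def using unique by blast
  qed
qed

lemma fork_relabelling:
  assumes "infinite (UNIV :: 's set)" "countable K"
  obtains p q where "relabelling (fork K) (p :: _ \<Rightarrow> 's) (q :: _ \<Rightarrow> 's)"
proof (rule countable_relabelling[OF assms(1) category_fork])
  show "countable (Obj (fork K))" "countable (Arr (fork K))"
    using assms(2) by (auto simp: fork_def)
qed (rule that)

lemma joint_equalizer_exists:
  assumes "infinite (UNIV :: 's set)" "small_complete TYPE('s) C" "countable K"
    and P: "parallel_pairs C X K l r"
  shows "\<exists>A e. joint_equalizer C X K l r A e"
proof -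
  obtain p q where "relabelling (fork K) (p :: _ \<Rightarrow> 's) (q :: _ \<Rightarrow> 's)"
    by (rule fork_relabelling[OF assms(1,3)])
  then obtain A \<pi> where L: "limit_cone (fork K) C (fork_functor C X l r) A \<pi>"
    using relabelling.small_limit[OF _ assms(2) functor_fork[OF P]] by blast
  then have c: "\<pi> None \<in> hom C A X" "A \<in> Obj C" "\<forall>k\<in>K. \<pi> (Some k) = l k \<odot> \<pi> None"
    by (auto simp: limit_cone_def cone_fork_iff[OF P])
  have "limit_cone (fork K) C (fork_functor C X l r) A \<pi> \<longleftrightarrow> limit_cone (fork K) C
      (fork_functor C X l r) A (\<lambda>i. case i of None \<Rightarrow> \<pi> None | Some k \<Rightarrow> l k \<odot> \<pi> None)"
    by (rule limit_cone_cong[OF category_fork]) (use c(3) in \<open>auto simp: fork_def\<close>)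
  then show ?thesis using L limit_fork_iff[OF P c(1,2)] by blast
qed

text \<open>The image is again described as a joint equalizer of a family over the same index set, so that
  the lemma can be iterated: coassociativity of a restricted coaction is checked after composition
  with the inclusion to which \<open>B\<close> has been applied twice.\<close>

lemma joint_equalizer_preserved:
  assumes "infinite (UNIV :: 's set)" "left_exact TYPE('s) C B" "is_functor C C B" "countable K"
    and P: "parallel_pairs C X K l r" and J: "joint_equalizer C X K l r A e"
  shows "joint_equalizer C (OMap B X) K (\<lambda>k. AMap B (l k)) (\<lambda>k. AMap B (r k)) (OMap B A) (AMap B e)"
proof -
  note B = functor_simps[OF assms(3)]
  obtain p q where R: "relabelling (fork K) (p :: _ \<Rightarrow> 's) (q :: _ \<Rightarrow> 's)"
    by (rule fork_relabelling[OF assms(1,4)])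
  have e: "e \<in> hom C A X" "A \<in> Obj C" using J by (auto simp: joint_equalizer_def)
  have P': "parallel_pairs C (OMap B X) K (\<lambda>k. AMap B (l k)) (\<lambda>k. AMap B (r k))"
    using P by (auto simp: parallel_pairs_def B)
  have e': "AMap B e \<in> hom C (OMap B A) (OMap B X)" "OMap B A \<in> Obj C"
    using e by (auto simp: hom_iff B)
  have "limit_cone (fork K) C (functor_comp (fork K) B (fork_functor C X l r)) (OMap B A)
      (\<lambda>i. AMap B (case i of None \<Rightarrow> e | Some k \<Rightarrow> l k \<odot> e))"
    using J limit_fork_iff[OF P e] relabelling.left_exact_limit[OF R assms(2) functor_fork[OF P]]
    by blast
  moreover have "limit_cone (fork K) C (functor_comp (fork K) B (fork_functor C X l r)) (OMap B A)
      (\<lambda>i. AMap B (case i of None \<Rightarrow> e | Some k \<Rightarrow> l k \<odot> e)) \<longleftrightarrow>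
    limit_cone (fork K) C (fork_functor C (OMap B X) (\<lambda>k. AMap B (l k)) (\<lambda>k. AMap B (r k)))
      (OMap B A) (\<lambda>i. case i of None \<Rightarrow> AMap B e | Some k \<Rightarrow> AMap B (l k) \<odot> AMap B e)"
    by (rule limit_cone_cong[OF category_fork])
      (use P e in \<open>auto simp: fork_def fork_functor_def functor_comp_def parallel_pairs_def hom_iff B\<close>)
  ultimately show ?thesis using limit_fork_iff[OF P' e'] by blast
qed

lemma joint_equalizer_factor:
  assumes "joint_equalizer C X K l r A e" "y \<in> Arr C" "Cod C y = X" "\<And>k. k \<in> K \<Longrightarrow> l k \<odot> y = r k \<odot> y"
  shows "\<exists>z. z \<in> Arr C \<and> Dom C z = Dom C y \<and> Cod C z = A \<and> e \<odot> z = y"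
proof -
  have "\<exists>!z. z \<in> hom C (Dom C y) A \<and> e \<odot> z = y"
    using assms unfolding joint_equalizer_def hom_iff by blast
  then show ?thesis unfolding hom_iff by blast
qed

lemma joint_equalizer_mono:
  assumes P: "parallel_pairs C X K l r" and J: "joint_equalizer C X K l r A e"
    and y: "y \<in> Arr C" "Cod C y = A" and z: "z \<in> Arr C" "Cod C z = A" "Dom C y = Dom C z"
    and eq: "e \<odot> y = e \<odot> z"
  shows "y = z"
proof -
  have e: "e \<in> Arr C" "Dom C e = A" "Cod C e = X" using J by (auto simp: joint_equalizer_def hom_iff)
  have "l k \<odot> (e \<odot> y) = r k \<odot> (e \<odot> y)" if "k \<in> K" for k
  proof -
    have "l k \<odot> e = r k \<odot> e" using J that by (simp add: joint_equalizer_def)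
    then show ?thesis using e y P that by (simp add: parallel_pairs_def assoc[symmetric])
  qed
  moreover have "e \<odot> y \<in> hom C (Dom C y) X" using e y by (simp add: hom_iff)
  ultimately have "\<exists>!w. w \<in> hom C (Dom C y) A \<and> e \<odot> w = e \<odot> y"
    using J unfolding joint_equalizer_def by blast
  moreover have "y \<in> hom C (Dom C y) A" "z \<in> hom C (Dom C y) A" using y z by (simp_all add: hom_iff)
  ultimately show ?thesis using eq by metis
qed

end

section \<open>Comodules\<close>

locale comonad_on = category C
  for C :: "('o, 'a) category" (structure) +
  fixes W :: "('o, 'a) comonad_data"
  assumes W: "comonad C W"
begin

abbreviation BO :: "'o \<Rightarrow> 'o" where "BO \<equiv> OMap (cfun W)"
abbreviation BA :: "'a \<Rightarrow> 'a" where "BA \<equiv> AMap (cfun W)"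

lemma B_functor: "is_functor C C (cfun W)"
  using W by (simp add: comonad_def Let_def)

lemmas B_simps [simp] = functor_simps[OF B_functor]

lemma comult_simps [simp]:
  "X \<in> Obj C \<Longrightarrow> comult W X \<in> Arr C" "X \<in> Obj C \<Longrightarrow> Dom C (comult W X) = BO X"
  "X \<in> Obj C \<Longrightarrow> Cod C (comult W X) = BO (BO X)"
  using W by (auto simp: comonad_def Let_def nat_trans_def hom_iff)

lemma counit_simps [simp]:
  "X \<in> Obj C \<Longrightarrow> counit W X \<in> Arr C" "X \<in> Obj C \<Longrightarrow> Dom C (counit W X) = BO X"
  "X \<in> Obj C \<Longrightarrow> Cod C (counit W X) = X"
  using W by (auto simp: comonad_def Let_def nat_trans_def hom_iff id_functor_def)

lemma comult_nat: "f \<in> Arr C \<Longrightarrow> BA (BA f) \<odot> comult W (Dom C f) = comult W (Cod C f) \<odot> BA f"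
  using W by (auto simp: comonad_def Let_def nat_trans_def)

lemma counit_nat: "f \<in> Arr C \<Longrightarrow> f \<odot> counit W (Dom C f) = counit W (Cod C f) \<odot> BA f"
  using W by (auto simp: comonad_def Let_def nat_trans_def id_functor_def)

lemma comonad_axioms_simps:
  assumes "X \<in> Obj C"
  shows "BA (comult W X) \<odot> comult W X = comult W (BO X) \<odot> comult W X"
    "BA (counit W X) \<odot> comult W X = Id C (BO X)" "counit W (BO X) \<odot> comult W X = Id C (BO X)"
  using W assms by (auto simp: comonad_def Let_def)

lemma comoduleD:
  assumes "M \<in> comodules C W"
  shows "fst M \<in> Obj C" "snd M \<in> Arr C" "Dom C (snd M) = fst M" "Cod C (snd M) = BO (fst M)"
    and "comult W (fst M) \<odot> snd M = BA (snd M) \<odot> snd M"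
    and "counit W (fst M) \<odot> snd M = Id C (fst M)"
  using assms by (auto simp: comodules_def hom_iff)

lemma comoduleI:
  assumes "X \<in> Obj C" "\<rho> \<in> Arr C" "Dom C \<rho> = X" "Cod C \<rho> = BO X"
    and "comult W X \<odot> \<rho> = BA \<rho> \<odot> \<rho>" and "counit W X \<odot> \<rho> = Id C X"
  shows "(X, \<rho>) \<in> comodules C W"
  using assms by (auto simp: comodules_def hom_iff)

text \<open>Unlike an arrow of \<open>CoMod\<close>, which carries its source and target, this is a property of an
  arrow of \<open>C\<close>, so that composites can be computed in \<open>C\<close>.\<close>

definition colinear :: "'o \<times> 'a \<Rightarrow> 'a \<Rightarrow> 'o \<times> 'a \<Rightarrow> bool" where
  "colinear M f N \<longleftrightarrow> M \<in> comodules C W \<and> N \<in> comodules C W \<and> f \<in> Arr C \<and> Dom C f = fst M \<and>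
     Cod C f = fst N \<and> BA f \<odot> snd M = snd N \<odot> f"

definition cofree :: "'o \<Rightarrow> 'o \<times> 'a" where
  "cofree X = (BO X, comult W X)"

lemma cofree_simps [simp]: "fst (cofree X) = BO X" "snd (cofree X) = comult W X"
  by (auto simp: cofree_def)

lemma cofree_comodule [simp]: "X \<in> Obj C \<Longrightarrow> cofree X \<in> comodules C W"
  unfolding cofree_def by (rule comoduleI) (auto simp: comonad_axioms_simps)

lemma colinear_Id: "M \<in> comodules C W \<Longrightarrow> colinear M (Id C (fst M)) M"
  using comoduleD[of M] by (simp add: colinear_def)

lemma colinear_comp:
  assumes "colinear M f N" "colinear N g P"
  shows "colinear M (g \<odot> f) P"
proof -
  have M: "M \<in> comodules C W" and N: "N \<in> comodules C W" and P: "P \<in> comodules C W"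
    and f [simp]: "f \<in> Arr C" "Dom C f = fst M" "Cod C f = fst N"
    and g [simp]: "g \<in> Arr C" "Dom C g = fst N" "Cod C g = fst P"
    and f_lin: "BA f \<odot> snd M = snd N \<odot> f" and g_lin: "BA g \<odot> snd N = snd P \<odot> g"
    using assms by (auto simp: colinear_def)
  note [simp] = comoduleD(1-4)[OF M] comoduleD(1-4)[OF N] comoduleD(1-4)[OF P]
  have "BA (g \<odot> f) \<odot> snd M = BA g \<odot> (BA f \<odot> snd M)" by (simp add: assoc)
  also have "\<dots> = (BA g \<odot> snd N) \<odot> f" by (simp add: f_lin assoc)
  also have "\<dots> = snd P \<odot> (g \<odot> f)" by (simp add: g_lin assoc)
  finally show ?thesis using M P by (simp add: colinear_def)
qed

lemma colinear_cofree: "f \<in> Arr C \<Longrightarrow> colinear (cofree (Dom C f)) (BA f) (cofree (Cod C f))"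
  by (simp add: colinear_def comult_nat)

text \<open>The colinear map into the cofree comodule that corresponds to an arrow \<open>v\<close> of \<open>C\<close>.  The next
  lemmas say that composition with the counit is inverse to it, so that cofree comodules are the
  values of a right adjoint.\<close>

definition lift :: "'o \<times> 'a \<Rightarrow> 'a \<Rightarrow> 'a" where
  "lift M v = BA v \<odot> snd M"

lemma colinear_lift:
  assumes M: "M \<in> comodules C W" and v: "v \<in> Arr C" "Dom C v = fst M"
  shows "colinear M (lift M v) (cofree (Cod C v))"
proof -
  note [simp] = comoduleD(1-4)[OF M] v
  have "BA (BA v \<odot> snd M) \<odot> snd M = BA (BA v) \<odot> (BA (snd M) \<odot> snd M)" by (simp add: assoc)
  also have "\<dots> = (BA (BA v) \<odot> comult W (fst M)) \<odot> snd M"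
    by (simp add: assoc comoduleD(5)[OF M, symmetric])
  also have "\<dots> = comult W (Cod C v) \<odot> (BA v \<odot> snd M)"
    using comult_nat[of v] by (simp add: assoc)
  finally show ?thesis using M by (simp add: colinear_def lift_def)
qed

lemma counit_lift:
  assumes M: "M \<in> comodules C W" and v: "v \<in> Arr C" "Dom C v = fst M"
  shows "counit W (Cod C v) \<odot> lift M v = v"
proof -
  note [simp] = comoduleD(1-4)[OF M] v
  have "counit W (Cod C v) \<odot> lift M v = (counit W (Cod C v) \<odot> BA v) \<odot> snd M"
    by (simp add: lift_def assoc)
  also have "\<dots> = v \<odot> (counit W (fst M) \<odot> snd M)"
    using counit_nat[of v] by (simp add: assoc[symmetric])
  finally show ?thesis by (simp add: comoduleD(6)[OF M])
qed

lemma lift_counit: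
  assumes x: "colinear M x (cofree X)" and X: "X \<in> Obj C"
  shows "lift M (counit W X \<odot> x) = x"
proof -
  note x = x[unfolded colinear_def]
  have M: "M \<in> comodules C W" using x by blast
  note [simp] = comoduleD(1-4)[OF M] X
  have "lift M (counit W X \<odot> x) = BA (counit W X) \<odot> (BA x \<odot> snd M)"
    using x by (simp add: lift_def assoc)
  also have "\<dots> = (BA (counit W X) \<odot> comult W X) \<odot> x" using x by (simp add: assoc)
  finally show ?thesis using x by (simp add: comonad_axioms_simps)
qed

lemma colinear_into_cofree_eqI:
  assumes "colinear M x (cofree X)" "colinear M y (cofree X)" "X \<in> Obj C"
    and "counit W X \<odot> x = counit W X \<odot> y"
  shows "x = y"
  using lift_counit[OF assms(1,3)] lift_counit[OF assms(2,3)] assms(4) by metis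

text \<open>A subcomodule of the cofree comodule on \<open>X\<close> that is universal among colinear maps
  satisfying the equations in \<open>K\<close>.  The pairs in \<open>K\<close> consist of arbitrary arrows of \<open>C\<close>, and \<open>e\<close> is
  monic in \<open>C\<close>, not only among colinear maps.\<close>

definition equalizer_comodule :: "'o \<Rightarrow> ('a \<times> 'a) set \<Rightarrow> 'o \<times> 'a \<Rightarrow> 'a \<Rightarrow> bool" where
  "equalizer_comodule X K M e \<longleftrightarrow> colinear M e (cofree X) \<and> (\<forall>(a, b)\<in>K. a \<odot> e = b \<odot> e) \<and>
    (\<forall>y z. y \<in> Arr C \<and> z \<in> Arr C \<and> Dom C y = Dom C z \<and> Cod C y = fst M \<and> Cod C z = fst M \<and>
      e \<odot> y = e \<odot> z \<longrightarrow> y = z) \<and>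
    (\<forall>N x. colinear N x (cofree X) \<and> (\<forall>(a, b)\<in>K. a \<odot> x = b \<odot> x) \<longrightarrow>
      (\<exists>y. colinear N y M \<and> e \<odot> y = x))"

end

text \<open>The parameter \<open>S\<close> names the type that bounds the size of diagrams.\<close>

locale lex_comonad = comonad_on C W
  for C :: "('o, 'a) category" (structure) and W +
  fixes S :: "'s itself"
  assumes infinite_size: "infinite (UNIV :: 's set)"
    and complete: "small_complete TYPE('s) C" and lex: "left_exact TYPE('s) C (cfun W)"
begin

text \<open>Replace \<open>a\<close> and \<open>b\<close> by their lifts \<open>B(a) \<Delta>\<close> and \<open>B(b) \<Delta>\<close>, which are colinear maps between cofree
  comodules and impose the same condition on colinear maps into \<open>B(X)\<close>.  Let \<open>e : A \<rightarrow> B(X)\<close> be their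
  joint equalizer in \<open>C\<close>.  By colinearity of the lifts \<open>\<Delta> e\<close> equalizes the images of the pairs under
  \<open>B\<close>, and since \<open>B(e)\<close> is again a joint equalizer, \<open>\<Delta> e\<close> factors as \<open>B(e) \<rho>\<close>.  The axioms for \<open>\<rho>\<close> and
  colinearity of factorisations hold because \<open>e\<close>, \<open>B(e)\<close> and \<open>B(B(e))\<close> are monic.\<close>

lemma equalizer_comodule_exists:
  assumes X: "X \<in> Obj C" and K: "countable K"
    and P: "\<And>a b. (a, b) \<in> K \<Longrightarrow>
      a \<in> Arr C \<and> b \<in> Arr C \<and> Dom C a = BO X \<and> Dom C b = BO X \<and> Cod C b = Cod C a"
  shows "\<exists>M e. equalizer_comodule X K M e"
proof -
  have cX: "cofree X \<in> comodules C W" using X by simp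
  define l where "l = (\<lambda>k :: 'a \<times> 'a. lift (cofree X) (fst k))"
  define r where "r = (\<lambda>k :: 'a \<times> 'a. lift (cofree X) (snd k))"
  have k_arr: "fst k \<in> Arr C" "snd k \<in> Arr C" "Dom C (fst k) = BO X" "Dom C (snd k) = BO X"
    "Cod C (snd k) = Cod C (fst k)" if "k \<in> K" for k
    using P[of "fst k" "snd k"] that by auto
  have l: "colinear (cofree X) (l k) (cofree (Cod C (fst k)))"
    "counit W (Cod C (fst k)) \<odot> l k = fst k" if "k \<in> K" for k
    using colinear_lift[OF cX, of "fst k"] counit_lift[OF cX, of "fst k"] k_arr[OF that]
    by (auto simp: l_def)
  have r: "colinear (cofree X) (r k) (cofree (Cod C (fst k)))"
    "counit W (Cod C (fst k)) \<odot> r k = snd k" if "k \<in> K" for k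
    using colinear_lift[OF cX, of "snd k"] counit_lift[OF cX, of "snd k"] k_arr[OF that]
    by (auto simp: r_def)
  have l': "l k \<in> Arr C" "Dom C (l k) = BO X" "Cod C (l k) = BO (Cod C (fst k))"
    and l_lin: "BA (l k) \<odot> comult W X = comult W (Cod C (fst k)) \<odot> l k" if "k \<in> K" for k
    using l(1)[OF that] by (simp_all add: colinear_def)
  have r': "r k \<in> Arr C" "Dom C (r k) = BO X" "Cod C (r k) = BO (Cod C (fst k))"
    and r_lin: "BA (r k) \<odot> comult W X = comult W (Cod C (fst k)) \<odot> r k" if "k \<in> K" for k
    using r(1)[OF that] by (simp_all add: colinear_def)
  have pp: "parallel_pairs C (BO X) K l r"
    using l' r' X by (simp add: parallel_pairs_def)
  obtain A e where J: "joint_equalizer C (BO X) K l r A e"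
    using joint_equalizer_exists[OF infinite_size complete K pp] by blast
  have pp1: "parallel_pairs C (BO (BO X)) K (\<lambda>k. BA (l k)) (\<lambda>k. BA (r k))"
    using pp by (simp add: parallel_pairs_def)
  have pp2: "parallel_pairs C (BO (BO (BO X))) K (\<lambda>k. BA (BA (l k))) (\<lambda>k. BA (BA (r k)))"
    using pp by (simp add: parallel_pairs_def)
  note pres = joint_equalizer_preserved[OF infinite_size lex B_functor K]
  note J1 = pres[OF pp J]
  note J2 = pres[OF pp1 J1]
  note mono = joint_equalizer_mono[OF pp J] joint_equalizer_mono[OF pp1 J1]
    joint_equalizer_mono[OF pp2 J2]
  have A: "A \<in> Obj C" and e: "e \<in> Arr C" "Dom C e = A" "Cod C e = BO X"
    using J by (auto simp: joint_equalizer_def hom_iff)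
  note [simp] = A e X
  have eq: "l k \<odot> e = r k \<odot> e" if "k \<in> K" for k using J that by (auto simp: joint_equalizer_def)
  have Be_eq: "BA (l k) \<odot> (comult W X \<odot> e) = BA (r k) \<odot> (comult W X \<odot> e)" if k: "k \<in> K" for k
  proof -
    have "BA (l k) \<odot> (comult W X \<odot> e) = (BA (l k) \<odot> comult W X) \<odot> e"
      using l'[OF k] by (simp add: assoc)
    also have "\<dots> = comult W (Cod C (fst k)) \<odot> (l k \<odot> e)"
      using l'[OF k] k_arr[OF k] by (simp add: l_lin[OF k] assoc)
    also have "\<dots> = (BA (r k) \<odot> comult W X) \<odot> e"
      using r'[OF k] k_arr[OF k] by (simp add: r_lin[OF k] assoc eq[OF k])
    also have "\<dots> = BA (r k) \<odot> (comult W X \<odot> e)"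
      using r'[OF k] by (simp add: assoc)
    finally show ?thesis .
  qed
  obtain \<rho> where \<rho> [simp]: "\<rho> \<in> Arr C" "Dom C \<rho> = A" "Cod C \<rho> = BO A"
    and e\<rho>: "BA e \<odot> \<rho> = comult W X \<odot> e"
    using joint_equalizer_factor[OF J1, of "comult W X \<odot> e"] Be_eq by auto
  have M: "(A, \<rho>) \<in> comodules C W"
  proof (rule comoduleI)
    have "BA (BA e) \<odot> (comult W A \<odot> \<rho>) = (BA (BA e) \<odot> comult W A) \<odot> \<rho>" by (simp add: assoc)
    also have "\<dots> = comult W (BO X) \<odot> (BA e \<odot> \<rho>)" using comult_nat[of e] by (simp add: assoc)
    also have "\<dots> = (comult W (BO X) \<odot> comult W X) \<odot> e" by (simp add: e\<rho> assoc)
    also have "\<dots> = BA (comult W X) \<odot> (BA e \<odot> \<rho>)"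
      by (simp add: comonad_axioms_simps(1)[OF X, symmetric] e\<rho> assoc)
    also have "\<dots> = BA (comult W X \<odot> e) \<odot> \<rho>" by (simp add: assoc)
    also have "\<dots> = BA (BA e) \<odot> (BA \<rho> \<odot> \<rho>)" by (simp add: e\<rho>[symmetric] assoc)
    finally show "comult W A \<odot> \<rho> = BA \<rho> \<odot> \<rho>" by (rule mono(3)[rotated -1]) auto
    have "e \<odot> (counit W A \<odot> \<rho>) = (e \<odot> counit W A) \<odot> \<rho>" by (simp add: assoc)
    also have "\<dots> = counit W (BO X) \<odot> (BA e \<odot> \<rho>)" using counit_nat[of e] by (simp add: assoc)
    also have "\<dots> = (counit W (BO X) \<odot> comult W X) \<odot> e" by (simp add: e\<rho> assoc)
    also have "\<dots> = e \<odot> Id C A" by (simp add: comonad_axioms_simps)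
    finally show "counit W A \<odot> \<rho> = Id C A" by (rule mono(1)[rotated -1]) auto
  qed auto
  have "colinear (A, \<rho>) e (cofree X)" using M by (simp add: colinear_def e\<rho>)
  moreover have "fst k \<odot> e = snd k \<odot> e" if k: "k \<in> K" for k
  proof -
    have "fst k \<odot> e = counit W (Cod C (fst k)) \<odot> (l k \<odot> e)"
      using l'[OF k] k_arr[OF k] by (subst l(2)[OF k, symmetric]) (simp add: assoc)
    also have "\<dots> = snd k \<odot> e"
      using r'[OF k] k_arr[OF k] by (subst r(2)[OF k, symmetric]) (simp add: assoc eq[OF k])
    finally show ?thesis .
  qed
  moreover have "\<exists>y. colinear N y (A, \<rho>) \<and> e \<odot> y = x"
    if x: "colinear N x (cofree X)" and Kx: "\<forall>(a, b)\<in>K. a \<odot> x = b \<odot> x" for N x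
  proof -
    note x' = x[unfolded colinear_def]
    have N: "N \<in> comodules C W" using x' by blast
    note [simp] = comoduleD(1-4)[OF N]
    have "l k \<odot> x = r k \<odot> x" if k: "k \<in> K" for k
    proof (rule colinear_into_cofree_eqI)
      show "colinear N (l k \<odot> x) (cofree (Cod C (fst k)))" "colinear N (r k \<odot> x) (cofree (Cod C (fst k)))"
        using colinear_comp[OF x] l(1)[OF k] r(1)[OF k] by blast+
      have "counit W (Cod C (fst k)) \<odot> (l k \<odot> x) = fst k \<odot> x"
        using l'[OF k] k_arr[OF k] x' by (subst (2) l(2)[OF k, symmetric]) (simp add: assoc)
      moreover have "counit W (Cod C (fst k)) \<odot> (r k \<odot> x) = snd k \<odot> x"
        using r'[OF k] k_arr[OF k] x' by (subst r(2)[OF k, symmetric]) (simp add: assoc)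
      moreover have "fst k \<odot> x = snd k \<odot> x" using Kx k by auto
      ultimately show "counit W (Cod C (fst k)) \<odot> (l k \<odot> x) = counit W (Cod C (fst k)) \<odot> (r k \<odot> x)"
        by simp
    qed (use k_arr[OF k] in simp)
    then obtain y where y [simp]: "y \<in> Arr C" "Dom C y = fst N" "Cod C y = A" and ey: "e \<odot> y = x"
      using joint_equalizer_factor[OF J, of x] x' by auto
    have "BA e \<odot> (BA y \<odot> snd N) = BA (e \<odot> y) \<odot> snd N" by (simp add: assoc)
    also have "\<dots> = comult W X \<odot> (e \<odot> y)" using x' by (simp add: ey)
    also have "\<dots> = (BA e \<odot> \<rho>) \<odot> y" by (simp add: e\<rho> assoc)
    also have "\<dots> = BA e \<odot> (\<rho> \<odot> y)" by (simp add: assoc)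
    finally have "BA y \<odot> snd N = \<rho> \<odot> y" by (rule mono(2)[rotated -1]) auto
    then have "colinear N y (A, \<rho>)" using M N by (simp add: colinear_def)
    then show ?thesis using ey by blast
  qed
  ultimately have "equalizer_comodule X K (A, \<rho>) e"
    using mono(1) by (simp add: equalizer_comodule_def case_prod_unfold)
  then show ?thesis by blast
qed

end

context comonad_on
begin

lemma CB_simps [simp]:
  "Obj (CB C W) = comodules C W"
  "(M, f, N) \<in> Arr (CB C W) \<longleftrightarrow> M \<in> comodules C W \<and> N \<in> comodules C W \<and> f \<in> Arr C \<and>
    Dom C f = fst M \<and> Cod C f = fst N"
  "Dom (CB C W) (M, f, N) = M" "Cod (CB C W) (M, f, N) = N"
  "Id (CB C W) M = (M, Id C (fst M), M)"
  "(N, g, P) \<odot>\<^bsub>CB C W\<^esub> (M, f, N') = (M, g \<odot> f, P)"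
  by (auto simp: CB_def hom_iff)

lemma CoMod_simps [simp]:
  "Obj (CoMod C W) = comodules C W"
  "(M, f, N) \<in> Arr (CoMod C W) \<longleftrightarrow> colinear M f N"
  "Dom (CoMod C W) = Dom (CB C W)" "Cod (CoMod C W) = Cod (CB C W)" "Id (CoMod C W) = Id (CB C W)"
  "g' \<odot>\<^bsub>CoMod C W\<^esub> f' = g' \<odot>\<^bsub>CB C W\<^esub> f'"
  by (cases M; cases N; auto simp: CoMod_def CB_def hom_iff colinear_def)+

lemma category_CB: "category (CB C W)"
proof (rule categoryI, goal_cases)
  case (1 f)
  then show ?case by (cases f) auto
next
  case (2 M)
  then show ?case using comoduleD[of M] by auto
next
  case (3 f g)
  then show ?case by (cases f; cases g) auto
next
  case (4 f)
  then show ?case by (cases f) auto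
next
  case (5 f g h)
  then show ?case by (cases f; cases g; cases h) (auto simp: assoc)
qed

lemma Arr_CoMod_subset: "Arr (CoMod C W) \<subseteq> Arr (CB C W)"
proof
  fix f assume "f \<in> Arr (CoMod C W)"
  then show "f \<in> Arr (CB C W)" by (cases f) (auto simp: colinear_def)
qed

lemma category_CoMod: "category (CoMod C W)"
proof -
  have "category (CB C W\<lparr>Obj := Obj (CB C W), Arr := Arr (CoMod C W)\<rparr>)"
  proof (rule category_restrict[OF category_CB], goal_cases)
    case (3 f)
    then show ?case by (cases f) (auto simp: colinear_def)
  next
    case (4 M)
    then show ?case by (simp add: colinear_Id)
  next
    case (5 f g)
    then show ?case by (cases f; cases g) (auto intro: colinear_comp)
  qed (use Arr_CoMod_subset in auto)
  moreover have "CB C W\<lparr>Obj := Obj (CB C W), Arr := Arr (CoMod C W)\<rparr> = CoMod C W"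
    by (simp add: CoMod_def CB_def del: CB_simps)
  ultimately show ?thesis by simp
qed

lemma functor_CoMod_CB: "is_functor I (CoMod C W) F \<Longrightarrow> is_functor I (CB C W) F"
  using Arr_CoMod_subset by (auto simp: is_functor_def hom_def)

lemma nat_trans_CoMod_iff:
  "nat_trans I (CoMod C W) F G \<eta> \<longleftrightarrow>
    nat_trans I (CB C W) F G \<eta> \<and> (\<forall>x\<in>Obj I. \<eta> x \<in> Arr (CoMod C W))"
  using Arr_CoMod_subset by (auto simp: nat_trans_def hom_def)

end

section \<open>Cyclic comodules among para-cyclic objects\<close>

lemma Lambda_proj_tau_top: "AMap Lambda_proj (tau_top n) = Id Lambda n"
proof -
  have "path_cong gens_Z cyclic_rel n [Cyc n (int n + 1)] [] n"
    by (intro path_cong.base cyclic_rel.cyc) auto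
  then show ?thesis using word_arrow_eq by (simp add: Lambda_proj_word_arrow)
qed

lemma functor_Lambda_proj_op: "is_functor (op_cat Lambda_N) (op_cat Lambda) Lambda_proj"
  using functor_simps[OF functor_Lambda_proj] by (auto simp: is_functor_def hom_def)

lemma functor_cyclic_to_para:
  "is_functor (op_cat Lambda) D S \<Longrightarrow> is_functor (op_cat Lambda_N) D (cyclic_to_para S)"
  unfolding cyclic_to_para_def
  by (rule functor_compose[OF category_op[OF category_Lambda(2)] functor_Lambda_proj_op])

lemma cyclic_to_para_simps [simp]:
  "OMap (cyclic_to_para S) n = OMap S n"
  "f \<in> Arr Lambda_N \<Longrightarrow> AMap (cyclic_to_para S) f = AMap S (AMap Lambda_proj f)"
  by (auto simp: cyclic_to_para_def)

context comonad_on
begin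

text \<open>Restriction along the projection makes \<open>\<tau>\<^sub>n\<^sup>n\<^sup>+\<^sup>1\<close> act trivially; conversely a functor with this
  property factors through the projection.  This description and the next one replace functors on
  \<open>\<Lambda>\<close> by functors on \<open>\<Lambda>\<^sub>N\<close>, where the approximation is constructed.\<close>

lemma Obj_CycCoMod:
  "F \<in> Obj (CycCoMod C W) \<longleftrightarrow> is_functor (op_cat Lambda_N) (CoMod C W) F \<and>
    AMap F \<in> extensional (Arr Lambda_N) \<and> (\<forall>n. AMap F (tau_top n) = Id (CoMod C W) (OMap F n))"
proof
  assume "F \<in> Obj (CycCoMod C W)"
  then obtain S where S: "is_functor (op_cat Lambda) (CoMod C W) S" and F: "F = cyclic_to_para S"
    by (auto simp: CycCoMod_def Obj_functor_cat)
  have "AMap F (tau_top n) = Id (CoMod C W) (OMap F n)" for n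
    using functor_simps(5)[OF S, of n] Lambda_proj_tau_top[of n] by (simp add: F)
  moreover have "AMap F \<in> extensional (Arr Lambda_N)"
    by (simp add: F cyclic_to_para_def functor_comp_def)
  ultimately show "is_functor (op_cat Lambda_N) (CoMod C W) F \<and>
      AMap F \<in> extensional (Arr Lambda_N) \<and> (\<forall>n. AMap F (tau_top n) = Id (CoMod C W) (OMap F n))"
    using functor_cyclic_to_para[OF S] by (simp add: F)
next
  assume cyc: "is_functor (op_cat Lambda_N) (CoMod C W) F \<and>
      AMap F \<in> extensional (Arr Lambda_N) \<and> (\<forall>n. AMap F (tau_top n) = Id (CoMod C W) (OMap F n))"
  interpret cyclic_action "CoMod C W" F
    using cyc category_CoMod by (intro cyclic_action.intro cyclic_action_axioms.intro) auto
  obtain S where S: "is_functor (op_cat Lambda) (CoMod C W) S" "OMap S = OMap F"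
    "AMap S \<in> extensional (Arr Lambda)" "\<And>f. f \<in> Arr Lambda_N \<Longrightarrow> AMap S (AMap Lambda_proj f) = AMap F f"
    using factors_through_Lambda by auto
  have "AMap (cyclic_to_para S) = AMap F"
  proof (rule extensionalityI)
    show "AMap (cyclic_to_para S) \<in> extensional (Arr Lambda_N)"
      by (simp add: cyclic_to_para_def functor_comp_def)
    show "AMap F \<in> extensional (Arr Lambda_N)" using cyc by blast
  qed (simp add: S(4))
  moreover have "OMap (cyclic_to_para S) = OMap F" by (rule ext) (simp add: S(2))
  ultimately have "F = cyclic_to_para S" by simp
  moreover have "S \<in> Obj (functor_cat (op_cat Lambda) (CoMod C W))"
    using S by (simp add: Obj_functor_cat)
  ultimately show "F \<in> Obj (CycCoMod C W)" by (auto simp: CycCoMod_def)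
qed

lemma Arr_CycCoMod:
  "(F, \<eta>, G) \<in> Arr (CycCoMod C W) \<longleftrightarrow> F \<in> Obj (CycCoMod C W) \<and> G \<in> Obj (CycCoMod C W) \<and>
    nat_trans (op_cat Lambda_N) (CoMod C W) F G \<eta>"
proof
  assume "(F, \<eta>, G) \<in> Arr (CycCoMod C W)"
  then obtain S U where *: "F = cyclic_to_para S" "G = cyclic_to_para U"
    "(S, \<eta>, U) \<in> Arr (functor_cat (op_cat Lambda) (CoMod C W))"
    by (auto simp: CycCoMod_def)
  then have "nat_trans (op_cat Lambda) (CoMod C W) S U \<eta>" by (simp add: Arr_functor_cat)
  then have n: "\<And>x. \<eta> x \<in> hom (CoMod C W) (OMap S x) (OMap U x)"
    "\<And>f. f \<in> Arr Lambda \<Longrightarrow>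
      AMap U f \<odot>\<^bsub>CoMod C W\<^esub> \<eta> (Cod Lambda f) = \<eta> (Dom Lambda f) \<odot>\<^bsub>CoMod C W\<^esub> AMap S f"
    by (simp_all add: nat_trans_def del: CoMod_simps)
  have "AMap G f \<odot>\<^bsub>CoMod C W\<^esub> \<eta> (Cod Lambda_N f) = \<eta> (Dom Lambda_N f) \<odot>\<^bsub>CoMod C W\<^esub> AMap F f"
    if f: "f \<in> Arr Lambda_N" for f
    using n(2)[OF functor_simps(2)[OF functor_Lambda_proj f]] f
      functor_simps(3,4)[OF functor_Lambda_proj f]
    by (simp add: *(1,2) del: CoMod_simps)
  then have "nat_trans (op_cat Lambda_N) (CoMod C W) F G \<eta>"
    using n(1) by (simp add: nat_trans_def *(1,2) del: CoMod_simps)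
  with * show "F \<in> Obj (CycCoMod C W) \<and> G \<in> Obj (CycCoMod C W) \<and>
      nat_trans (op_cat Lambda_N) (CoMod C W) F G \<eta>"
    by (auto simp: CycCoMod_def Arr_functor_cat)
next
  assume *: "F \<in> Obj (CycCoMod C W) \<and> G \<in> Obj (CycCoMod C W) \<and>
    nat_trans (op_cat Lambda_N) (CoMod C W) F G \<eta>"
  then obtain S U where S: "F = cyclic_to_para S" "S \<in> Obj (functor_cat (op_cat Lambda) (CoMod C W))"
    and U: "G = cyclic_to_para U" "U \<in> Obj (functor_cat (op_cat Lambda) (CoMod C W))"
    by (auto simp: CycCoMod_def)
  note n = nat_trans_def[of "op_cat Lambda_N" "CoMod C W" F G \<eta>, THEN iffD1, OF *[THEN conjunct2, THEN conjunct2]]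
  have "AMap U f \<odot>\<^bsub>CoMod C W\<^esub> \<eta> (Cod Lambda f) = \<eta> (Dom Lambda f) \<odot>\<^bsub>CoMod C W\<^esub> AMap S f"
    if f: "f \<in> Arr Lambda" for f
  proof -
    obtain g where g: "g \<in> Arr Lambda_N" "AMap Lambda_proj g = f"
      "Dom Lambda_N g = Dom Lambda f" "Cod Lambda_N g = Cod Lambda f"
      by (rule Lambda_proj_full[OF f])
    have "AMap G g \<odot>\<^bsub>CoMod C W\<^esub> \<eta> (Cod Lambda_N g) = \<eta> (Dom Lambda_N g) \<odot>\<^bsub>CoMod C W\<^esub> AMap F g"
      using n g(1) by (simp del: CoMod_simps)
    then show ?thesis using g(1) by (simp add: S(1) U(1) g(2-4) del: CoMod_simps)
  qed
  then have "nat_trans (op_cat Lambda) (CoMod C W) S U \<eta>"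
    using n by (simp add: nat_trans_def S(1) U(1) del: CoMod_simps)
  then have "(S, \<eta>, U) \<in> Arr (functor_cat (op_cat Lambda) (CoMod C W))"
    using S U by (simp add: Arr_functor_cat)
  then show "(F, \<eta>, G) \<in> Arr (CycCoMod C W)"
    unfolding S(1) U(1) CycCoMod_def by (auto intro!: image_eqI[of _ _ "(S, \<eta>, U)"])
qed

abbreviation para_cat :: "(('o, 'a) para_obj, ('o, 'a) para_mor) category" where
  "para_cat \<equiv> functor_cat (op_cat Lambda_N) (CB C W)"

lemma category_para_cat: "category para_cat"
  by (intro category_functor_cat category_op category_Lambda category_CB)

lemma Obj_CycCoMod_subset: "Obj (CycCoMod C W) \<subseteq> pseudo_para_cyclic C W"
proof
  fix F assume "F \<in> Obj (CycCoMod C W)"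
  then have F: "is_functor (op_cat Lambda_N) (CoMod C W) F" "AMap F \<in> extensional (Arr Lambda_N)"
    by (auto simp: Obj_CycCoMod)
  then have "is_functor (op_cat Lambda_plus) (CoMod C W) F"
    using Arr_Lambda_plus
    unfolding is_functor_def op_cat_simps Lambda_plus_simps Lambda_N_simps(1) by blast
  then show "F \<in> pseudo_para_cyclic C W"
    using F functor_CoMod_CB[OF F(1)] by (simp add: pseudo_para_cyclic_def Obj_functor_cat)
qed

lemma Obj_PPC [simp]: "Obj (PPC C W) = pseudo_para_cyclic C W"
  "Obj (PPC_colin C W) = pseudo_para_cyclic C W"
  by (auto simp: PPC_def PPC_colin_def)

lemma Arr_PPC:
  "(S, \<eta>, T) \<in> Arr (PPC C W) \<longleftrightarrow> S \<in> pseudo_para_cyclic C W \<and> T \<in> pseudo_para_cyclic C W \<and>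
    nat_trans (op_cat Lambda_N) (CB C W) S T \<eta>"
  by (auto simp: PPC_def Arr_functor_cat pseudo_para_cyclic_def)

text \<open>Naturality over \<open>\<Lambda>\<^sub>+\<close> follows from naturality over \<open>\<Lambda>\<^sub>N\<close>, so that what remains is a condition on the
  single components.\<close>

lemma Arr_PPC_colin:
  "(S, \<eta>, T) \<in> Arr (PPC_colin C W) \<longleftrightarrow>
    (S, \<eta>, T) \<in> Arr (PPC C W) \<and> (\<forall>n. \<eta> n \<in> Arr (CoMod C W))"
proof -
  have "nat_trans (op_cat Lambda_plus) (CB C W) S T \<eta>" if "(S, \<eta>, T) \<in> Arr (PPC C W)"
    using that Arr_Lambda_plus by (auto simp: Arr_PPC nat_trans_def)
  then show ?thesis by (auto simp: PPC_colin_def nat_trans_CoMod_iff)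
qed

lemma PPC_restrict: "PPC C W = para_cat\<lparr>Obj := pseudo_para_cyclic C W, Arr := Arr (PPC C W)\<rparr>"
  and PPC_colin_restrict:
    "PPC_colin C W = para_cat\<lparr>Obj := pseudo_para_cyclic C W, Arr := Arr (PPC_colin C W)\<rparr>"
  and CycCoMod_restrict:
    "CycCoMod C W = para_cat\<lparr>Obj := Obj (CycCoMod C W), Arr := Arr (CycCoMod C W)\<rparr>"
  by (simp_all add: PPC_def PPC_colin_def CycCoMod_def)

lemma Arr_PPC_subset: "Arr (PPC C W) \<subseteq> Arr para_cat"
  by (auto simp: PPC_def)

lemma Arr_CycCoMod_subset: "Arr (CycCoMod C W) \<subseteq> Arr (PPC_colin C W)"
proof
  fix f assume f: "f \<in> Arr (CycCoMod C W)"
  obtain F \<eta> G where "f = (F, \<eta>, G)" by (cases f)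
  with f show "f \<in> Arr (PPC_colin C W)"
    using Obj_CycCoMod_subset by (auto simp: Arr_CycCoMod Arr_PPC_colin Arr_PPC nat_trans_CoMod_iff)
qed

lemma Arr_PPC_colin_subset: "Arr (PPC_colin C W) \<subseteq> Arr (PPC C W)"
  by (auto simp: PPC_colin_def)

lemma category_PPC: "category (PPC C W)"
proof (subst PPC_restrict, rule category_restrict[OF category_para_cat])
  interpret E: category para_cat by (rule category_para_cat)
  fix T assume T: "T \<in> pseudo_para_cyclic C W"
  then have "Id para_cat T \<in> Arr para_cat" by (intro E.Id_arr) (simp add: pseudo_para_cyclic_def)
  with T show "Id para_cat T \<in> Arr (PPC C W)" by (simp add: PPC_def)
next
  interpret E: category para_cat by (rule category_para_cat)
  fix f g assume f: "f \<in> Arr (PPC C W)" and g: "g \<in> Arr (PPC C W)" and c: "Cod para_cat f = Dom para_cat g"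
  then have "g \<odot>\<^bsub>para_cat\<^esub> f \<in> Arr para_cat" using Arr_PPC_subset by (intro E.comp_arr) auto
  with f g show "g \<odot>\<^bsub>para_cat\<^esub> f \<in> Arr (PPC C W)" by (auto simp: PPC_def)
qed (auto simp: PPC_def pseudo_para_cyclic_def)

lemma colin_comp_arr:
  assumes "(S, \<alpha>, T) \<in> Arr (PPC C W)" "(T, \<beta>, U) \<in> Arr (PPC C W)"
    "\<alpha> n \<in> Arr (CoMod C W)" "\<beta> n \<in> Arr (CoMod C W)"
  shows "\<beta> n \<odot>\<^bsub>CB C W\<^esub> \<alpha> n \<in> Arr (CoMod C W)"
proof -
  interpret D: category "CoMod C W" by (rule category_CoMod)
  have "Cod (CoMod C W) (\<alpha> n) = Dom (CoMod C W) (\<beta> n)"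
    using assms(1,2) by (auto simp: Arr_PPC nat_trans_def hom_def)
  then show ?thesis using D.comp_arr(1)[OF assms(3,4)] by simp
qed

lemma category_PPC_colin: "category (PPC_colin C W)"
proof (subst PPC_colin_restrict, rule category_restrict[OF category_para_cat])
  interpret P: category "PPC C W" by (rule category_PPC)
  fix T assume T: "T \<in> pseudo_para_cyclic C W"
  then have "Id (PPC C W) T \<in> Arr (PPC C W)" by (intro P.Id_arr) simp
  moreover have "OMap T n \<in> comodules C W" for n
    using T by (auto simp: pseudo_para_cyclic_def Obj_functor_cat is_functor_def)
  ultimately show "Id para_cat T \<in> Arr (PPC_colin C W)"
    by (simp add: PPC_def) (simp add: Arr_PPC_colin PPC_def colinear_Id)
next
  interpret P: category "PPC C W" by (rule category_PPC)
  fix f g assume f: "f \<in> Arr (PPC_colin C W)" and g: "g \<in> Arr (PPC_colin C W)"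
    and c: "Cod para_cat f = Dom para_cat g"
  obtain S \<alpha> T where f': "f = (S, \<alpha>, T)" by (cases f)
  obtain T' \<beta> U where g': "g = (T', \<beta>, U)" by (cases g)
  have [simp]: "T' = T" using c f' g' by simp
  have *: "(S, \<alpha>, T) \<in> Arr (PPC C W)" "(T, \<beta>, U) \<in> Arr (PPC C W)"
    using f g f' g' by (simp_all add: Arr_PPC_colin)
  have "g \<odot>\<^bsub>PPC C W\<^esub> f \<in> Arr (PPC C W)" using * by (intro P.comp_arr) (auto simp: f' g' PPC_def)
  then have "g \<odot>\<^bsub>para_cat\<^esub> f \<in> Arr (PPC C W)" by (simp add: PPC_def)
  then show "g \<odot>\<^bsub>para_cat\<^esub> f \<in> Arr (PPC_colin C W)"
    using colin_comp_arr[OF *] f g by (simp add: f' g' Arr_PPC_colin)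
qed (use Arr_PPC_colin_subset Arr_PPC_subset in \<open>auto simp: PPC_colin_def PPC_def pseudo_para_cyclic_def\<close>)

lemma category_CycCoMod: "category (CycCoMod C W)"
proof (subst CycCoMod_restrict, rule category_restrict[OF category_para_cat])
  show "Obj (CycCoMod C W) \<subseteq> Obj para_cat"
    using Obj_CycCoMod_subset by (auto simp: pseudo_para_cyclic_def)
  show "Arr (CycCoMod C W) \<subseteq> Arr para_cat"
    using Arr_CycCoMod_subset Arr_PPC_colin_subset Arr_PPC_subset by blast
next
  fix F assume F: "F \<in> Obj (CycCoMod C W)"
  then have "is_functor (op_cat Lambda_N) (CoMod C W) F" by (simp add: Obj_CycCoMod)
  from nat_trans_Id[OF category_op[OF category_Lambda(2)] category_CoMod this]
  show "Id para_cat F \<in> Arr (CycCoMod C W)" using F by (simp add: Arr_CycCoMod)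
next
  fix f g assume f: "f \<in> Arr (CycCoMod C W)" and g: "g \<in> Arr (CycCoMod C W)"
    and c: "Cod para_cat f = Dom para_cat g"
  obtain F \<alpha> G where f': "f = (F, \<alpha>, G)" by (cases f)
  obtain G' \<beta> H where g': "g = (G', \<beta>, H)" by (cases g)
  have [simp]: "G' = G" using c f' g' by simp
  have "nat_trans (op_cat Lambda_N) (CoMod C W) F H (\<lambda>x\<in>Obj (op_cat Lambda_N). \<beta> x \<odot>\<^bsub>CoMod C W\<^esub> \<alpha> x)"
    by (rule nat_trans_comp[OF category_op[OF category_Lambda(2)] category_CoMod, of F G H])
      (use f g in \<open>auto simp: f' g' Arr_CycCoMod Obj_CycCoMod\<close>)
  then show "g \<odot>\<^bsub>para_cat\<^esub> f \<in> Arr (CycCoMod C W)"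
    using f g by (simp add: f' g' Arr_CycCoMod)
next
  fix f assume f: "f \<in> Arr (CycCoMod C W)"
  then show "Dom para_cat f \<in> Obj (CycCoMod C W) \<and> Cod para_cat f \<in> Obj (CycCoMod C W)"
    by (cases f) (auto simp: Arr_CycCoMod)
qed

lemma subcategory_PPC: "subcategory (CycCoMod C W) (PPC C W)"
  by (subst (1) CycCoMod_restrict, subst PPC_restrict, rule subcategory_restrict)
    (use category_CycCoMod category_PPC CycCoMod_restrict PPC_restrict Obj_CycCoMod_subset
      Arr_CycCoMod_subset Arr_PPC_colin_subset in auto)

lemma subcategory_PPC_colin: "subcategory (CycCoMod C W) (PPC_colin C W)"
  by (subst (1) CycCoMod_restrict, subst PPC_colin_restrict, rule subcategory_restrict)
    (use category_CycCoMod category_PPC_colin CycCoMod_restrict PPC_colin_restrict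
      Obj_CycCoMod_subset Arr_CycCoMod_subset in auto)

end

section \<open>Approximation by cyclic comodules\<close>

text \<open>The arrow of \<open>C\<close> in an arrow (source, arrow, target) of \<open>CB\<close>.\<close>

abbreviation underlying :: "'m \<times> 'a \<times> 'm \<Rightarrow> 'a" where
  "underlying t \<equiv> fst (snd t)"

instance gen :: countable
  by countable_datatype

lemma countable_Arr_Lambda_N: "countable (Arr Lambda_N)"
proof -
  have "Arr Lambda_N \<subseteq> range (\<lambda>(m, w, n). arrN m w n)"
  proof
    fix f assume "f \<in> Arr Lambda_N"
    then obtain m w n where "f = arrN m w n" unfolding Arr_Lambda_N by blast
    then show "f \<in> range (\<lambda>(m, w, n). arrN m w n)" by (intro range_eqI[of _ _ "(m, w, n)"]) simp
  qed
  then show ?thesis by (rule countable_subset) simp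
qed

context comonad_on
begin

lemma CB_functorD:
  assumes "is_functor (op_cat Lambda_N) (CB C W) F"
  shows "OMap F n \<in> comodules C W"
    and "f \<in> Arr Lambda_N \<Longrightarrow>
      AMap F f = (OMap F (Cod Lambda_N f), underlying (AMap F f), OMap F (Dom Lambda_N f))"
    and "f \<in> Arr Lambda_N \<Longrightarrow> underlying (AMap F f) \<in> Arr C"
    and "f \<in> Arr Lambda_N \<Longrightarrow> Dom C (underlying (AMap F f)) = fst (OMap F (Cod Lambda_N f))"
    and "f \<in> Arr Lambda_N \<Longrightarrow> Cod C (underlying (AMap F f)) = fst (OMap F (Dom Lambda_N f))"
    and "underlying (AMap F (arrN n [] n)) = Id C (fst (OMap F n))"
    and "f \<in> Arr Lambda_N \<Longrightarrow> g \<in> Arr Lambda_N \<Longrightarrow> Cod Lambda_N f = Dom Lambda_N g \<Longrightarrow>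
      underlying (AMap F (g \<odot>\<^bsub>Lambda_N\<^esub> f)) = underlying (AMap F f) \<odot> underlying (AMap F g)"
proof -
  note F = functor_simps[OF assms]
  show "OMap F n \<in> comodules C W" using F(1)[of n] by simp
  have *: "AMap F f = (OMap F (Cod Lambda_N f), underlying (AMap F f), OMap F (Dom Lambda_N f)) \<and>
      underlying (AMap F f) \<in> Arr C \<and> Dom C (underlying (AMap F f)) = fst (OMap F (Cod Lambda_N f)) \<and>
      Cod C (underlying (AMap F f)) = fst (OMap F (Dom Lambda_N f))" if "f \<in> Arr Lambda_N" for f
  proof -
    obtain M a N where "AMap F f = (M, a, N)" by (cases "AMap F f")
    then show ?thesis using F(2-4)[of f] that by simp
  qed
  show "f \<in> Arr Lambda_N \<Longrightarrow>
      AMap F f = (OMap F (Cod Lambda_N f), underlying (AMap F f), OMap F (Dom Lambda_N f))"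
    "f \<in> Arr Lambda_N \<Longrightarrow> underlying (AMap F f) \<in> Arr C"
    "f \<in> Arr Lambda_N \<Longrightarrow> Dom C (underlying (AMap F f)) = fst (OMap F (Cod Lambda_N f))"
    "f \<in> Arr Lambda_N \<Longrightarrow> Cod C (underlying (AMap F f)) = fst (OMap F (Dom Lambda_N f))"
    using * by blast+
  show "underlying (AMap F (arrN n [] n)) = Id C (fst (OMap F n))" using F(5)[of n] by simp
  show "underlying (AMap F (g \<odot>\<^bsub>Lambda_N\<^esub> f)) = underlying (AMap F f) \<odot> underlying (AMap F g)"
    if "f \<in> Arr Lambda_N" "g \<in> Arr Lambda_N" "Cod Lambda_N f = Dom Lambda_N g"
  proof -
    have "AMap F (g \<odot>\<^bsub>Lambda_N\<^esub> f) = AMap F f \<odot>\<^bsub>CB C W\<^esub> AMap F g"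
      using F(6)[of g f] that by simp
    then show ?thesis by (cases "AMap F f"; cases "AMap F g") simp
  qed
qed

lemma CoMod_functorD:
  assumes "is_functor (op_cat Lambda_N) (CoMod C W) F" "f \<in> Arr Lambda_N"
  shows "colinear (OMap F (Cod Lambda_N f)) (underlying (AMap F f)) (OMap F (Dom Lambda_N f))"
  using functor_simps(2-4)[OF assms(1), of f] assms(2) by (cases "AMap F f") auto

lemma CB_nat_transD:
  assumes "nat_trans (op_cat Lambda_N) (CB C W) F G \<eta>"
  shows "\<eta> n = (OMap F n, underlying (\<eta> n), OMap G n)" and "underlying (\<eta> n) \<in> Arr C"
    and "Dom C (underlying (\<eta> n)) = fst (OMap F n)" and "Cod C (underlying (\<eta> n)) = fst (OMap G n)"
    and "f \<in> Arr Lambda_N \<Longrightarrow>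
      underlying (AMap G f) \<odot> underlying (\<eta> (Cod Lambda_N f)) = underlying (\<eta> (Dom Lambda_N f)) \<odot> underlying (AMap F f)"
proof -
  note n = nat_trans_simps[OF assms]
  have "\<eta> n = (OMap F n, underlying (\<eta> n), OMap G n) \<and> underlying (\<eta> n) \<in> Arr C \<and>
      Dom C (underlying (\<eta> n)) = fst (OMap F n) \<and> Cod C (underlying (\<eta> n)) = fst (OMap G n)"
  proof -
    obtain M a N where "\<eta> n = (M, a, N)" by (cases "\<eta> n")
    then show ?thesis using n(1-3)[of n] by simp
  qed
  then show "\<eta> n = (OMap F n, underlying (\<eta> n), OMap G n)" "underlying (\<eta> n) \<in> Arr C"
    "Dom C (underlying (\<eta> n)) = fst (OMap F n)" "Cod C (underlying (\<eta> n)) = fst (OMap G n)"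
    by blast+
  assume "f \<in> Arr Lambda_N"
  then show "underlying (AMap G f) \<odot> underlying (\<eta> (Cod Lambda_N f)) = underlying (\<eta> (Dom Lambda_N f)) \<odot> underlying (AMap F f)"
    using n(4)[of f]
    by (cases "AMap F f"; cases "AMap G f"; cases "\<eta> (Cod Lambda_N f)"; cases "\<eta> (Dom Lambda_N f)") auto
qed

lemma CB_nat_transI:
  assumes F: "is_functor (op_cat Lambda_N) (CB C W) F" and G: "is_functor (op_cat Lambda_N) (CB C W) G"
    and h: "\<And>n. h n \<in> Arr C" "\<And>n. Dom C (h n) = fst (OMap F n)" "\<And>n. Cod C (h n) = fst (OMap G n)"
    and nat: "\<And>f. f \<in> Arr Lambda_N \<Longrightarrow>
      underlying (AMap G f) \<odot> h (Cod Lambda_N f) = h (Dom Lambda_N f) \<odot> underlying (AMap F f)"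
  shows "nat_trans (op_cat Lambda_N) (CB C W) F G (\<lambda>n. (OMap F n, h n, OMap G n))"
proof -
  have "AMap G f \<odot>\<^bsub>CB C W\<^esub> (OMap F (Cod Lambda_N f), h (Cod Lambda_N f), OMap G (Cod Lambda_N f)) =
      (OMap F (Dom Lambda_N f), h (Dom Lambda_N f), OMap G (Dom Lambda_N f)) \<odot>\<^bsub>CB C W\<^esub> AMap F f"
    if f: "f \<in> Arr Lambda_N" for f
    by (subst CB_functorD(2)[OF F f], subst CB_functorD(2)[OF G f]) (simp add: nat[OF f])
  then show ?thesis
    using h CB_functorD(1)[OF F] CB_functorD(1)[OF G] by (simp add: nat_trans_def hom_def)
qed

end

locale para_comodule = lex_comonad C W S
  for C :: "('o, 'a) category" (structure) and W and S :: "'s itself" +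
  fixes T :: "('o, 'a) para_obj"
  assumes T: "T \<in> pseudo_para_cyclic C W"
begin

abbreviation X :: "nat \<Rightarrow> 'o" where "X n \<equiv> fst (OMap T n)"
abbreviation \<rho> :: "nat \<Rightarrow> 'a" where "\<rho> n \<equiv> snd (OMap T n)"
abbreviation Tarr :: "nat \<times> gen list set \<times> nat \<Rightarrow> 'a" where "Tarr f \<equiv> underlying (AMap T f)"

lemma T_functor: "is_functor (op_cat Lambda_N) (CB C W) T"
  using T by (simp add: pseudo_para_cyclic_def Obj_functor_cat)

lemmas T_simps [simp] = CB_functorD(3-6)[OF T_functor]
lemmas T_comp = CB_functorD(7)[OF T_functor]
lemmas T_comodule = comoduleD[OF CB_functorD(1)[OF T_functor]]
lemmas T_comodule_simps [simp] = T_comodule(1-4)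

text \<open>The functor is contravariant, so centrality of \<open>\<tau>\<^sub>n\<^sup>n\<^sup>+\<^sup>1\<close> becomes naturality of its action.\<close>

lemma Tarr_central:
  assumes "f \<in> Arr Lambda_N"
  shows "Tarr (tau_top (Dom Lambda_N f)) \<odot> Tarr f = Tarr f \<odot> Tarr (tau_top (Cod Lambda_N f))"
  using tau_top_central[OF assms] T_comp[of f "tau_top (Cod Lambda_N f)"]
    T_comp[of "tau_top (Dom Lambda_N f)" f] assms by simp

text \<open>The condition is imposed on the colinear map \<open>D \<rightarrow> B T\<close> that corresponds to the transformation \<open>v\<close>.\<close>

definition equalizes :: "(nat \<Rightarrow> ('a \<times> 'a) set) \<Rightarrow> ('o, 'a) para_obj \<Rightarrow> (nat \<Rightarrow> ('o \<times> 'a) \<times> 'a \<times> ('o \<times> 'a)) \<Rightarrow> bool"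
  where "equalizes P D v \<longleftrightarrow>
    (\<forall>n. \<forall>(a, b)\<in>P n. a \<odot> lift (OMap D n) (underlying (v n)) = b \<odot> lift (OMap D n) (underlying (v n)))"

text \<open>In degree \<open>n\<close> let \<open>e\<^sub>n : A\<^sub>n \<rightarrow> B(T\<^sub>n)\<close> be the equalizer comodule of \<open>P n\<close>.  Stability of the
  equations lets \<open>B(T(f))\<close> restrict to the \<open>A\<^sub>n\<close>; as the \<open>e\<^sub>n\<close> are monic, this gives a functor \<open>A\<close> to
  comodules, and the equation for \<open>\<tau>\<^sub>n\<^sup>n\<^sup>+\<^sup>1\<close> makes it cyclic.  The transformation \<open>u = \<epsilon> e\<close> corresponds to
  the inclusion \<open>e\<close>.  A transformation \<open>v\<close> that satisfies the equations corresponds to a colinear map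
  \<open>x\<close> into \<open>B T\<close> that factors through \<open>e\<close>; the factorisation is natural because \<open>x\<close> is, which uses that
  the operators of \<open>D\<close> are colinear.  It is unique because a colinear \<open>w\<close> with \<open>\<epsilon> e w = v\<close> has \<open>e w = x\<close>.\<close>

lemma cyclic_comodule_cover:
  fixes P :: "nat \<Rightarrow> ('a \<times> 'a) set"
  assumes countable: "\<And>n. countable (P n)"
    and parallel: "\<And>n a b. (a, b) \<in> P n \<Longrightarrow>
      a \<in> Arr C \<and> b \<in> Arr C \<and> Dom C a = BO (X n) \<and> Dom C b = BO (X n) \<and> Cod C b = Cod C a"
    and tau: "\<And>n. (Tarr (tau_top n) \<odot> counit W (X n), counit W (X n)) \<in> P n"
    and stable: "\<And>f y a b. f \<in> Arr Lambda_N \<Longrightarrow> y \<in> Arr C \<Longrightarrow> Cod C y = BO (X (Cod Lambda_N f)) \<Longrightarrow>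
      (\<forall>(c, d)\<in>P (Cod Lambda_N f). c \<odot> y = d \<odot> y) \<Longrightarrow> (a, b) \<in> P (Dom Lambda_N f) \<Longrightarrow>
      a \<odot> (BA (Tarr f) \<odot> y) = b \<odot> (BA (Tarr f) \<odot> y)"
  obtains A u where "A \<in> Obj (CycCoMod C W)" and "(A, u, T) \<in> Arr (PPC C W)" and "equalizes P A u"
    and "\<And>D v. D \<in> Obj (CycCoMod C W) \<Longrightarrow> (D, v, T) \<in> Arr (PPC C W) \<Longrightarrow> equalizes P D v \<Longrightarrow>
      \<exists>!w. (D, w, A) \<in> Arr (CycCoMod C W) \<and> (\<forall>n. v n = u n \<odot>\<^bsub>CB C W\<^esub> w n)"
proof -
  interpret N: category Lambda_N by (rule category_Lambda)
  have "\<exists>M e. equalizer_comodule (X n) (P n) M e" for n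
    by (rule equalizer_comodule_exists[OF _ countable parallel]) simp_all
  then obtain M e where Me: "\<And>n. equalizer_comodule (X n) (P n) (M n) (e n)" by metis
  have e_colin: "\<And>n. colinear (M n) (e n) (cofree (X n))"
    and e_eq: "\<And>n. \<forall>(a, b)\<in>P n. a \<odot> e n = b \<odot> e n"
    and e_mono: "\<And>n y z. y \<in> Arr C \<Longrightarrow> z \<in> Arr C \<Longrightarrow> Dom C y = Dom C z \<Longrightarrow> Cod C y = fst (M n) \<Longrightarrow>
      Cod C z = fst (M n) \<Longrightarrow> e n \<odot> y = e n \<odot> z \<Longrightarrow> y = z"
    and e_factor: "\<And>n N x. colinear N x (cofree (X n)) \<Longrightarrow> (\<forall>(a, b)\<in>P n. a \<odot> x = b \<odot> x) \<Longrightarrow>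
      \<exists>y. colinear N y (M n) \<and> e n \<odot> y = x"
    using Me unfolding equalizer_comodule_def by blast+
  have M: "M n \<in> comodules C W" and e [simp]: "e n \<in> Arr C" "Dom C (e n) = fst (M n)"
    "Cod C (e n) = BO (X n)" for n
    using e_colin[of n] by (auto simp: colinear_def)
  note [simp] = comoduleD(1-4)[OF M] M
  have ex_g: "\<exists>y. colinear (M (Cod Lambda_N f)) y (M (Dom Lambda_N f)) \<and>
      e (Dom Lambda_N f) \<odot> y = BA (Tarr f) \<odot> e (Cod Lambda_N f)" if f: "f \<in> Arr Lambda_N" for f
  proof (rule e_factor)
    have "colinear (cofree (X (Cod Lambda_N f))) (BA (Tarr f)) (cofree (X (Dom Lambda_N f)))"
      using colinear_cofree[of "Tarr f"] f by simp
    then show "colinear (M (Cod Lambda_N f)) (BA (Tarr f) \<odot> e (Cod Lambda_N f)) (cofree (X (Dom Lambda_N f)))"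
      using e_colin colinear_comp by blast
    show "\<forall>(a, b)\<in>P (Dom Lambda_N f). a \<odot> (BA (Tarr f) \<odot> e (Cod Lambda_N f)) = b \<odot> (BA (Tarr f) \<odot> e (Cod Lambda_N f))"
      using stable[OF f, of "e (Cod Lambda_N f)"] e_eq by auto
  qed
  have "\<exists>g. \<forall>f\<in>Arr Lambda_N. colinear (M (Cod Lambda_N f)) (g f) (M (Dom Lambda_N f)) \<and>
      e (Dom Lambda_N f) \<odot> g f = BA (Tarr f) \<odot> e (Cod Lambda_N f)"
    by (rule bchoice, rule ballI, rule ex_g)
  then obtain g where g_colin: "\<And>f. f \<in> Arr Lambda_N \<Longrightarrow> colinear (M (Cod Lambda_N f)) (g f) (M (Dom Lambda_N f))"
    and g_eq: "\<And>f. f \<in> Arr Lambda_N \<Longrightarrow> e (Dom Lambda_N f) \<odot> g f = BA (Tarr f) \<odot> e (Cod Lambda_N f)"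
    by blast
  have g [simp]: "g f \<in> Arr C" "Dom C (g f) = fst (M (Cod Lambda_N f))" "Cod C (g f) = fst (M (Dom Lambda_N f))"
    if "f \<in> Arr Lambda_N" for f
    using g_colin[OF that] by (auto simp: colinear_def)
  have g_Id: "g (arrN n [] n) = Id C (fst (M n))" for n
    by (rule e_mono[of _ _ n]) (use g_eq[of "arrN n [] n"] in auto)
  have g_comp: "g (k \<odot>\<^bsub>Lambda_N\<^esub> f) = g f \<odot> g k"
    if f: "f \<in> Arr Lambda_N" and k: "k \<in> Arr Lambda_N" and c: "Cod Lambda_N f = Dom Lambda_N k" for f k
  proof (rule e_mono[of _ _ "Dom Lambda_N f"])
    have "e (Dom Lambda_N f) \<odot> (g f \<odot> g k) = (e (Dom Lambda_N f) \<odot> g f) \<odot> g k"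
      using f k c by (simp add: assoc)
    also have "\<dots> = BA (Tarr f) \<odot> (e (Dom Lambda_N k) \<odot> g k)" using f k c by (simp add: g_eq assoc)
    also have "\<dots> = (BA (Tarr f) \<odot> BA (Tarr k)) \<odot> e (Cod Lambda_N k)" using f k c by (simp add: g_eq assoc)
    also have "\<dots> = BA (Tarr (k \<odot>\<^bsub>Lambda_N\<^esub> f)) \<odot> e (Cod Lambda_N k)" using f k c by (simp add: T_comp)
    also have "\<dots> = e (Dom Lambda_N f) \<odot> g (k \<odot>\<^bsub>Lambda_N\<^esub> f)"
      using g_eq[of "k \<odot>\<^bsub>Lambda_N\<^esub> f"] f k c by simp
    finally show "e (Dom Lambda_N f) \<odot> g (k \<odot>\<^bsub>Lambda_N\<^esub> f) = e (Dom Lambda_N f) \<odot> (g f \<odot> g k)" by simp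
  qed (use f k c in simp_all)
  have g_tau: "g (tau_top n) = Id C (fst (M n))" for n
  proof (rule e_mono[of _ _ n])
    have "BA (Tarr (tau_top n)) \<odot> e n = e n"
    proof (rule colinear_into_cofree_eqI[OF _ e_colin])
      have "colinear (cofree (X n)) (BA (Tarr (tau_top n))) (cofree (X n))"
        using colinear_cofree[of "Tarr (tau_top n)"] by simp
      then show "colinear (M n) (BA (Tarr (tau_top n)) \<odot> e n) (cofree (X n))"
        using e_colin colinear_comp by blast
      have "counit W (X n) \<odot> (BA (Tarr (tau_top n)) \<odot> e n) = (counit W (X n) \<odot> BA (Tarr (tau_top n))) \<odot> e n"
        by (simp add: assoc)
      also have "\<dots> = (Tarr (tau_top n) \<odot> counit W (X n)) \<odot> e n"
        using counit_nat[of "Tarr (tau_top n)"] by simp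
      also have "\<dots> = counit W (X n) \<odot> e n" using e_eq[of n] tau[of n] by blast
      finally show "counit W (X n) \<odot> (BA (Tarr (tau_top n)) \<odot> e n) = counit W (X n) \<odot> e n" .
    qed simp
    then show "e n \<odot> g (tau_top n) = e n \<odot> Id C (fst (M n))" using g_eq[of "tau_top n"] by simp
  qed (use g[of "tau_top n"] in simp_all)
  define A where "A = \<lparr>OMap = M, AMap = (\<lambda>f\<in>Arr Lambda_N. (M (Cod Lambda_N f), g f, M (Dom Lambda_N f)))\<rparr>"
  have A_simps [simp]: "OMap A n = M n" "f \<in> Arr Lambda_N \<Longrightarrow>
      AMap A f = (M (Cod Lambda_N f), g f, M (Dom Lambda_N f))" for n f
    by (auto simp: A_def)
  have A_functor: "is_functor (op_cat Lambda_N) (CoMod C W) A"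
    by (auto simp: is_functor_def hom_def g_colin g_Id g_comp simp del: split_paired_All)
  have A: "A \<in> Obj (CycCoMod C W)"
    using A_functor g_tau by (simp add: Obj_CycCoMod) (simp add: A_def)
  note A_CB = functor_CoMod_CB[OF A_functor]
  \<comment> \<open>the components of the universal transformation from \<open>A\<close> to \<open>T\<close>\<close>
  define h where "h n = counit W (X n) \<odot> e n" for n
  have h [simp]: "h n \<in> Arr C" "Dom C (h n) = fst (M n)" "Cod C (h n) = X n" for n
    by (auto simp: h_def)
  have lift_h: "lift (M n) (h n) = e n" for n
    unfolding h_def by (rule lift_counit[OF e_colin]) simp
  define u where "u n = (OMap A n, h n, OMap T n)" for n
  have "nat_trans (op_cat Lambda_N) (CB C W) A T (\<lambda>n. (OMap A n, h n, OMap T n))"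
  proof (rule CB_nat_transI[OF A_CB T_functor])
    fix f assume f: "f \<in> Arr Lambda_N"
    have "Tarr f \<odot> h (Cod Lambda_N f) = (Tarr f \<odot> counit W (X (Cod Lambda_N f))) \<odot> e (Cod Lambda_N f)"
      using f by (simp add: h_def assoc)
    also have "\<dots> = counit W (X (Dom Lambda_N f)) \<odot> (BA (Tarr f) \<odot> e (Cod Lambda_N f))"
      using f counit_nat[of "Tarr f"] by (simp add: assoc)
    also have "\<dots> = h (Dom Lambda_N f) \<odot> g f" using f by (simp add: h_def assoc g_eq[symmetric])
    finally show "Tarr f \<odot> h (Cod Lambda_N f) = h (Dom Lambda_N f) \<odot> underlying (AMap A f)" using f by simp
  qed simp_all
  then have u: "(A, u, T) \<in> Arr (PPC C W)"
    using A Obj_CycCoMod_subset T unfolding u_def by (auto simp: Arr_PPC)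
  have u_eq: "equalizes P A u" using e_eq by (simp add: equalizes_def u_def lift_h)
  have "\<exists>!w. (D, w, A) \<in> Arr (CycCoMod C W) \<and> (\<forall>n. v n = u n \<odot>\<^bsub>CB C W\<^esub> w n)"
    if D: "D \<in> Obj (CycCoMod C W)" and v: "(D, v, T) \<in> Arr (PPC C W)"
      and v_eq: "equalizes P D v" for D v
  proof -
    have DF: "is_functor (op_cat Lambda_N) (CoMod C W) D" using D by (simp add: Obj_CycCoMod)
    note D_CB = functor_CoMod_CB[OF DF]
    have v_nat: "nat_trans (op_cat Lambda_N) (CB C W) D T v" using v by (simp add: Arr_PPC)
    note vD = CB_nat_transD[OF v_nat]
    note [simp] = comoduleD(1-4)[OF CB_functorD(1)[OF D_CB]] CB_functorD(1,3-5)[OF D_CB] vD(2-4)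
    define x where "x n = lift (OMap D n) (underlying (v n))" for n
    have x_colin: "colinear (OMap D n) (x n) (cofree (X n))"
      and counit_x: "counit W (X n) \<odot> x n = underlying (v n)" for n
      using colinear_lift[of "OMap D n" "underlying (v n)"] counit_lift[of "OMap D n" "underlying (v n)"]
      by (simp_all add: x_def)
    have x [simp]: "x n \<in> Arr C" "Dom C (x n) = fst (OMap D n)" "Cod C (x n) = BO (X n)" for n
      using x_colin[of n] by (auto simp: colinear_def)
    have "\<exists>y. colinear (OMap D n) y (M n) \<and> e n \<odot> y = x n" for n
      using e_factor[OF x_colin] v_eq by (simp add: x_def equalizes_def)
    then have "\<exists>y. \<forall>n. colinear (OMap D n) (y n) (M n) \<and> e n \<odot> y n = x n" by (intro choice allI)
    then obtain y where y_colin: "\<And>n. colinear (OMap D n) (y n) (M n)" and ey: "\<And>n. e n \<odot> y n = x n"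
      by blast
    have y [simp]: "y n \<in> Arr C" "Dom C (y n) = fst (OMap D n)" "Cod C (y n) = fst (M n)" for n
      using y_colin[of n] by (auto simp: colinear_def)
    define w where "w n = (OMap D n, y n, OMap A n)" for n
    have "nat_trans (op_cat Lambda_N) (CB C W) D A (\<lambda>n. (OMap D n, y n, OMap A n))"
    proof (rule CB_nat_transI[OF D_CB A_CB])
      fix f assume f: "f \<in> Arr Lambda_N"
      let ?m = "Cod Lambda_N f" and ?k = "Dom Lambda_N f"
      let ?d = "underlying (AMap D f)"
      have d: "BA ?d \<odot> snd (OMap D ?m) = snd (OMap D ?k) \<odot> ?d"
        using CoMod_functorD[OF DF f] by (simp add: colinear_def)
      have "g f \<odot> y ?m = y ?k \<odot> ?d"
      proof (rule e_mono[of _ _ ?k])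
        have "e ?k \<odot> (g f \<odot> y ?m) = (e ?k \<odot> g f) \<odot> y ?m" using f by (simp add: assoc)
        also have "\<dots> = BA (Tarr f) \<odot> (e ?m \<odot> y ?m)" using f by (simp add: g_eq assoc)
        also have "\<dots> = BA (Tarr f \<odot> underlying (v ?m)) \<odot> snd (OMap D ?m)"
          using f by (simp add: ey x_def lift_def assoc)
        also have "\<dots> = BA (underlying (v ?k)) \<odot> (BA ?d \<odot> snd (OMap D ?m))"
          using f by (simp add: vD(5)[OF f] assoc)
        also have "\<dots> = x ?k \<odot> ?d" using f by (simp add: d x_def lift_def assoc)
        also have "\<dots> = e ?k \<odot> (y ?k \<odot> ?d)" using f by (simp add: ey[symmetric] assoc)
        finally show "e ?k \<odot> (g f \<odot> y ?m) = e ?k \<odot> (y ?k \<odot> ?d)" .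
      qed (use f in simp_all)
      then show "underlying (AMap A f) \<odot> y ?m = y ?k \<odot> ?d" using f by simp
    qed simp_all
    then have w: "(D, w, A) \<in> Arr (CycCoMod C W)"
      using A D y_colin unfolding w_def by (simp add: Arr_CycCoMod nat_trans_CoMod_iff)
    have vw: "v n = u n \<odot>\<^bsub>CB C W\<^esub> w n" for n
    proof -
      have "h n \<odot> y n = underlying (v n)" by (simp add: h_def assoc ey counit_x)
      then show ?thesis using vD(1)[of n] by (simp add: u_def w_def)
    qed
    have "w' = w" if w': "(D, w', A) \<in> Arr (CycCoMod C W)" and vw': "\<And>n. v n = u n \<odot>\<^bsub>CB C W\<^esub> w' n" for w'
    proof
      fix n
      have nat': "nat_trans (op_cat Lambda_N) (CoMod C W) D A w'" using w' by (simp add: Arr_CycCoMod)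
      then have "w' n \<in> Arr (CoMod C W)" by (simp add: nat_trans_CoMod_iff)
      moreover have "nat_trans (op_cat Lambda_N) (CB C W) D A w'" using nat' by (simp add: nat_trans_CoMod_iff)
      note w'D = CB_nat_transD[OF this]
      ultimately have colin: "colinear (OMap D n) (underlying (w' n)) (M n)"
        by (subst (asm) w'D(1)) simp
      have "underlying (v n) = h n \<odot> underlying (w' n)"
        unfolding vw' by (subst w'D(1)) (simp add: u_def)
      then have "counit W (X n) \<odot> (e n \<odot> underlying (w' n)) = counit W (X n) \<odot> x n"
        using w'D(2-4)[of n] by (simp add: h_def assoc counit_x)
      then have "e n \<odot> underlying (w' n) = x n"
        by (intro colinear_into_cofree_eqI[OF colinear_comp[OF colin e_colin] x_colin]) simp_all
      then have "underlying (w' n) = y n"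
        using w'D(2-4)[of n] by (intro e_mono[of "underlying (w' n)" "y n" n]) (simp_all add: ey)
      then show "w' n = w n" by (subst w'D(1)) (simp add: w_def)
    qed
    then show ?thesis using w vw by blast
  qed
  with A u u_eq show thesis by (rule that)
qed

lemma approximation_if_factors:
  assumes E: "E = para_cat\<lparr>Obj := pseudo_para_cyclic C W, Arr := Ar\<rparr>"
    and sub: "subcategory (CycCoMod C W) E" and A: "A \<in> Obj (CycCoMod C W)" and u: "(A, u, T) \<in> Ar"
    and factors: "\<And>D v. D \<in> Obj (CycCoMod C W) \<Longrightarrow> (D, v, T) \<in> Ar \<Longrightarrow>
      \<exists>!w. (D, w, A) \<in> Arr (CycCoMod C W) \<and> (\<forall>n. v n = u n \<odot>\<^bsub>CB C W\<^esub> w n)"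
  shows "is_approximation E (CycCoMod C W) T A (A, u, T)"
proof -
  have hom_Cyc: "(D, w, A') \<in> hom (CycCoMod C W) Y Z \<longleftrightarrow>
      (D, w, A') \<in> Arr (CycCoMod C W) \<and> D = Y \<and> A' = Z" for D w A' Y Z
    by (simp add: hom_def CycCoMod_def)
  have hom_E: "(D, v, U) \<in> hom E Y Z \<longleftrightarrow> (D, v, U) \<in> Ar \<and> D = Y \<and> U = Z" for D v U Y Z
    by (simp add: hom_def E)
  have comp: "(A, u, T) \<odot>\<^bsub>E\<^esub> (D, w, A) = (D, \<lambda>n. u n \<odot>\<^bsub>CB C W\<^esub> w n, T)" for D w
    by (simp add: E restrict_def)
  have "\<exists>!v'. v' \<in> hom (CycCoMod C W) Y A \<and> v = (A, u, T) \<odot>\<^bsub>E\<^esub> v'"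
    if Y: "Y \<in> Obj (CycCoMod C W)" and v: "v \<in> hom E Y T" for Y v
  proof -
    obtain v0 where v0: "v = (Y, v0, T)" "(Y, v0, T) \<in> Ar"
      using v by (cases v) (auto simp: hom_E)
    obtain w where w: "(Y, w, A) \<in> Arr (CycCoMod C W)" "\<And>n. v0 n = u n \<odot>\<^bsub>CB C W\<^esub> w n"
      and unique: "\<And>w'. (Y, w', A) \<in> Arr (CycCoMod C W) \<Longrightarrow>
        (\<And>n. v0 n = u n \<odot>\<^bsub>CB C W\<^esub> w' n) \<Longrightarrow> w' = w"
      using factors[OF Y v0(2)] by blast
    show ?thesis
    proof (rule ex1I[of _ "(Y, w, A)"])
      show "(Y, w, A) \<in> hom (CycCoMod C W) Y A \<and> v = (A, u, T) \<odot>\<^bsub>E\<^esub> (Y, w, A)"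
        using w by (simp add: hom_Cyc comp v0(1) ext)
    next
      fix v' assume v': "v' \<in> hom (CycCoMod C W) Y A \<and> v = (A, u, T) \<odot>\<^bsub>E\<^esub> v'"
      obtain w' where w': "v' = (Y, w', A)" "(Y, w', A) \<in> Arr (CycCoMod C W)"
        using v' by (cases v') (auto simp: hom_Cyc)
      have "v0 = (\<lambda>n. u n \<odot>\<^bsub>CB C W\<^esub> w' n)" using v' by (simp add: w'(1) v0(1) comp)
      then show "v' = (Y, w, A)" using unique[OF w'(2)] w'(1) by simp
    qed
  qed
  then show ?thesis using sub A u T hom_E[of A u T A T]
    by (simp add: is_approximation_def) (simp add: E)
qed

text \<open>A cyclic comodule has trivial \<open>\<tau>\<^sub>n\<^sup>n\<^sup>+\<^sup>1\<close>, so by naturality of \<open>v\<close> its image in \<open>T\<close> is fixed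
  by the action of \<open>\<tau>\<^sub>n\<^sup>n\<^sup>+\<^sup>1\<close>.\<close>

lemma tau_equalizes:
  assumes D: "D \<in> Obj (CycCoMod C W)" and v: "(D, v, T) \<in> Arr (PPC C W)"
  shows "(Tarr (tau_top n) \<odot> counit W (X n)) \<odot> lift (OMap D n) (underlying (v n)) =
    counit W (X n) \<odot> lift (OMap D n) (underlying (v n))"
proof -
  have D_CB: "is_functor (op_cat Lambda_N) (CB C W) D"
    using D by (simp add: Obj_CycCoMod functor_CoMod_CB)
  have D_tau: "underlying (AMap D (tau_top n)) = Id C (fst (OMap D n))"
    using D by (simp add: Obj_CycCoMod)
  have "nat_trans (op_cat Lambda_N) (CB C W) D T v" using v by (simp add: Arr_PPC)
  note vD = CB_nat_transD[OF this]
  note [simp] = CB_functorD(1)[OF D_CB] comoduleD(1-4)[OF CB_functorD(1)[OF D_CB]] vD(2-4)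
  have lift_arr: "lift (OMap D n) (underlying (v n)) \<in> Arr C" "Dom C (lift (OMap D n) (underlying (v n))) = fst (OMap D n)"
    "Cod C (lift (OMap D n) (underlying (v n))) = BO (X n)"
    by (simp_all add: lift_def)
  have c: "counit W (X n) \<odot> lift (OMap D n) (underlying (v n)) = underlying (v n)"
    using counit_lift[of "OMap D n" "underlying (v n)"] by simp
  have "(Tarr (tau_top n) \<odot> counit W (X n)) \<odot> lift (OMap D n) (underlying (v n)) = Tarr (tau_top n) \<odot> underlying (v n)"
    using lift_arr by (simp add: assoc c)
  also have "\<dots> = underlying (v n)" using vD(5)[of "tau_top n"] by (simp add: D_tau)
  finally show ?thesis by (simp add: c)
qed

lemma tau_condition_stable:
  assumes f: "f \<in> Arr Lambda_N" and y: "y \<in> Arr C" "Cod C y = BO (X (Cod Lambda_N f))"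
    and eq: "(Tarr (tau_top (Cod Lambda_N f)) \<odot> counit W (X (Cod Lambda_N f))) \<odot> y =
      counit W (X (Cod Lambda_N f)) \<odot> y"
  shows "(Tarr (tau_top (Dom Lambda_N f)) \<odot> counit W (X (Dom Lambda_N f))) \<odot> (BA (Tarr f) \<odot> y) =
    counit W (X (Dom Lambda_N f)) \<odot> (BA (Tarr f) \<odot> y)"
proof -
  let ?m = "Cod Lambda_N f" and ?k = "Dom Lambda_N f"
  have c: "counit W (X ?k) \<odot> (BA (Tarr f) \<odot> y) = Tarr f \<odot> (counit W (X ?m) \<odot> y)"
    using counit_nat[of "Tarr f"] f y by (simp add: assoc[symmetric])
  have "(Tarr (tau_top ?k) \<odot> counit W (X ?k)) \<odot> (BA (Tarr f) \<odot> y) =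
      (Tarr (tau_top ?k) \<odot> Tarr f) \<odot> (counit W (X ?m) \<odot> y)"
    using f y by (simp add: assoc c)
  also have "\<dots> = Tarr f \<odot> ((Tarr (tau_top ?m) \<odot> counit W (X ?m)) \<odot> y)"
    using f y by (simp add: Tarr_central assoc)
  finally show ?thesis by (simp add: eq c)
qed

lemma approximation_PPC: "\<exists>A u. is_approximation (PPC C W) (CycCoMod C W) T A u"
proof (rule cyclic_comodule_cover[of "\<lambda>n. {(Tarr (tau_top n) \<odot> counit W (X n), counit W (X n))}"])
  fix A u
  assume A: "A \<in> Obj (CycCoMod C W)" and u: "(A, u, T) \<in> Arr (PPC C W)"
    and factors: "\<And>D v. D \<in> Obj (CycCoMod C W) \<Longrightarrow> (D, v, T) \<in> Arr (PPC C W) \<Longrightarrow>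
      equalizes (\<lambda>n. {(Tarr (tau_top n) \<odot> counit W (X n), counit W (X n))}) D v \<Longrightarrow>
      \<exists>!w. (D, w, A) \<in> Arr (CycCoMod C W) \<and> (\<forall>n. v n = u n \<odot>\<^bsub>CB C W\<^esub> w n)"
  have "is_approximation (PPC C W) (CycCoMod C W) T A (A, u, T)"
    by (rule approximation_if_factors[OF PPC_restrict subcategory_PPC A u])
      (rule factors, use tau_equalizes in \<open>auto simp: equalizes_def\<close>)
  then show ?thesis by blast
qed (use tau_condition_stable in auto)

text \<open>The equations \<open>\<rho>\<^sub>k T(f) \<epsilon> x = B(T(f)) x\<close> in degree \<open>n\<close>, for all \<open>f : [k] \<rightarrow> [n]\<close>.  They say that the
  image of \<open>x\<close> in degree \<open>k\<close> satisfies the equation for the identity of \<open>[k]\<close>, that is \<open>\<rho> \<epsilon> x' = x'\<close>.\<close>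

definition colinearity_pairs :: "nat \<Rightarrow> ('a \<times> 'a) set" where
  "colinearity_pairs n = (\<lambda>f. (\<rho> (Dom Lambda_N f) \<odot> (Tarr f \<odot> counit W (X n)), BA (Tarr f))) `
    {f \<in> Arr Lambda_N. Cod Lambda_N f = n}"

text \<open>With \<open>x = B(v) \<rho>\<^sub>D\<close> both sides are equal to \<open>\<rho>\<^sub>k v\<^sub>k D(f)\<close>: the left one by naturality of \<open>v\<close>, the
  right one by naturality of \<open>v\<close> and because \<open>v\<^sub>k\<close> and \<open>D(f)\<close> are colinear.\<close>

lemma colinearity_pairs_equalize:
  assumes D: "D \<in> Obj (CycCoMod C W)" and v: "(D, v, T) \<in> Arr (PPC_colin C W)"
    and ab: "(a, b) \<in> colinearity_pairs n"
  shows "a \<odot> lift (OMap D n) (underlying (v n)) = b \<odot> lift (OMap D n) (underlying (v n))"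
proof -
  obtain f where f: "f \<in> Arr Lambda_N" "Cod Lambda_N f = n"
    and a: "a = \<rho> (Dom Lambda_N f) \<odot> (Tarr f \<odot> counit W (X n))" and b: "b = BA (Tarr f)"
    using ab by (auto simp: colinearity_pairs_def)
  let ?k = "Dom Lambda_N f" and ?d = "underlying (AMap D f)" and ?x = "lift (OMap D n) (underlying (v n))"
  have DF: "is_functor (op_cat Lambda_N) (CoMod C W) D" using D by (simp add: Obj_CycCoMod)
  note D_CB = functor_CoMod_CB[OF DF]
  have v': "nat_trans (op_cat Lambda_N) (CB C W) D T v" "v ?k \<in> Arr (CoMod C W)"
    using v by (simp_all add: Arr_PPC_colin Arr_PPC)
  note vD = CB_nat_transD[OF v'(1)]
  have v_lin: "BA (underlying (v ?k)) \<odot> snd (OMap D ?k) = \<rho> ?k \<odot> underlying (v ?k)"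
    using v'(2) by (subst (asm) vD(1)) (simp add: colinear_def)
  have d: "BA ?d \<odot> snd (OMap D n) = snd (OMap D ?k) \<odot> ?d"
    using CoMod_functorD[OF DF f(1)] f(2) by (simp add: colinear_def)
  note [simp] = CB_functorD(1,3-5)[OF D_CB] comoduleD(1-4)[OF CB_functorD(1)[OF D_CB]] vD(2-4) f
  have lift_arr: "?x \<in> Arr C" "Dom C ?x = fst (OMap D n)" "Cod C ?x = BO (X n)"
    by (simp_all add: lift_def)
  have c: "counit W (X n) \<odot> ?x = underlying (v n)"
    using counit_lift[of "OMap D n" "underlying (v n)"] by simp
  have nat: "Tarr f \<odot> underlying (v n) = underlying (v ?k) \<odot> ?d" using vD(5)[OF f(1)] by simp
  have "a \<odot> ?x = \<rho> ?k \<odot> (Tarr f \<odot> underlying (v n))" using lift_arr by (simp add: a assoc c)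
  also have "\<dots> = (\<rho> ?k \<odot> underlying (v ?k)) \<odot> ?d" by (simp add: nat assoc)
  also have "\<dots> = BA (underlying (v ?k)) \<odot> (BA ?d \<odot> snd (OMap D n))"
    by (simp add: v_lin[symmetric] d assoc)
  also have "\<dots> = BA (underlying (v ?k) \<odot> ?d) \<odot> snd (OMap D n)" by (simp add: assoc)
  also have "\<dots> = b \<odot> ?x" by (simp add: nat[symmetric] b lift_def assoc)
  finally show ?thesis .
qed

text \<open>The equation for \<open>h\<close> at \<open>B(T(f)) y\<close> is the equation for the composite \<open>f h\<close> at \<open>y\<close>.\<close>

lemma colinearity_pairs_stable:
  assumes f: "f \<in> Arr Lambda_N" and y: "y \<in> Arr C" "Cod C y = BO (X (Cod Lambda_N f))"
    and eq: "\<forall>(a, b)\<in>colinearity_pairs (Cod Lambda_N f). a \<odot> y = b \<odot> y"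
    and ab: "(a, b) \<in> colinearity_pairs (Dom Lambda_N f)"
  shows "a \<odot> (BA (Tarr f) \<odot> y) = b \<odot> (BA (Tarr f) \<odot> y)"
proof -
  interpret N: category Lambda_N by (rule category_Lambda)
  let ?m = "Cod Lambda_N f" and ?k = "Dom Lambda_N f"
  obtain h where h: "h \<in> Arr Lambda_N" "Cod Lambda_N h = ?k"
    and a: "a = \<rho> (Dom Lambda_N h) \<odot> (Tarr h \<odot> counit W (X ?k))" and b: "b = BA (Tarr h)"
    using ab by (auto simp: colinearity_pairs_def)
  let ?fh = "f \<odot>\<^bsub>Lambda_N\<^esub> h"
  have fh: "Tarr ?fh = Tarr h \<odot> Tarr f" using T_comp[OF h(1) f h(2)] .
  have "(\<rho> (Dom Lambda_N h) \<odot> (Tarr ?fh \<odot> counit W (X ?m)), BA (Tarr ?fh)) \<in> colinearity_pairs ?m"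
    unfolding colinearity_pairs_def using f h by (intro image_eqI[of _ _ ?fh]) simp_all
  with eq have eq': "(\<rho> (Dom Lambda_N h) \<odot> (Tarr ?fh \<odot> counit W (X ?m))) \<odot> y = BA (Tarr ?fh) \<odot> y"
    by blast
  have "counit W (X ?k) \<odot> (BA (Tarr f) \<odot> y) = Tarr f \<odot> (counit W (X ?m) \<odot> y)"
    using counit_nat[of "Tarr f"] f y by (simp add: assoc[symmetric])
  then have "a \<odot> (BA (Tarr f) \<odot> y) = (\<rho> (Dom Lambda_N h) \<odot> (Tarr ?fh \<odot> counit W (X ?m))) \<odot> y"
    using f h y by (simp add: a fh assoc)
  also have "\<dots> = b \<odot> (BA (Tarr f) \<odot> y)" unfolding eq' using f h y by (simp add: b fh assoc)
  finally show ?thesis .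
qed

text \<open>The equation for the identity of \<open>[n]\<close> at \<open>x = B(v) \<rho>\<^sub>D\<close> is colinearity of \<open>v\<close>.\<close>

lemma colinear_if_equalizes:
  assumes D: "D \<in> pseudo_para_cyclic C W" and v: "(D, v, T) \<in> Arr (PPC C W)"
    and eq: "\<forall>(a, b)\<in>colinearity_pairs n. a \<odot> lift (OMap D n) (underlying (v n)) = b \<odot> lift (OMap D n) (underlying (v n))"
  shows "v n \<in> Arr (CoMod C W)"
proof -
  let ?x = "lift (OMap D n) (underlying (v n))"
  have D_CB: "is_functor (op_cat Lambda_N) (CB C W) D"
    using D by (simp add: pseudo_para_cyclic_def Obj_functor_cat)
  have "nat_trans (op_cat Lambda_N) (CB C W) D T v" using v by (simp add: Arr_PPC)
  note vD = CB_nat_transD[OF this]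
  note [simp] = CB_functorD(1)[OF D_CB] CB_functorD(1)[OF T_functor]
    comoduleD(1-4)[OF CB_functorD(1)[OF D_CB]] vD(2-4)
  have lift_arr: "?x \<in> Arr C" "Dom C ?x = fst (OMap D n)" "Cod C ?x = BO (X n)"
    by (simp_all add: lift_def)
  have c: "counit W (X n) \<odot> ?x = underlying (v n)"
    using counit_lift[of "OMap D n" "underlying (v n)"] by simp
  have "(\<rho> n \<odot> (Tarr (arrN n [] n) \<odot> counit W (X n)), BA (Tarr (arrN n [] n))) \<in> colinearity_pairs n"
    unfolding colinearity_pairs_def by (intro image_eqI[of _ _ "arrN n [] n"]) simp_all
  with eq have "(\<rho> n \<odot> (Tarr (arrN n [] n) \<odot> counit W (X n))) \<odot> ?x = BA (Tarr (arrN n [] n)) \<odot> ?x"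
    by blast
  then have "\<rho> n \<odot> underlying (v n) = BA (underlying (v n)) \<odot> snd (OMap D n)"
    using lift_arr by (simp add: assoc c) (simp add: lift_def)
  then have "colinear (OMap D n) (underlying (v n)) (OMap T n)" by (simp add: colinear_def)
  then show ?thesis by (subst vD(1)) simp
qed

lemma approximation_PPC_colin: "\<exists>A u. is_approximation (PPC_colin C W) (CycCoMod C W) T A u"
proof -
  define P where "P n = insert (Tarr (tau_top n) \<odot> counit W (X n), counit W (X n)) (colinearity_pairs n)" for n
  show ?thesis
  proof (rule cyclic_comodule_cover[of P])
    fix n
    show "countable (P n)"
      using countable_Arr_Lambda_N by (auto simp: P_def colinearity_pairs_def intro: countable_subset)
    show "(Tarr (tau_top n) \<odot> counit W (X n), counit W (X n)) \<in> P n" by (simp add: P_def)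
  next
    fix n a b assume "(a, b) \<in> P n"
    then show "a \<in> Arr C \<and> b \<in> Arr C \<and> Dom C a = BO (X n) \<and> Dom C b = BO (X n) \<and> Cod C b = Cod C a"
      unfolding P_def colinearity_pairs_def insert_iff image_iff by (elim disjE bexE) simp_all
  next
    fix f y a b
    assume "f \<in> Arr Lambda_N" "y \<in> Arr C" "Cod C y = BO (X (Cod Lambda_N f))"
      "\<forall>(c, d)\<in>P (Cod Lambda_N f). c \<odot> y = d \<odot> y" "(a, b) \<in> P (Dom Lambda_N f)"
    then show "a \<odot> (BA (Tarr f) \<odot> y) = b \<odot> (BA (Tarr f) \<odot> y)"
      using tau_condition_stable[of f y] colinearity_pairs_stable[of f y a b] by (auto simp: P_def)
  next
    fix A u
    assume A: "A \<in> Obj (CycCoMod C W)" and u: "(A, u, T) \<in> Arr (PPC C W)" and u_eq: "equalizes P A u"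
      and factors: "\<And>D v. D \<in> Obj (CycCoMod C W) \<Longrightarrow> (D, v, T) \<in> Arr (PPC C W) \<Longrightarrow>
        equalizes P D v \<Longrightarrow> \<exists>!w. (D, w, A) \<in> Arr (CycCoMod C W) \<and> (\<forall>n. v n = u n \<odot>\<^bsub>CB C W\<^esub> w n)"
    have "(A, u, T) \<in> Arr (PPC_colin C W)"
      using u u_eq A Obj_CycCoMod_subset colinear_if_equalizes[OF _ u]
      by (simp add: Arr_PPC_colin subset_iff equalizes_def P_def)
    then have "is_approximation (PPC_colin C W) (CycCoMod C W) T A (A, u, T)"
    proof (rule approximation_if_factors[OF PPC_colin_restrict subcategory_PPC_colin A])
      fix D v assume D: "D \<in> Obj (CycCoMod C W)" and v: "(D, v, T) \<in> Arr (PPC_colin C W)"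
      have v': "(D, v, T) \<in> Arr (PPC C W)" using v by (simp add: Arr_PPC_colin)
      have "equalizes P D v"
        using tau_equalizes[OF D v'] colinearity_pairs_equalize[OF D v] by (auto simp: equalizes_def P_def)
      then show "\<exists>!w. (D, w, A) \<in> Arr (CycCoMod C W) \<and> (\<forall>n. v n = u n \<odot>\<^bsub>CB C W\<^esub> w n)"
        by (rule factors[OF D v'])
    qed
    then show ?thesis by blast
  qed
qed

end

theorem theorem4p8:
  fixes C :: "('o, 'a) category" and W :: "('o, 'a) comonad_data" and T :: "('o, 'a) para_obj"
  assumes "infinite (UNIV :: 's set)"
    and "category C" and "small_complete TYPE('s) C"
    and "comonad C W" and "left_exact TYPE('s) C (cfun W)"
    and "T \<in> pseudo_para_cyclic C W"
  shows "(\<exists>A u. is_approximation (PPC_colin C W) (CycCoMod C W) T A u) \<and>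
         (\<exists>A u. is_approximation (PPC C W) (CycCoMod C W) T A u)"
proof -
  interpret para_comodule C W "TYPE('s)" T
    using assms by (simp add: para_comodule_def para_comodule_axioms_def lex_comonad_def
        lex_comonad_axioms_def comonad_on_def comonad_on_axioms_def)
  show ?thesis using approximation_PPC_colin approximation_PPC by blast
qed

end
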